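(* Let $d\ge2$ and $p\in\left(2+\frac4d,2^*\right)$. Then there exists a sequence $\{\mu_n\}_{n\ge1}$ of positive real numbers with $\mu_n\to+\infty$ as $n\to+\infty$ such that, for every integer $n\ge1$, $\hat E_{\mathbb V^d_1}$ has at least two distinct positive critical points $u_{n,1}$ and $u_{n,2}$ in $H^1_{\mu_n}(\mathbb V^d_1)$, where $u_{n,1}$ is a positive ground state of $\hat E_{\mathbb V^d_1}$ in $H^1_{\mu_n}(\mathbb V^d_1)$ and $u_{n,2}$ is a positive ground state of $\hat J_{\omega_n,\mathbb V^d_1}$ for some $\omega_n>0$. Moreover, $$\hat E_{\mathbb V^d_1}(u_{n,2})>\hat E_{\mathbb V^d_1}(u_{n,1})=\hat{\mathcal E}_{\mathbb V^d_1}(\mu_n)\qquad\text{for every integer }n\ge1,$$ and $$\mathcal L_{\mathbb V^d_1}(u_{n,1})\to+\infty\quad\text{and}\quad\mathcal L_{\mathbb V^d_1}(u_{n,2})\to0\qquad\text{as }n\to+\infty .$$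
   Context: $2^*=\infty$ if $d=2$ and $2^*=\frac{2d}{d-2}$ if $d\ge3$. $\mathbb V^d_1=\mathbb Z^d$, with $x\sim y$ iff $\sum_{i=1}^d|x_i-y_i|=1$. $\|\cdot\|_{\ell^q}$ is the usual $\ell^q(\mathbb Z^d)$ norm, and $\|\nabla^d_1u\|^2_{\ell^2}=\frac12\sum_{x\in\mathbb Z^d}\sum_{y\sim x}|u(y)-u(x)|^2$. $H^1(\mathbb V^d_1)$ is the completion of the finitely supported real functions under $(\|\nabla^d_1u\|^2_{\ell^2}+\|u\|^2_{\ell^2})^{1/2}$. Energy: for $\mu>0$, $H^1_\mu(\mathbb V^d_1)=\{u\in H^1(\mathbb V^d_1):\|u\|^2_{\ell^2}=\mu\}$; $\hat E_{\mathbb V^d_1}(u)=\frac12\|\nabla^d_1u\|^2_{\ell^2}-\frac1p\|u\|^p_{\ell^p}$; $\hat{\mathcal E}_{\mathbb V^d_1}(\mu)=\inf_{H^1_\mu(\mathbb V^d_1)}\hat E_{\mathbb V^d_1}$; a ground state of $\hat E_{\mathbb V^d_1}$ in $H^1_\mu(\mathbb V^d_1)$ is a minimizer. A critical point of $\hat E_{\mathbb V^d_1}$ in $H^1_\mu(\mathbb V^d_1)$ means a critical point of $\hat E_{\mathbb V^d_1}$ constrained to $H^1_\mu(\mathbb V^d_1)$. $\mathcal L_{\mathbb V^d_1}(u)=\dfrac{\|u\|^p_{\ell^p}-\|\nabla^d_1u\|^2_{\ell^2}}{\|u\|^2_{\ell^2}}$. Action: for $\omega>0$, $\hat J_{\omega,\mathbb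 V^d_1}(u)=\frac12\|\nabla^d_1u\|^2_{\ell^2}+\frac\omega2\|u\|^2_{\ell^2}-\frac1p\|u\|^p_{\ell^p}$; a ground state of $\hat J_{\omega,\mathbb V^d_1}$ is a minimizer of $\hat J_{\omega,\mathbb V^d_1}$ on $\hat{\mathcal N}_{\omega,\mathbb V^d_1}=\{u\in H^1(\mathbb V^d_1)\setminus\{0\}:\|\nabla^d_1u\|^2_{\ell^2}+\omega\|u\|^2_{\ell^2}=\|u\|^p_{\ell^p}\}$. *)

theory Defs
  imports "HOL-Analysis.Analysis"
begin

text \<open>
  The lattice of dimension \<open>d\<close> is the type \<open>int ^ 'd\<close>, where \<open>d = CARD('d)\<close>.
\<close>

definition lattice_adj :: "int ^ 'd \<Rightarrow> int ^ 'd \<Rightarrow> bool" where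
  "lattice_adj x y \<longleftrightarrow> (\<Sum>i\<in>UNIV. \<bar>x $ i - y $ i\<bar>) = 1"

lemma finite_lattice_neighbours: "finite {y :: int ^ 'd. lattice_adj x y}"
proof (rule finite_subset)
  show "{y. lattice_adj x y} \<subseteq> vec_lambda ` (\<Pi>\<^sub>E i\<in>UNIV. {x $ i - 1..x $ i + 1})"
  proof
    fix y assume "y \<in> {y. lattice_adj x y}"
    then have s: "(\<Sum>i\<in>UNIV. \<bar>x $ i - y $ i\<bar>) = 1"
      by (simp add: lattice_adj_def)
    have "\<bar>x $ i - y $ i\<bar> \<le> 1" for i
      using member_le_sum[of i UNIV "\<lambda>i. \<bar>x $ i - y $ i\<bar>"] s by simp
    then have "x $ i - 1 \<le> y $ i \<and> y $ i \<le> x $ i + 1" for i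
      by (smt (verit))
    then have "vec_nth y \<in> (\<Pi>\<^sub>E i\<in>UNIV. {x $ i - 1..x $ i + 1})"
      by auto
    then show "y \<in> vec_lambda ` (\<Pi>\<^sub>E i\<in>UNIV. {x $ i - 1..x $ i + 1})"
      by (metis image_eqI vec_nth_inverse)
  qed
  show "finite (vec_lambda ` (\<Pi>\<^sub>E i\<in>UNIV. {x $ i - 1..x $ i + 1}))"
    by (intro finite_imageI finite_PiE) auto
qed

definition sobolev_exponent :: "nat \<Rightarrow> ereal" where
  "sobolev_exponent d = (if d = 2 then \<infinity> else ereal (2 * real d / (real d - 2)))"

text \<open>
  The (unordered) sums below take the value 0 when they do not converge. They are only evaluated at
  finitely supported functions and at elements of \<open>H1\<close>; for these they converge, as
  \<open>H1\<close> is contained in every \<open>\<ell>\<^sup>q\<close> with \<open>q \<ge> 2\<close>.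
\<close>

definition lq_norm :: "real \<Rightarrow> (int ^ 'd \<Rightarrow> real) \<Rightarrow> real" where
  "lq_norm q u = (\<Sum>\<^sub>\<infinity>x\<in>UNIV. \<bar>u x\<bar> powr q) powr (1 / q)"

definition grad_norm_sq :: "(int ^ 'd \<Rightarrow> real) \<Rightarrow> real" where
  "grad_norm_sq u = 1 / 2 * (\<Sum>\<^sub>\<infinity>x\<in>UNIV. \<Sum>y\<in>{y. lattice_adj x y}. \<bar>u y - u x\<bar>\<^sup>2)"

definition H1_norm :: "(int ^ 'd \<Rightarrow> real) \<Rightarrow> real" where
  "H1_norm u = sqrt (grad_norm_sq u + (lq_norm 2 u)\<^sup>2)"

text \<open>
  The completion of the finitely supported functions is realised inside the space of all functions:
  \<open>|u x| \<le> H1_norm u\<close> for finitely supported \<open>u\<close>, so a Cauchy sequence converges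
  pointwise, and its class in the completion is identified with its pointwise limit.
\<close>

definition H1 :: "(int ^ 'd \<Rightarrow> real) set" where
  "H1 = {u. \<exists>\<phi> :: nat \<Rightarrow> int ^ 'd \<Rightarrow> real.
      (\<forall>n. finite {x. \<phi> n x \<noteq> 0}) \<and>
      (\<forall>\<epsilon>>0. \<exists>N. \<forall>m\<ge>N. \<forall>n\<ge>N. H1_norm (\<lambda>x. \<phi> m x - \<phi> n x) < \<epsilon>) \<and>
      (\<forall>x. (\<lambda>n. \<phi> n x) \<longlonglongrightarrow> u x)}"

definition H1_mass :: "real \<Rightarrow> (int ^ 'd \<Rightarrow> real) set" where
  "H1_mass \<mu> = {u \<in> H1. (lq_norm 2 u)\<^sup>2 = \<mu>}"

definition energy :: "real \<Rightarrow> (int ^ 'd \<Rightarrow> real) \<Rightarrow> real" where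
  "energy p u = 1 / 2 * grad_norm_sq u - 1 / p * lq_norm p u powr p"

text \<open>
  For \<open>p \<ge> 2\<close> and \<open>\<mu> > 0\<close> the real infimum is taken over a nonempty set and
  the energy is bounded below by \<open>- \<mu> powr (p / 2) / p\<close> on it, since \<open>\<ell>\<^sup>2\<close> embeds in \<open>\<ell>\<^sup>p\<close> with norm 1.
\<close>

definition ground_energy :: "real \<Rightarrow> 'd::finite itself \<Rightarrow> real \<Rightarrow> real" where
  "ground_energy p d \<mu> = (INF u\<in>(H1_mass \<mu> :: (int ^ 'd \<Rightarrow> real) set). energy p u)"

definition energy_ground_state :: "real \<Rightarrow> real \<Rightarrow> (int ^ 'd \<Rightarrow> real) \<Rightarrow> bool" where
  "energy_ground_state p \<mu> u \<longleftrightarrow>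
     u \<in> H1_mass \<mu> \<and> (\<forall>v\<in>(H1_mass \<mu> :: (int ^ 'd \<Rightarrow> real) set). energy p u \<le> energy p v)"

text \<open>
  \<open>D\<close> is the Frechet differential at \<open>u\<close> of the functional \<open>F\<close> on the Hilbert space \<open>H1\<close>.
\<close>

definition H1_has_differential ::
    "((int ^ 'd \<Rightarrow> real) \<Rightarrow> real) \<Rightarrow> (int ^ 'd \<Rightarrow> real) \<Rightarrow> ((int ^ 'd \<Rightarrow> real) \<Rightarrow> real) \<Rightarrow> bool" where
  "H1_has_differential F u D \<longleftrightarrow>
     (\<forall>v\<in>H1. \<forall>w\<in>H1. \<forall>a b. D (\<lambda>x. a * v x + b * w x) = a * D v + b * D w) \<and>
     (\<exists>C. \<forall>v\<in>H1. \<bar>D v\<bar> \<le> C * H1_norm v) \<and>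
     (\<forall>\<epsilon>>0. \<exists>\<delta>>0. \<forall>v\<in>H1. H1_norm v < \<delta> \<longrightarrow>
        \<bar>F (\<lambda>x. u x + v x) - F u - D v\<bar> \<le> \<epsilon> * H1_norm v)"

text \<open>
  Constrained critical points: the differential of the energy vanishes on the tangent space
  at \<open>u\<close> of the sphere \<open>H1_mass \<mu>\<close>, which is the \<open>\<ell>\<^sup>2\<close>-orthogonal complement of \<open>u\<close> in \<open>H1\<close>.
\<close>

definition energy_critical_point :: "real \<Rightarrow> real \<Rightarrow> (int ^ 'd \<Rightarrow> real) \<Rightarrow> bool" where
  "energy_critical_point p \<mu> u \<longleftrightarrow> u \<in> H1_mass \<mu> \<and>
     (\<exists>D. H1_has_differential (energy p) u D \<and>
          (\<forall>v\<in>H1. (\<Sum>\<^sub>\<infinity>x\<in>UNIV. u x * v x) = 0 \<longrightarrow> D v = 0))"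

definition multiplier :: "real \<Rightarrow> (int ^ 'd \<Rightarrow> real) \<Rightarrow> real" where
  "multiplier p u = (lq_norm p u powr p - grad_norm_sq u) / (lq_norm 2 u)\<^sup>2"

definition action :: "real \<Rightarrow> real \<Rightarrow> (int ^ 'd \<Rightarrow> real) \<Rightarrow> real" where
  "action p \<omega> u =
     1 / 2 * grad_norm_sq u + \<omega> / 2 * (lq_norm 2 u)\<^sup>2 - 1 / p * lq_norm p u powr p"

definition nehari :: "real \<Rightarrow> real \<Rightarrow> (int ^ 'd \<Rightarrow> real) set" where
  "nehari p \<omega> =
     {u \<in> H1. u \<noteq> (\<lambda>x. 0) \<and> grad_norm_sq u + \<omega> * (lq_norm 2 u)\<^sup>2 = lq_norm p u powr p}"

definition action_ground_state :: "real \<Rightarrow> real \<Rightarrow> (int ^ 'd \<Rightarrow> real) \<Rightarrow> bool" where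
  "action_ground_state p \<omega> u \<longleftrightarrow>
     u \<in> nehari p \<omega> \<and> (\<forall>v\<in>(nehari p \<omega> :: (int ^ 'd \<Rightarrow> real) set). action p \<omega> u \<le> action p \<omega> v)"

definition positive_fun :: "(int ^ 'd \<Rightarrow> real) \<Rightarrow> bool" where
  "positive_fun u \<longleftrightarrow> (\<forall>x. 0 < u x)"

end

theory Submission
  imports Defs "HOL-Complex_Analysis.Great_Picard"
begin

text \<open>
  \<open>H1\<close> is \<open>\<ell>\<^sup>2\<close> with an equivalent norm. Minimizing sequences for the energy at fixed mass, and
  for the \<open>p\<close>-th power sum on the Nehari manifold, do not vanish uniformly. After translation they
  have a nonzero pointwise limit, from which the remainder decouples (Brezis-Lieb), and strict
  subadditivity excludes that mass is lost. So energy ground states exist whenever the minimal energy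
  is negative, in particular for all large masses, and action ground states exist for every
  \<open>\<omega> > 0\<close>.

  Since \<open>p < 2\<^sup>*\<close>, rescaled tents show that the minimal action tends to 0 as \<open>\<omega>\<close> does, so action ground
  states become uniformly small. Since \<open>p > 2 + 4 / d\<close>, a Nash type inequality bounds the \<open>p\<close>-th power
  sum by the gradient norm for uniformly small functions of bounded mass, which is impossible on the
  Nehari manifold. Hence the masses of action ground states tend to infinity as \<open>\<omega> \<rightarrow> 0\<close>. Their
  multiplier is \<open>\<omega>\<close>, whereas comparison with a point mass shows that the multiplier of an energy ground
  state of mass \<open>\<mu>\<close> is at least \<open>\<mu> powr (p / 2 - 1)\<close> up to a constant. So the two differ, and the action
  ground state is not a minimizer of the energy.
\<close>

section \<open>Powers of the absolute value\<close>

text \<open>The mass of an action ground state cannot be prescribed: it is known only once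
  \<open>\<omega>\<close> is fixed. So the construction runs from \<open>\<omega>\<close> to
  \<open>\<mu>\<close>: the action ground state comes first, and the energy ground state is then
  taken at the mass found. This gives a sequence of masses rather than all large ones. Both states
  are critical on the same sphere because, at fixed mass, action and energy differ by a constant.

  The two states live at opposite scales. At large mass the lattice favours concentration: the
  gradient term is at most linear in the mass, whereas a point mass has a power sum of superlinear
  size \<open>\<mu> powr (p / 2)\<close>. At small amplitude functions spread over many points and
  Euclidean scaling governs them. There the two bounds on \<open>p\<close> become signs of
  exponents: a dyadic layer of height \<open>t\<close> contributes a multiple of
  \<open>t powr (p - 2 - 4 / d)\<close>, and a power of the minimal action is compared with the
  radius to the power \<open>p * (d - 2) - 2 * d\<close>, which is negative below the Sobolev
  exponent.\<close>

lemma abs_powr_eq_mult: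
  fixes s r :: real
  shows "\<bar>s\<bar> powr r = \<bar>s\<bar> powr (r - 1) * \<bar>s\<bar>"
  using powr_mult_base[of "\<bar>s\<bar>" "r - 1"] by (simp add: mult.commute)

lemma abs_powr_tendsto_0:
  fixes r :: real
  assumes "0 < r"
  shows "((\<lambda>h. \<bar>h\<bar> powr r) \<longlongrightarrow> 0) (at 0)"
proof -
  have "((\<lambda>h::real. \<bar>h\<bar>) \<longlongrightarrow> 0) (at 0)"
    by (simp add: tendsto_rabs_zero_iff)
  from tendsto_powr'[OF this tendsto_const[of r]] show ?thesis
    using assms by simp
qed

text \<open>Away from 0 this is the power rule on a half line. At 0 the difference quotient is
  bounded by \<open>\<bar>h\<bar> powr (r - 1)\<close>, which tends to 0 because
  \<open>1 < r\<close>.\<close>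

lemma abs_powr_has_real_derivative:
  fixes r s :: real
  assumes "1 < r"
  shows "((\<lambda>s. \<bar>s\<bar> powr r) has_real_derivative r * (sgn s * \<bar>s\<bar> powr (r - 1))) (at s)"
proof -
  consider "s > 0" | "s < 0" | "s = 0" by linarith
  then show ?thesis
  proof cases
    case 1
    have "((\<lambda>s. s powr r) has_real_derivative r * (sgn s * \<bar>s\<bar> powr (r - 1))) (at s)"
      using 1 by (auto intro!: derivative_eq_intros)
    then show ?thesis
      by (rule has_field_derivative_transform_within_open[where S = "{0<..}"]) (use 1 in auto)
  next
    case 2
    have "((\<lambda>s. (- s) powr r) has_real_derivative r * (sgn s * \<bar>s\<bar> powr (r - 1))) (at s)"
      using 2 by (auto intro!: derivative_eq_intros)
    then show ?thesis
      by (rule has_field_derivative_transform_within_open[where S = "{..<0}"]) (use 2 in auto)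
  next
    case 3
    have "((\<lambda>h. \<bar>h\<bar> powr (r - 1)) \<longlongrightarrow> 0) (at (0::real))"
      using assms by (intro abs_powr_tendsto_0) simp
    moreover have "\<bar>\<bar>h\<bar> powr r / h\<bar> \<le> \<bar>h\<bar> powr (r - 1)" for h :: real
    proof (cases "h = 0")
      case False
      then have "\<bar>h\<bar> powr r / \<bar>h\<bar> = \<bar>h\<bar> powr (r - 1)"
        by (subst abs_powr_eq_mult) simp
      then show ?thesis
        by (simp add: abs_divide)
    qed simp
    then have "\<forall>\<^sub>F h in at (0::real). norm (\<bar>h\<bar> powr r / h) \<le> \<bar>h\<bar> powr (r - 1)"
      unfolding real_norm_def by (intro always_eventually allI)
    ultimately have "((\<lambda>h. \<bar>h\<bar> powr r / h) \<longlongrightarrow> 0) (at (0::real))"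
      by (rule Lim_null_comparison[rotated])
    then show ?thesis
      using 3 by (simp add: DERIV_def)
  qed
qed

text \<open>With \<open>r = p - 1\<close> this yields the second derivative of
  \<open>\<bar>s\<bar> powr p\<close>, which exists even at 0 because \<open>2 < p\<close>.\<close>

lemma sgn_abs_powr_has_real_derivative:
  fixes r s :: real
  assumes "1 < r"
  shows "((\<lambda>s. sgn s * \<bar>s\<bar> powr r) has_real_derivative r * \<bar>s\<bar> powr (r - 1)) (at s)"
proof -
  consider "s > 0" | "s < 0" | "s = 0" by linarith
  then show ?thesis
  proof cases
    case 1
    have "((\<lambda>s. s powr r) has_real_derivative r * \<bar>s\<bar> powr (r - 1)) (at s)"
      using 1 by (auto intro!: derivative_eq_intros)
    then show ?thesis
      by (rule has_field_derivative_transform_within_open[where S = "{0<..}"]) (use 1 in auto)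
  next
    case 2
    have "((\<lambda>s. - ((- s) powr r)) has_real_derivative r * \<bar>s\<bar> powr (r - 1)) (at s)"
      using 2 by (auto intro!: derivative_eq_intros)
    then show ?thesis
      by (rule has_field_derivative_transform_within_open[where S = "{..<0}"]) (use 2 in auto)
  next
    case 3
    have "((\<lambda>h. \<bar>h\<bar> powr (r - 1)) \<longlongrightarrow> 0) (at (0::real))"
      using assms by (intro abs_powr_tendsto_0) simp
    moreover have "\<bar>sgn h * \<bar>h\<bar> powr r / h\<bar> \<le> \<bar>h\<bar> powr (r - 1)" for h :: real
    proof (cases "h = 0")
      case False
      then have "\<bar>h\<bar> powr r / \<bar>h\<bar> = \<bar>h\<bar> powr (r - 1)"
        by (subst abs_powr_eq_mult) simp
      then show ?thesis
        using False by (simp add: abs_divide abs_mult abs_sgn_eq)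
    qed simp
    then have "\<forall>\<^sub>F h in at (0::real). norm (sgn h * \<bar>h\<bar> powr r / h) \<le> \<bar>h\<bar> powr (r - 1)"
      unfolding real_norm_def by (intro always_eventually allI)
    ultimately have "((\<lambda>h. sgn h * \<bar>h\<bar> powr r / h) \<longlongrightarrow> 0) (at (0::real))"
      by (rule Lim_null_comparison[rotated])
    then show ?thesis
      using 3 by (simp add: DERIV_def)
  qed
qed

text \<open>Locating \<open>\<xi>\<close> by its distance from \<open>a\<close> treats both orders
  of \<open>a\<close> and \<open>b\<close>, and \<open>a = b\<close>, at once.\<close>

lemma real_mvt_between:
  fixes f :: "real \<Rightarrow> real"
  assumes "\<And>x. (f has_real_derivative f' x) (at x)"
  obtains \<xi> where "\<bar>\<xi> - a\<bar> \<le> \<bar>b - a\<bar>" "f b - f a = (b - a) * f' \<xi>"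
proof -
  consider "a < b" | "b < a" | "a = b" by linarith
  then show thesis
  proof cases
    case 1
    then obtain z where "z > a" "z < b" "f b - f a = (b - a) * f' z"
      using MVT2[of a b f f'] assms by metis
    then show thesis using that[of z] by auto
  next
    case 2
    then obtain z where "z > b" "z < a" "f a - f b = (a - b) * f' z"
      using MVT2[of b a f f'] assms by metis
    then show thesis using that[of z] by (auto simp: algebra_simps)
  next
    case 3
    then show thesis using that[of a] by auto
  qed
qed

lemma abs_powr_diff_le:
  fixes s t q :: real
  assumes "1 < q"
  shows "\<bar>\<bar>s + t\<bar> powr q - \<bar>s\<bar> powr q\<bar> \<le> q * (\<bar>s\<bar> + \<bar>t\<bar>) powr (q - 1) * \<bar>t\<bar>"
proof -
  obtain \<xi> where \<xi>: "\<bar>\<xi> - s\<bar> \<le> \<bar>s + t - s\<bar>"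
      "\<bar>s + t\<bar> powr q - \<bar>s\<bar> powr q = (s + t - s) * (q * (sgn \<xi> * \<bar>\<xi>\<bar> powr (q - 1)))"
    using real_mvt_between[OF abs_powr_has_real_derivative[OF assms], of s "s + t"] by blast
  have "\<bar>\<xi>\<bar> powr (q - 1) \<le> (\<bar>s\<bar> + \<bar>t\<bar>) powr (q - 1)"
    using \<xi>(1) assms by (intro powr_mono2) auto
  moreover have "\<bar>sgn \<xi> * \<bar>\<xi>\<bar> powr (q - 1)\<bar> \<le> \<bar>\<xi>\<bar> powr (q - 1)"
    by (simp add: abs_mult sgn_if)
  ultimately have "q * \<bar>sgn \<xi> * \<bar>\<xi>\<bar> powr (q - 1)\<bar> \<le> q * (\<bar>s\<bar> + \<bar>t\<bar>) powr (q - 1)"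
    using assms by (intro mult_left_mono) linarith+
  then have "\<bar>t\<bar> * (q * \<bar>sgn \<xi> * \<bar>\<xi>\<bar> powr (q - 1)\<bar>) \<le> \<bar>t\<bar> * (q * (\<bar>s\<bar> + \<bar>t\<bar>) powr (q - 1))"
    by (rule mult_left_mono) auto
  then show ?thesis
    unfolding \<xi>(2) using assms by (simp add: abs_mult mult_ac)
qed

text \<open>Two applications of the mean value theorem, to the power and then to its derivative; the
  second needs \<open>1 < p - 1\<close>. The quadratic remainder is what later gives
  differentiability on the whole space.\<close>

lemma abs_powr_taylor:
  fixes s t p :: real
  assumes "2 < p"
  shows "\<bar>\<bar>s + t\<bar> powr p - \<bar>s\<bar> powr p - p * (sgn s * \<bar>s\<bar> powr (p - 1)) * t\<bar>
     \<le> p * (p - 1) * (\<bar>s\<bar> + \<bar>t\<bar>) powr (p - 2) * t\<^sup>2"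
proof -
  have p: "1 < p" "1 < p - 1" using assms by auto
  obtain \<xi> where \<xi>: "\<bar>\<xi> - s\<bar> \<le> \<bar>s + t - s\<bar>"
      "\<bar>s + t\<bar> powr p - \<bar>s\<bar> powr p = (s + t - s) * (p * (sgn \<xi> * \<bar>\<xi>\<bar> powr (p - 1)))"
    using real_mvt_between[OF abs_powr_has_real_derivative[OF p(1)], of s "s + t"] by blast
  obtain \<eta> where \<eta>: "\<bar>\<eta> - s\<bar> \<le> \<bar>\<xi> - s\<bar>"
      "sgn \<xi> * \<bar>\<xi>\<bar> powr (p - 1) - sgn s * \<bar>s\<bar> powr (p - 1) = (\<xi> - s) * ((p - 1) * \<bar>\<eta>\<bar> powr (p - 1 - 1))"
    using real_mvt_between[OF sgn_abs_powr_has_real_derivative[OF p(2)], of s \<xi>] by blast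
  have "\<bar>\<eta>\<bar> powr (p - 2) \<le> (\<bar>s\<bar> + \<bar>t\<bar>) powr (p - 2)"
    using \<xi>(1) \<eta>(1) assms by (intro powr_mono2) auto
  then have "\<bar>\<xi> - s\<bar> * \<bar>\<eta>\<bar> powr (p - 2) \<le> \<bar>t\<bar> * (\<bar>s\<bar> + \<bar>t\<bar>) powr (p - 2)"
    using \<xi>(1) by (intro mult_mono) auto
  then have "(p * (p - 1) * \<bar>t\<bar>) * (\<bar>\<xi> - s\<bar> * \<bar>\<eta>\<bar> powr (p - 2))
      \<le> (p * (p - 1) * \<bar>t\<bar>) * (\<bar>t\<bar> * (\<bar>s\<bar> + \<bar>t\<bar>) powr (p - 2))"
    by (rule mult_left_mono) (use assms in simp)
  moreover have "\<bar>s + t\<bar> powr p - \<bar>s\<bar> powr p - p * (sgn s * \<bar>s\<bar> powr (p - 1)) * t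
      = p * t * ((\<xi> - s) * ((p - 1) * \<bar>\<eta>\<bar> powr (p - 2)))"
  proof -
    have "\<bar>s + t\<bar> powr p - \<bar>s\<bar> powr p - p * (sgn s * \<bar>s\<bar> powr (p - 1)) * t
        = p * t * (sgn \<xi> * \<bar>\<xi>\<bar> powr (p - 1) - sgn s * \<bar>s\<bar> powr (p - 1))"
      unfolding \<xi>(2) by (simp only: add_diff_cancel_left' right_diff_distrib mult_ac)
    then show ?thesis
      unfolding \<eta>(2) by simp
  qed
  moreover have "\<bar>p * t * ((\<xi> - s) * ((p - 1) * \<bar>\<eta>\<bar> powr (p - 2)))\<bar>
      = (p * (p - 1) * \<bar>t\<bar>) * (\<bar>\<xi> - s\<bar> * \<bar>\<eta>\<bar> powr (p - 2))"
    using assms by (simp add: abs_mult)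
  moreover have "(p * (p - 1) * \<bar>t\<bar>) * (\<bar>t\<bar> * (\<bar>s\<bar> + \<bar>t\<bar>) powr (p - 2))
      = p * (p - 1) * (\<bar>s\<bar> + \<bar>t\<bar>) powr (p - 2) * t\<^sup>2"
    by (simp add: power2_eq_square)
  ultimately show ?thesis
    by simp
qed

text \<open>The error is measured by squares instead of \<open>q\<close>-th powers because the
  masses are what is bounded: \<open>t\<close> will be a remainder of bounded mass, so its term is
  made small by \<open>\<epsilon>\<close>, and \<open>s\<close> a fixed function, whose term is
  small off a finite set.\<close>

lemma brezis_lieb_pointwise:
  fixes q R \<epsilon> :: real
  assumes "2 \<le> q" "0 \<le> R" "0 < \<epsilon>"
  obtains C where "0 \<le> C"
    "\<And>s t. \<bar>s\<bar> \<le> R \<Longrightarrow> \<bar>t\<bar> \<le> R \<Longrightarrow> 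
       \<bar>\<bar>s + t\<bar> powr q - \<bar>t\<bar> powr q - \<bar>s\<bar> powr q\<bar> \<le> \<epsilon> * t\<^sup>2 + C * s\<^sup>2"
proof -
  \<comment> \<open>In \<open>q + 1\<close>, the \<open>q\<close> comes from the mean value bound
    and the 1 from the term \<open>\<bar>s\<bar> powr q\<close>; \<open>2 * R\<close> bounds
    \<open>\<bar>s\<bar> + \<bar>t\<bar>\<close>.\<close>
  define K where "K = (q + 1) * (2 * R) powr (q - 2)"
  have K: "0 \<le> K" using assms by (simp add: K_def)
  show thesis
  proof
    show "0 \<le> K + K\<^sup>2 / \<epsilon>" using assms K by simp
    fix s t :: real
    assume st: "\<bar>s\<bar> \<le> R" "\<bar>t\<bar> \<le> R"
    let ?a = "\<bar>s\<bar> + \<bar>t\<bar>"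
    have split: "?a powr (q - 1) = ?a powr (q - 2) * ?a"
      using abs_powr_eq_mult[of ?a "q - 1"] by simp
    have le: "?a powr (q - 2) \<le> (2 * R) powr (q - 2)"
      using st assms by (intro powr_mono2) auto
    have "\<bar>\<bar>s + t\<bar> powr q - \<bar>t\<bar> powr q - \<bar>s\<bar> powr q\<bar>
        \<le> \<bar>\<bar>t + s\<bar> powr q - \<bar>t\<bar> powr q\<bar> + \<bar>\<bar>s\<bar> powr q\<bar>"
      unfolding add.commute[of s t] by (rule abs_triangle_ineq4)
    also have "\<dots> \<le> q * ?a powr (q - 1) * \<bar>s\<bar> + ?a powr (q - 1) * \<bar>s\<bar>"
    proof (rule add_mono)
      show "\<bar>\<bar>t + s\<bar> powr q - \<bar>t\<bar> powr q\<bar> \<le> q * ?a powr (q - 1) * \<bar>s\<bar>"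
        using abs_powr_diff_le[of q t s] assms by (simp add: add.commute)
      have "\<bar>s\<bar> powr (q - 1) * \<bar>s\<bar> \<le> ?a powr (q - 1) * \<bar>s\<bar>"
        using assms by (intro mult_right_mono powr_mono2) auto
      then show "\<bar>\<bar>s\<bar> powr q\<bar> \<le> ?a powr (q - 1) * \<bar>s\<bar>"
        using abs_powr_eq_mult[of s q] by simp
    qed
    also have "\<dots> = (q + 1) * ?a powr (q - 1) * \<bar>s\<bar>"
      by (simp add: distrib_right)
    also have "\<dots> = (q + 1) * ?a powr (q - 2) * (?a * \<bar>s\<bar>)"
      by (simp add: split)
    also have "\<dots> \<le> K * (?a * \<bar>s\<bar>)"
      unfolding K_def using le assms by (intro mult_right_mono mult_left_mono) auto
    also have "\<dots> = K * s\<^sup>2 + K * \<bar>s\<bar> * \<bar>t\<bar>"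
      by (simp add: algebra_simps power2_eq_square)
    also have "\<dots> \<le> K * s\<^sup>2 + (\<epsilon> * t\<^sup>2 + K\<^sup>2 / \<epsilon> * s\<^sup>2)"
    proof -
      \<comment> \<open>Young's inequality moves the weight onto \<open>s\<^sup>2\<close> and leaves
        only \<open>\<epsilon>\<close> in front of \<open>t\<^sup>2\<close>.\<close>
      have "0 \<le> (\<epsilon> * \<bar>t\<bar> - K * \<bar>s\<bar>)\<^sup>2" by simp
      then have "2 * \<epsilon> * (K * \<bar>s\<bar> * \<bar>t\<bar>) \<le> \<epsilon>\<^sup>2 * t\<^sup>2 + K\<^sup>2 * s\<^sup>2"
        by (simp add: power2_diff power_mult_distrib mult_ac)
      moreover have "0 \<le> \<epsilon> * (K * \<bar>s\<bar> * \<bar>t\<bar>)" using assms K by simp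
      ultimately have "\<epsilon> * (K * \<bar>s\<bar> * \<bar>t\<bar>) \<le> \<epsilon>\<^sup>2 * t\<^sup>2 + K\<^sup>2 * s\<^sup>2"
        by linarith
      also have "\<dots> = \<epsilon> * (\<epsilon> * t\<^sup>2 + K\<^sup>2 / \<epsilon> * s\<^sup>2)"
        using assms by (simp add: field_simps power2_eq_square)
      finally show ?thesis using assms by simp
    qed
    finally show "\<bar>\<bar>s + t\<bar> powr q - \<bar>t\<bar> powr q - \<bar>s\<bar> powr q\<bar> \<le> \<epsilon> * t\<^sup>2 + (K + K\<^sup>2 / \<epsilon>) * s\<^sup>2"
      by (simp add: algebra_simps)
  qed
qed

section \<open>Square summable functions\<close>

definition sq_summable :: "('a \<Rightarrow> real) set" where
  "sq_summable = {u. (\<lambda>x. (u x)\<^sup>2) summable_on UNIV}"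

definition sqsum :: "('a \<Rightarrow> real) \<Rightarrow> real" where
  "sqsum u = (\<Sum>\<^sub>\<infinity>x\<in>UNIV. (u x)\<^sup>2)"

definition pairing :: "('a \<Rightarrow> real) \<Rightarrow> ('a \<Rightarrow> real) \<Rightarrow> real" where
  "pairing u v = (\<Sum>\<^sub>\<infinity>x\<in>UNIV. u x * v x)"

definition powsum :: "real \<Rightarrow> ('a \<Rightarrow> real) \<Rightarrow> real" where
  "powsum q u = (\<Sum>\<^sub>\<infinity>x\<in>UNIV. \<bar>u x\<bar> powr q)"

lemma summable_on_real_comparison:
  fixes f g :: "'a \<Rightarrow> real"
  assumes "f summable_on A" "\<And>x. x \<in> A \<Longrightarrow> \<bar>g x\<bar> \<le> f x"
  shows "g summable_on A"
proof -
  have "(\<lambda>x. \<bar>g x\<bar>) summable_on A"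
    by (rule summable_on_comparison_test[OF assms]) simp_all
  then show ?thesis
    by (subst summable_on_iff_abs_summable_on_real) simp
qed

lemma summable_on_real_diff:
  fixes f g :: "'a \<Rightarrow> real"
  assumes "f summable_on A" "g summable_on A"
  shows "(\<lambda>x. f x - g x) summable_on A"
  using summable_on_add[of f A "\<lambda>x. - g x"] assms by (simp add: summable_on_uminus)

lemma infsum_real_diff:
  fixes f g :: "'a \<Rightarrow> real"
  assumes "f summable_on A" "g summable_on A"
  shows "infsum (\<lambda>x. f x - g x) A = infsum f A - infsum g A"
  using infsum_add[of f A "\<lambda>x. - g x"] assms by (simp add: summable_on_uminus infsum_uminus)

lemma sq_summableI:
  assumes "\<And>F. finite F \<Longrightarrow> (\<Sum>x\<in>F. (u x)\<^sup>2) \<le> K"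
  shows "u \<in> sq_summable" "sqsum u \<le> K"
proof -
  show *: "u \<in> sq_summable"
    unfolding sq_summable_def using assms
    by (auto intro!: nonneg_bdd_above_summable_on bdd_aboveI2[where M = K])
  show "sqsum u \<le> K"
    using * assms by (auto simp: sqsum_def sq_summable_def intro!: infsum_le_finite_sums)
qed

lemma sum_le_sqsum:
  assumes "u \<in> sq_summable" "finite F"
  shows "(\<Sum>x\<in>F. (u x)\<^sup>2) \<le> sqsum u"
  using assms unfolding sqsum_def sq_summable_def by (intro finite_sum_le_infsum) auto

lemma sq_le_sqsum: "u \<in> sq_summable \<Longrightarrow> (u x)\<^sup>2 \<le> sqsum u"
  using sum_le_sqsum[of u "{x}"] by simp

lemma abs_le_sqrt_sqsum: "u \<in> sq_summable \<Longrightarrow> \<bar>u x\<bar> \<le> sqrt (sqsum u)"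
  using real_sqrt_le_mono[OF sq_le_sqsum] by fastforce

lemma sqsum_nonneg [simp]: "0 \<le> sqsum u"
  unfolding sqsum_def by (rule infsum_nonneg) simp

lemma sqsum_eq_0_iff:
  assumes "u \<in> sq_summable"
  shows "sqsum u = 0 \<longleftrightarrow> u = (\<lambda>x. 0)"
proof
  assume "sqsum u = 0"
  then have "u x = 0" for x
    using sq_le_sqsum[OF assms, of x] by simp
  then show "u = (\<lambda>x. 0)" by auto
qed (simp add: sqsum_def)

lemma sqsum_pos: "u \<in> sq_summable \<Longrightarrow> u \<noteq> (\<lambda>x. 0) \<Longrightarrow> 0 < sqsum u"
  using sqsum_eq_0_iff[of u] sqsum_nonneg[of u] by linarith

lemma sq_summable_bounded_by:
  assumes "v \<in> sq_summable" "\<And>x. \<bar>u x\<bar> \<le> \<bar>v x\<bar>"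
  shows "u \<in> sq_summable"
  using assms unfolding sq_summable_def
  by (auto intro!: summable_on_comparison_test[of "\<lambda>x. (v x)\<^sup>2"] simp: abs_le_square_iff)

lemma sqsum_mono:
  assumes "v \<in> sq_summable" "\<And>x. \<bar>u x\<bar> \<le> \<bar>v x\<bar>"
  shows "sqsum u \<le> sqsum v"
  using assms sq_summable_bounded_by[OF assms] unfolding sq_summable_def sqsum_def
  by (auto intro!: infsum_mono simp: abs_le_square_iff)

lemma sq_summable_finite_support:
  assumes "finite {x. u x \<noteq> 0}"
  shows "u \<in> sq_summable"
  using assms unfolding sq_summable_def
  by (simp add: finite_nonzero_values_imp_summable_on)

lemma sqsum_finite_support:
  assumes "finite A" "{x. u x \<noteq> 0} \<subseteq> A"
  shows "sqsum u = (\<Sum>x\<in>A. (u x)\<^sup>2)"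
proof -
  have "sqsum u = infsum (\<lambda>x. (u x)\<^sup>2) A"
    unfolding sqsum_def using assms by (intro infsum_cong_neutral) auto
  then show ?thesis using assms by simp
qed

lemma sq_summable_cmult:
  assumes "u \<in> sq_summable"
  shows "(\<lambda>x. c * u x) \<in> sq_summable"
  using assms unfolding sq_summable_def
  by (simp add: power_mult_distrib summable_on_cmult_right)

lemma sqsum_cmult: "sqsum (\<lambda>x. c * u x) = c\<^sup>2 * sqsum u"
  by (simp add: sqsum_def power_mult_distrib infsum_cmult_right')

lemma square_sum_le: "((a::real) + b)\<^sup>2 \<le> 2 * a\<^sup>2 + 2 * b\<^sup>2"
  using sum_squares_bound[of a b] by (simp add: power2_sum)

lemma sq_summable_add:
  assumes "u \<in> sq_summable" "v \<in> sq_summable"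
  shows "(\<lambda>x. u x + v x) \<in> sq_summable"
proof -
  have "(\<lambda>x. 2 * (u x)\<^sup>2 + 2 * (v x)\<^sup>2) summable_on UNIV"
    using assms unfolding sq_summable_def
    by (auto intro!: summable_on_add summable_on_cmult_right)
  then show ?thesis
    unfolding sq_summable_def
    by (auto intro!: summable_on_comparison_test[of "\<lambda>x. 2 * (u x)\<^sup>2 + 2 * (v x)\<^sup>2"] simp: square_sum_le)
qed

lemma sq_summable_diff:
  assumes "u \<in> sq_summable" "v \<in> sq_summable"
  shows "(\<lambda>x. u x - v x) \<in> sq_summable"
  using sq_summable_add[OF assms(1) sq_summable_cmult[OF assms(2), of "-1"]] by simp

lemma sq_summable_abs: "u \<in> sq_summable \<Longrightarrow> (\<lambda>x. \<bar>u x\<bar>) \<in> sq_summable"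
  by (rule sq_summable_bounded_by) auto

lemma sqsum_abs: "sqsum (\<lambda>x. \<bar>u x\<bar>) = sqsum u"
  by (simp add: sqsum_def)

lemma summable_on_mult:
  assumes "u \<in> sq_summable" "v \<in> sq_summable"
  shows "(\<lambda>x. u x * v x) summable_on UNIV"
proof (rule summable_on_real_comparison)
  show "(\<lambda>x. (u x)\<^sup>2 + (v x)\<^sup>2) summable_on UNIV"
    using assms unfolding sq_summable_def by (auto intro!: summable_on_add)
  show "\<bar>u x * v x\<bar> \<le> (u x)\<^sup>2 + (v x)\<^sup>2" for x
  proof -
    have "2 * \<bar>u x\<bar> * \<bar>v x\<bar> \<le> (u x)\<^sup>2 + (v x)\<^sup>2"
      using sum_squares_bound[of "\<bar>u x\<bar>" "\<bar>v x\<bar>"] by simp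
    moreover have "0 \<le> \<bar>u x\<bar> * \<bar>v x\<bar>" by simp
    ultimately have "\<bar>u x\<bar> * \<bar>v x\<bar> \<le> (u x)\<^sup>2 + (v x)\<^sup>2" by (simp only: mult.assoc)
    then show ?thesis by (simp add: abs_mult)
  qed
qed

lemma pairing_add_right:
  assumes "u \<in> sq_summable" "v \<in> sq_summable" "w \<in> sq_summable"
  shows "pairing u (\<lambda>x. v x + w x) = pairing u v + pairing u w"
  unfolding pairing_def distrib_left
  using assms by (intro infsum_add summable_on_mult)

lemma pairing_cmult_right: "pairing u (\<lambda>x. c * v x) = c * pairing u v"
  by (simp add: pairing_def mult.left_commute[of _ c] infsum_cmult_right')

lemma sqsum_add:
  assumes "u \<in> sq_summable" "v \<in> sq_summable"
  shows "sqsum (\<lambda>x. u x + v x) = sqsum u + 2 * pairing u v + sqsum v"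
proof -
  have "sqsum (\<lambda>x. u x + v x) = (\<Sum>\<^sub>\<infinity>x\<in>UNIV. (u x)\<^sup>2 + 2 * (u x * v x) + (v x)\<^sup>2)"
    unfolding sqsum_def by (intro infsum_cong) (simp add: power2_sum)
  also have "\<dots> = (\<Sum>\<^sub>\<infinity>x\<in>UNIV. (u x)\<^sup>2 + 2 * (u x * v x)) + sqsum v"
    unfolding sqsum_def using assms
    by (intro infsum_add summable_on_add summable_on_cmult_right summable_on_mult)
      (auto simp: sq_summable_def)
  also have "\<dots> = sqsum u + (\<Sum>\<^sub>\<infinity>x\<in>UNIV. 2 * (u x * v x)) + sqsum v"
    unfolding sqsum_def using assms
    by (subst infsum_add) (auto simp: sq_summable_def intro!: summable_on_cmult_right summable_on_mult)
  finally show ?thesis by (simp add: pairing_def infsum_cmult_right')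
qed

text \<open>Young's inequality with a free weight. Taking \<open>c = 1\<close> gives the crude
  factor 2, whereas a weight growing along a lattice path lets the constants in
  \<open>sqsum_shift_diff_le\<close> add up to an exact square.\<close>

lemma sqsum_add_le:
  assumes "u \<in> sq_summable" "v \<in> sq_summable" "0 < c"
  shows "sqsum (\<lambda>x. u x + v x) \<le> (1 + 1 / c) * sqsum u + (1 + c) * sqsum v"
proof -
  have "sqsum (\<lambda>x. u x + v x) \<le> (\<Sum>\<^sub>\<infinity>x\<in>UNIV. (1 + 1 / c) * (u x)\<^sup>2 + (1 + c) * (v x)\<^sup>2)"
    unfolding sqsum_def
  proof (rule infsum_mono)
    show "(\<lambda>x. (u x + v x)\<^sup>2) summable_on UNIV"
      using sq_summable_add[OF assms(1,2)] by (simp add: sq_summable_def)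
    show "(\<lambda>x. (1 + 1 / c) * (u x)\<^sup>2 + (1 + c) * (v x)\<^sup>2) summable_on UNIV"
      using assms by (auto simp: sq_summable_def intro!: summable_on_add summable_on_cmult_right)
    show "(u x + v x)\<^sup>2 \<le> (1 + 1 / c) * (u x)\<^sup>2 + (1 + c) * (v x)\<^sup>2" for x
    proof -
      have "0 \<le> (u x - c * v x)\<^sup>2 / c" using assms by simp
      also have "\<dots> = (1 / c) * (u x)\<^sup>2 + c * (v x)\<^sup>2 - 2 * u x * v x"
        using assms by (simp add: power2_eq_square field_simps)
      finally show ?thesis by (simp add: power2_sum distrib_right)
    qed
  qed
  also have "\<dots> = (1 + 1 / c) * sqsum u + (1 + c) * sqsum v"
    using assms unfolding sqsum_def
    by (subst infsum_add) (auto simp: sq_summable_def infsum_cmult_right' intro!: summable_on_cmult_right)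
  finally show ?thesis .
qed

lemma pairing_abs_le:
  assumes "u \<in> sq_summable" "v \<in> sq_summable"
  shows "\<bar>pairing u v\<bar> \<le> sqrt (sqsum u) * sqrt (sqsum v)"
proof (cases "sqsum v = 0")
  case True
  then have "v = (\<lambda>x. 0)" using sqsum_eq_0_iff assms by blast
  then show ?thesis by (simp add: pairing_def)
next
  case False
  then have pos: "0 < sqsum v" using sqsum_nonneg[of v] by linarith
  \<comment> \<open>The minimizer of the quadratic polynomial
    \<open>sqsum (\<lambda>x. u x + c * v x)\<close> in \<open>c\<close>; its minimal value being
    nonnegative is the Cauchy-Schwarz inequality.\<close>
  define c where "c = - pairing u v / sqsum v"
  have "0 \<le> sqsum (\<lambda>x. u x + c * v x)" by simp
  also have "\<dots> = sqsum u + 2 * c * pairing u v + c\<^sup>2 * sqsum v"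
    using assms by (simp add: sqsum_add sq_summable_cmult pairing_cmult_right sqsum_cmult)
  also have "\<dots> = sqsum u - (pairing u v)\<^sup>2 / sqsum v"
    using pos by (simp add: c_def field_simps power2_eq_square)
  finally have "(pairing u v)\<^sup>2 \<le> sqsum u * sqsum v"
    using pos by (simp add: field_simps)
  then have "sqrt ((pairing u v)\<^sup>2) \<le> sqrt (sqsum u * sqsum v)"
    by (rule real_sqrt_le_mono)
  then show ?thesis by (simp add: real_sqrt_mult)
qed

lemma sq_summable_reindex:
  assumes "bij f" "u \<in> sq_summable"
  shows "(\<lambda>x. u (f x)) \<in> sq_summable"
  using assms summable_on_reindex_bij_betw[of f UNIV UNIV "\<lambda>x. (u x)\<^sup>2"]
  by (simp add: sq_summable_def)

lemma sqsum_reindex: "bij f \<Longrightarrow> sqsum (\<lambda>x. u (f x)) = sqsum u"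
  using infsum_reindex_bij_betw[of f UNIV UNIV "\<lambda>x. (u x)\<^sup>2"] by (simp add: sqsum_def)

lemma powsum_reindex: "bij f \<Longrightarrow> powsum q (\<lambda>x. u (f x)) = powsum q u"
  using infsum_reindex_bij_betw[of f UNIV UNIV "\<lambda>x. \<bar>u x\<bar> powr q"] by (simp add: powsum_def)

section \<open>Power sums and the Brezis-Lieb decomposition\<close>

lemma abs_powr_le_sq:
  fixes s q R :: real
  assumes "2 \<le> q" "\<bar>s\<bar> \<le> R"
  shows "\<bar>s\<bar> powr q \<le> R powr (q - 2) * s\<^sup>2"
proof (cases "s = 0")
  case False
  have "\<bar>s\<bar> powr q = \<bar>s\<bar> powr (q - 2) * \<bar>s\<bar> powr 2"
    by (subst powr_add[symmetric]) simp
  also have "\<dots> = \<bar>s\<bar> powr (q - 2) * s\<^sup>2"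
    using False by simp
  also have "\<dots> \<le> R powr (q - 2) * s\<^sup>2"
    using assms by (intro mult_right_mono powr_mono2) auto
  finally show ?thesis .
qed auto

lemma powr_summable:
  assumes "u \<in> sq_summable" "2 \<le> q"
  shows "(\<lambda>x. \<bar>u x\<bar> powr q) summable_on UNIV"
proof (rule summable_on_real_comparison)
  show "(\<lambda>x. sqrt (sqsum u) powr (q - 2) * (u x)\<^sup>2) summable_on UNIV"
    using assms by (auto simp: sq_summable_def intro!: summable_on_cmult_right)
  show "\<bar>\<bar>u x\<bar> powr q\<bar> \<le> sqrt (sqsum u) powr (q - 2) * (u x)\<^sup>2" for x
    using abs_powr_le_sq[OF assms(2) abs_le_sqrt_sqsum[OF assms(1)]] by simp
qed

lemma powsum_nonneg [simp]: "0 \<le> powsum q u"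
  unfolding powsum_def by (rule infsum_nonneg) simp

text \<open>Interpolation between the supremum and the mass. Read backwards, a power sum that is
  large relative to the mass forces a large value somewhere, which is how vanishing is
  excluded.\<close>

lemma powsum_le_sup:
  assumes "u \<in> sq_summable" "2 \<le> q" "\<And>x. \<bar>u x\<bar> \<le> R"
  shows "powsum q u \<le> R powr (q - 2) * sqsum u"
proof -
  have "powsum q u \<le> (\<Sum>\<^sub>\<infinity>x\<in>UNIV. R powr (q - 2) * (u x)\<^sup>2)"
    unfolding powsum_def using assms powr_summable[OF assms(1,2)] abs_powr_le_sq[OF assms(2)]
    by (intro infsum_mono) (auto simp: sq_summable_def intro!: summable_on_cmult_right)
  then show ?thesis by (simp add: sqsum_def infsum_cmult_right')
qed

text \<open>For counting measure the supremum is bounded by the \<open>\<ell>\<^sup>2\<close> norm,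
  so interpolation gives the embedding of \<open>\<ell>\<^sup>2\<close> in
  \<open>\<ell>\<^sup>q\<close> with constant 1.\<close>

lemma powsum_le_sqsum:
  assumes "u \<in> sq_summable" "2 \<le> q"
  shows "powsum q u \<le> sqsum u powr (q / 2)"
proof (cases "sqsum u = 0")
  case True
  then show ?thesis
    using assms sqsum_eq_0_iff[of u] by (auto simp: powsum_def)
next
  case False
  then have pos: "0 < sqsum u" using sqsum_nonneg[of u] by linarith
  have "powsum q u \<le> sqrt (sqsum u) powr (q - 2) * sqsum u"
    using assms by (intro powsum_le_sup abs_le_sqrt_sqsum)
  also have "\<dots> = sqsum u powr ((q - 2) / 2) * sqsum u powr 1"
    using pos by (simp add: powr_half_sqrt[symmetric] powr_powr)
  also have "\<dots> = sqsum u powr (q / 2)"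
    using pos by (subst powr_add[symmetric]) (simp add: field_simps)
  finally show ?thesis .
qed

lemma abs_powr_le_powsum:
  assumes "u \<in> sq_summable" "2 \<le> q"
  shows "\<bar>u x\<bar> powr q \<le> powsum q u"
  using finite_sum_le_infsum[OF powr_summable[OF assms], of "{x}"] by (simp add: powsum_def)

lemma powsum_pos:
  assumes "u \<in> sq_summable" "2 \<le> q" "u \<noteq> (\<lambda>x. 0)"
  shows "0 < powsum q u"
proof -
  obtain x where "u x \<noteq> 0" using assms(3) by auto
  then have "0 < \<bar>u x\<bar> powr q" by simp
  then show ?thesis using abs_powr_le_powsum[OF assms(1,2), of x] by linarith
qed

lemma powsum_cmult: "powsum q (\<lambda>x. c * u x) = \<bar>c\<bar> powr q * powsum q u"
  by (simp add: powsum_def abs_mult powr_mult infsum_cmult_right')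

lemma powsum_abs: "powsum q (\<lambda>x. \<bar>u x\<bar>) = powsum q u"
  by (simp add: powsum_def)

lemma powsum_2: "powsum 2 u = sqsum u"
proof -
  have "\<bar>s\<bar> powr 2 = s\<^sup>2" for s :: real
    by (cases "s = 0") auto
  then show ?thesis by (simp add: powsum_def sqsum_def)
qed

text \<open>On a large finite set the claim holds by pointwise convergence, and off it the error is small
  because \<open>u\<close> has a small tail.\<close>

lemma brezis_lieb:
  fixes u :: "'a \<Rightarrow> real" and b :: "nat \<Rightarrow> 'a \<Rightarrow> real"
  assumes u: "u \<in> sq_summable" and b: "\<And>n. b n \<in> sq_summable"
    and K: "\<And>n. sqsum (b n) \<le> K" and lim: "\<And>x. (\<lambda>n. b n x) \<longlonglongrightarrow> 0" and q: "2 \<le> q"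
  shows "(\<lambda>n. powsum q (\<lambda>x. u x + b n x) - powsum q (b n)) \<longlonglongrightarrow> powsum q u"
proof -
  define f where "f n x = \<bar>u x + b n x\<bar> powr q - \<bar>b n x\<bar> powr q - \<bar>u x\<bar> powr q" for n x
  have sumf: "f n summable_on UNIV" for n
    unfolding f_def by (intro summable_on_real_diff powr_summable sq_summable_add u b q)
  have feq: "infsum (f n) UNIV = powsum q (\<lambda>x. u x + b n x) - powsum q (b n) - powsum q u" for n
    unfolding f_def powsum_def
    by (subst infsum_real_diff infsum_real_diff
        | intro summable_on_real_diff powr_summable sq_summable_add u b q refl)+
  have K0: "0 \<le> K" using sqsum_nonneg[of "b 0"] K[of 0] by linarith
  have "(\<lambda>n. infsum (f n) UNIV) \<longlonglongrightarrow> 0"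
  proof (rule LIMSEQ_I)
    fix r :: real assume r: "0 < r"
    \<comment> \<open>Error budget: the mass of \<open>b n\<close> and the tail of \<open>u\<close>
      may each cost \<open>r / 4\<close> off the finite set, and the finite set itself
      \<open>r / 2\<close>. Using \<open>K + 1\<close> and \<open>C + 1\<close> avoids division by
      0.\<close>
    define \<epsilon> where "\<epsilon> = r / (4 * (K + 1))"
    have \<epsilon>: "0 < \<epsilon>" using r K0 by (simp add: \<epsilon>_def)
    define R where "R = max (sqrt (sqsum u)) (sqrt K)"
    have R: "0 \<le> R" by (simp add: R_def le_max_iff_disj)
    have uR: "\<bar>u x\<bar> \<le> R" for x using abs_le_sqrt_sqsum[OF u, of x] by (simp add: R_def)
    have bR: "\<bar>b n x\<bar> \<le> R" for n x
      using order_trans[OF abs_le_sqrt_sqsum[OF b] real_sqrt_le_mono[OF K], of n x] by (simp add: R_def)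
    obtain C where C: "0 \<le> C" and
      Cb: "\<And>s t. \<bar>s\<bar> \<le> R \<Longrightarrow> \<bar>t\<bar> \<le> R \<Longrightarrow> 
       \<bar>\<bar>s + t\<bar> powr q - \<bar>t\<bar> powr q - \<bar>s\<bar> powr q\<bar> \<le> \<epsilon> * t\<^sup>2 + C * s\<^sup>2"
      using brezis_lieb_pointwise[OF q R \<epsilon>] by blast
    have su: "(\<lambda>x. (u x)\<^sup>2) summable_on A" for A
      using u summable_on_subset_banach[of _ UNIV A] by (auto simp: sq_summable_def)
    have sb: "(\<lambda>x. (b n x)\<^sup>2) summable_on A" for n A
      using b[of n] summable_on_subset_banach[of _ UNIV A] by (auto simp: sq_summable_def)
    obtain F where F: "finite F" and
      Fd: "dist (\<Sum>x\<in>F. (u x)\<^sup>2) (sqsum u) \<le> r / (4 * (C + 1))"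
      using infsum_finite_approximation[OF su, of "r / (4 * (C + 1))" UNIV] r C
      by (auto simp: sqsum_def)
    have "sqsum u = (\<Sum>x\<in>F. (u x)\<^sup>2) + infsum (\<lambda>x. (u x)\<^sup>2) (- F)"
      unfolding sqsum_def using infsum_Un_disjoint[OF su su, of F "- F"] F by simp
    then have tail: "infsum (\<lambda>x. (u x)\<^sup>2) (- F) \<le> r / (4 * (C + 1))"
      using Fd by (simp add: dist_real_def)
    have outer: "\<bar>infsum (f n) (- F)\<bar> \<le> r / 2" for n
    proof -
      have "norm (infsum (f n) (- F)) \<le> infsum (\<lambda>x. \<epsilon> * (b n x)\<^sup>2 + C * (u x)\<^sup>2) (- F)"
      proof (rule norm_infsum_le[OF has_sum_infsum has_sum_infsum])
        show "f n summable_on - F" by (rule summable_on_subset_banach[OF sumf]) simp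
        show "(\<lambda>x. \<epsilon> * (b n x)\<^sup>2 + C * (u x)\<^sup>2) summable_on - F"
          by (intro summable_on_add summable_on_cmult_right su sb)
        show "norm (f n x) \<le> \<epsilon> * (b n x)\<^sup>2 + C * (u x)\<^sup>2" for x
          using Cb[OF uR bR, of x n x] by (simp add: f_def)
      qed
      also have "\<dots> = \<epsilon> * infsum (\<lambda>x. (b n x)\<^sup>2) (- F) + C * infsum (\<lambda>x. (u x)\<^sup>2) (- F)"
        by (subst infsum_add) (auto intro!: summable_on_cmult_right su sb simp: infsum_cmult_right')
      also have "\<dots> \<le> \<epsilon> * K + C * (r / (4 * (C + 1)))"
      proof (intro add_mono mult_left_mono)
        have "infsum (\<lambda>x. (b n x)\<^sup>2) (- F) \<le> sqsum (b n)"
          unfolding sqsum_def by (intro infsum_mono_neutral sb) auto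
        then show "infsum (\<lambda>x. (b n x)\<^sup>2) (- F) \<le> K" using K[of n] by linarith
      qed (use \<epsilon> C tail in auto)
      also have "\<epsilon> * K \<le> r / 4"
        using r K0 by (simp add: \<epsilon>_def field_simps)
      also have "C * (r / (4 * (C + 1))) \<le> r / 4"
        using r C by (simp add: field_simps)
      finally show ?thesis using r by simp
    qed
    have "(\<lambda>n. \<Sum>x\<in>F. f n x) \<longlonglongrightarrow> (\<Sum>x\<in>F. \<bar>u x + 0\<bar> powr q - \<bar>0\<bar> powr q - \<bar>u x\<bar> powr q)"
      unfolding f_def using q
      by (intro tendsto_sum tendsto_diff tendsto_powr' tendsto_rabs tendsto_add tendsto_const lim) auto
    then have "(\<lambda>n. \<Sum>x\<in>F. f n x) \<longlonglongrightarrow> 0" by simp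
    from LIMSEQ_D[OF this, of "r / 2"] r obtain n0
      where n0: "\<And>n. n \<ge> n0 \<Longrightarrow> \<bar>\<Sum>x\<in>F. f n x\<bar> < r / 2" by auto
    show "\<exists>n0. \<forall>n\<ge>n0. norm (infsum (f n) UNIV - 0) < r"
    proof (intro exI allI impI)
      fix n assume "n \<ge> n0"
      have "infsum (f n) UNIV = (\<Sum>x\<in>F. f n x) + infsum (f n) (- F)"
        using infsum_Un_disjoint[of "f n" F "- F"] F summable_on_subset_banach[OF sumf[of n], of "- F"]
        by simp
      then show "norm (infsum (f n) UNIV - 0) < r"
        using n0[OF \<open>n \<ge> n0\<close>] outer[of n] by simp
    qed
  qed
  then have "(\<lambda>n. infsum (f n) UNIV + powsum q u) \<longlonglongrightarrow> 0 + powsum q u"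
    by (intro tendsto_add tendsto_const)
  then show ?thesis by (simp add: feq)
qed

lemma sqsum_brezis_lieb:
  fixes u :: "'a \<Rightarrow> real" and b :: "nat \<Rightarrow> 'a \<Rightarrow> real"
  assumes "u \<in> sq_summable" "\<And>n. b n \<in> sq_summable"
    "\<And>n. sqsum (b n) \<le> K" "\<And>x. (\<lambda>n. b n x) \<longlonglongrightarrow> 0"
  shows "(\<lambda>n. sqsum (\<lambda>x. u x + b n x) - sqsum (b n)) \<longlonglongrightarrow> sqsum u"
  using brezis_lieb[OF assms, of 2] by (simp add: powsum_2)

text \<open>Fatou's lemma in elementary form: the bound passes to the limit on each finite set, and
  finite partial sums of nonnegative terms determine the total.\<close>

lemma sq_summable_pointwise_limit:
  fixes u :: "nat \<Rightarrow> 'a \<Rightarrow> real"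
  assumes "\<And>n. u n \<in> sq_summable" "\<And>n. sqsum (u n) \<le> K" "\<And>x. (\<lambda>n. u n x) \<longlonglongrightarrow> v x"
  shows "v \<in> sq_summable" "sqsum v \<le> K"
proof -
  have "(\<Sum>x\<in>F. (v x)\<^sup>2) \<le> K" if "finite F" for F
  proof (rule LIMSEQ_le_const2)
    show "(\<lambda>n. \<Sum>x\<in>F. (u n x)\<^sup>2) \<longlonglongrightarrow> (\<Sum>x\<in>F. (v x)\<^sup>2)"
      by (intro tendsto_sum tendsto_power assms)
    show "\<exists>N. \<forall>n\<ge>N. (\<Sum>x\<in>F. (u n x)\<^sup>2) \<le> K"
      using sum_le_sqsum[OF assms(1) that] assms(2) by (meson order_trans)
  qed
  then show "v \<in> sq_summable" "sqsum v \<le> K"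
    by (auto intro: sq_summableI)
qed

section \<open>Functions on the lattice\<close>

definition lnorm :: "int ^ 'd \<Rightarrow> int" where
  "lnorm x = (\<Sum>i\<in>UNIV. \<bar>x $ i\<bar>)"

definition unit_steps :: "(int ^ 'd) set" where
  "unit_steps = {e. lnorm e = 1}"

definition shift_diff :: "int ^ 'd \<Rightarrow> (int ^ 'd \<Rightarrow> real) \<Rightarrow> int ^ 'd \<Rightarrow> real" where
  "shift_diff z u = (\<lambda>x. u (x + z) - u x)"

text \<open>The polarization of \<open>grad_norm_sq\<close>; the factor \<open>1 / 2\<close>
  compensates for each edge being counted from both of its ends.\<close>

definition grad_pairing :: "(int ^ 'd \<Rightarrow> real) \<Rightarrow> (int ^ 'd \<Rightarrow> real) \<Rightarrow> real" where
  "grad_pairing u v = 1 / 2 * (\<Sum>e\<in>unit_steps. pairing (shift_diff e u) (shift_diff e v))"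

lemma lnorm_nonneg [simp]: "0 \<le> lnorm x"
  by (simp add: lnorm_def sum_nonneg)

lemma lnorm_zero [simp]: "lnorm 0 = 0"
  by (simp add: lnorm_def)

lemma lnorm_eq_0_iff [simp]: "lnorm x = 0 \<longleftrightarrow> x = 0"
  by (auto simp: lnorm_def sum_nonneg_eq_0_iff vec_eq_iff)

lemma lnorm_minus [simp]: "lnorm (- x) = lnorm x"
  by (simp add: lnorm_def)

lemma lnorm_triangle: "lnorm (x + y) \<le> lnorm x + lnorm y"
  unfolding lnorm_def by (auto simp flip: sum.distrib intro!: sum_mono abs_triangle_ineq)

lemma abs_nth_le_lnorm: "\<bar>x $ i\<bar> \<le> lnorm x"
  unfolding lnorm_def by (rule member_le_sum) auto

text \<open>Moving one nonzero coordinate towards 0 shortens \<open>z\<close> by one. This is the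
  induction step for arguments along lattice paths, used both for estimates and for
  connectedness.\<close>

lemma unit_step_decreasing_lnorm:
  fixes z :: "int ^ 'd"
  assumes "z \<noteq> 0"
  obtains e where "e \<in> unit_steps" "lnorm (z - e) = lnorm z - 1"
proof -
  from assms obtain i where i: "z $ i \<noteq> 0" by (auto simp: vec_eq_iff)
  define e where "e = axis i (sgn (z $ i))"
  have "lnorm e = \<bar>sgn (z $ i)\<bar>"
    unfolding lnorm_def e_def by (subst sum.remove[of _ i]) (auto simp: axis_def)
  then have "e \<in> unit_steps"
    using i by (simp add: unit_steps_def abs_sgn_eq)
  moreover have "lnorm (z - e) = lnorm z - 1"
  proof -
    have "lnorm (z - e) = \<bar>z $ i - sgn (z $ i)\<bar> + (\<Sum>j\<in>UNIV - {i}. \<bar>z $ j\<bar>)"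
      unfolding lnorm_def e_def by (subst sum.remove[of _ i]) (auto simp: axis_def)
    also have "\<bar>z $ i - sgn (z $ i)\<bar> = \<bar>z $ i\<bar> - 1"
      using i by (auto simp: sgn_if)
    also have "\<bar>z $ i\<bar> - 1 + (\<Sum>j\<in>UNIV - {i}. \<bar>z $ j\<bar>) = lnorm z - 1"
      unfolding lnorm_def by (subst (2) sum.remove[of _ i]) auto
    finally show ?thesis .
  qed
  ultimately show thesis using that by blast
qed

lemma lattice_neighbours_eq: "{y. lattice_adj x y} = (\<lambda>e. x + e) ` unit_steps"
proof -
  have "lattice_adj x y \<longleftrightarrow> y - x \<in> unit_steps" for y
    by (simp add: lattice_adj_def unit_steps_def lnorm_def abs_minus_commute)
  then show ?thesis
    by (force simp: image_iff algebra_simps)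
qed

lemma finite_unit_steps [simp]: "finite (unit_steps :: (int ^ 'd) set)"
  using finite_lattice_neighbours[of "0 :: int ^ 'd"] by (simp add: lattice_neighbours_eq)

lemma sum_lattice_neighbours: "(\<Sum>y\<in>{y. lattice_adj x y}. f y) = (\<Sum>e\<in>unit_steps. f (x + e))"
  unfolding lattice_neighbours_eq by (subst sum.reindex) (auto simp: inj_on_def)

lemma bij_shift: "bij (\<lambda>x :: int ^ 'd. x + z)"
  by (rule bij_plus_right)

lemma sq_summable_shift: "u \<in> sq_summable \<Longrightarrow> (\<lambda>x :: int ^ 'd. u (x + z)) \<in> sq_summable"
  by (rule sq_summable_reindex[OF bij_shift])

lemma sqsum_shift: "sqsum (\<lambda>x :: int ^ 'd. u (x + z)) = sqsum u"
  by (rule sqsum_reindex[OF bij_shift])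

lemma powsum_shift: "powsum q (\<lambda>x :: int ^ 'd. u (x + z)) = powsum q u"
  by (rule powsum_reindex[OF bij_shift])

lemma sq_summable_shift_diff: "u \<in> sq_summable \<Longrightarrow> shift_diff z u \<in> sq_summable"
  unfolding shift_diff_def by (intro sq_summable_diff sq_summable_shift)

lemma infsum_finite_sum:
  fixes f :: "'a \<Rightarrow> 'b \<Rightarrow> real"
  assumes "finite I" "\<And>i. i \<in> I \<Longrightarrow> f i summable_on A"
  shows "infsum (\<lambda>x. \<Sum>i\<in>I. f i x) A = (\<Sum>i\<in>I. infsum (f i) A)"
proof -
  have "((\<lambda>x. \<Sum>i\<in>I. f i x) has_sum (\<Sum>i\<in>I. infsum (f i) A)) A"
    using assms by (induction I rule: finite_induct) (auto intro!: has_sum_add)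
  then show ?thesis by (rule infsumI)
qed

text \<open>Splitting by direction turns the gradient norm into finitely many
  \<open>\<ell>\<^sup>2\<close> norms, so statements about \<open>sqsum\<close>, the Brezis-Lieb
  lemma included, carry over direction by direction.\<close>

lemma grad_norm_sq_eq:
  fixes u :: "int ^ 'd \<Rightarrow> real"
  assumes "u \<in> sq_summable"
  shows "grad_norm_sq u = 1 / 2 * (\<Sum>e\<in>unit_steps. sqsum (shift_diff e u))"
proof -
  have "(\<Sum>\<^sub>\<infinity>x\<in>UNIV. \<Sum>e\<in>unit_steps. (shift_diff e u x)\<^sup>2) = (\<Sum>e\<in>unit_steps. sqsum (shift_diff e u))"
    unfolding sqsum_def
    using sq_summable_shift_diff[OF assms]
    by (subst infsum_finite_sum) (auto simp: sq_summable_def)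
  then show ?thesis
    unfolding grad_norm_sq_def sum_lattice_neighbours by (simp add: shift_diff_def)
qed

lemma grad_norm_sq_nonneg [simp]: "0 \<le> grad_norm_sq u"
  unfolding grad_norm_sq_def by (intro mult_nonneg_nonneg infsum_nonneg sum_nonneg) auto

lemma sqsum_shift_diff_le_sqsum:
  assumes "u \<in> sq_summable"
  shows "sqsum (shift_diff z u) \<le> 4 * sqsum u"
  using sqsum_add_le[OF sq_summable_shift[OF assms, of z] sq_summable_cmult[OF assms, of "-1"], of 1]
  by (simp add: shift_diff_def sqsum_shift sqsum_cmult[of "-1" u, simplified])

text \<open>On a lattice difference operators are bounded. Besides the equivalence of norms, this
  supplies the linear bound on the gradient term that the superlinear power term beats at large
  mass.\<close>

lemma grad_norm_sq_le:
  fixes u :: "int ^ 'd \<Rightarrow> real"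
  assumes "u \<in> sq_summable"
  shows "grad_norm_sq u \<le> 2 * real (card (unit_steps :: (int ^ 'd) set)) * sqsum u"
proof -
  have "(\<Sum>e\<in>(unit_steps :: (int ^ 'd) set). sqsum (shift_diff e u))
      \<le> (\<Sum>e\<in>(unit_steps :: (int ^ 'd) set). 4 * sqsum u)"
    by (intro sum_mono sqsum_shift_diff_le_sqsum assms)
  then show ?thesis
    by (simp add: grad_norm_sq_eq[OF assms])
qed

lemma grad_norm_sq_cmult: "grad_norm_sq (\<lambda>x. c * u x) = c\<^sup>2 * grad_norm_sq u"
proof -
  have "(\<Sum>y\<in>A. \<bar>c * u y - c * u x\<bar>\<^sup>2) = c\<^sup>2 * (\<Sum>y\<in>A. \<bar>u y - u x\<bar>\<^sup>2)" for x A
  proof -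
    have "\<bar>c * u y - c * u x\<bar>\<^sup>2 = c\<^sup>2 * \<bar>u y - u x\<bar>\<^sup>2" for y
      unfolding right_diff_distrib[symmetric] by (simp add: power_mult_distrib)
    then show ?thesis
      by (simp only: sum_distrib_left)
  qed
  then show ?thesis
    by (simp add: grad_norm_sq_def infsum_cmult_right')
qed

lemma grad_norm_sq_add:
  assumes "u \<in> sq_summable" "v \<in> sq_summable"
  shows "grad_norm_sq (\<lambda>x. u x + v x) = grad_norm_sq u + 2 * grad_pairing u v + grad_norm_sq v"
proof -
  have "sqsum (shift_diff e (\<lambda>x. u x + v x))
      = sqsum (shift_diff e u) + 2 * pairing (shift_diff e u) (shift_diff e v) + sqsum (shift_diff e v)" for e
  proof -
    have "shift_diff e (\<lambda>x. u x + v x) = (\<lambda>x. shift_diff e u x + shift_diff e v x)"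
      by (auto simp: shift_diff_def)
    then show ?thesis
      using assms by (simp only: sqsum_add sq_summable_shift_diff)
  qed
  then show ?thesis
    using assms
    by (simp add: grad_norm_sq_eq sq_summable_add grad_pairing_def sum.distrib algebra_simps
        flip: sum_distrib_left)
qed

lemma grad_pairing_add_right:
  assumes "u \<in> sq_summable" "v \<in> sq_summable" "w \<in> sq_summable"
  shows "grad_pairing u (\<lambda>x. v x + w x) = grad_pairing u v + grad_pairing u w"
proof -
  have "pairing (shift_diff e u) (shift_diff e (\<lambda>x. v x + w x))
      = pairing (shift_diff e u) (shift_diff e v) + pairing (shift_diff e u) (shift_diff e w)" for e
  proof -
    have "shift_diff e (\<lambda>x. v x + w x) = (\<lambda>x. shift_diff e v x + shift_diff e w x)"
      by (auto simp: shift_diff_def)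
    then show ?thesis
      using assms by (simp only: pairing_add_right sq_summable_shift_diff)
  qed
  then show ?thesis
    by (simp add: grad_pairing_def sum.distrib distrib_left)
qed

lemma grad_pairing_cmult_right: "grad_pairing u (\<lambda>x. c * v x) = c * grad_pairing u v"
proof -
  have "shift_diff e (\<lambda>x. c * v x) = (\<lambda>x. c * shift_diff e v x)" for e
    by (auto simp: shift_diff_def right_diff_distrib)
  then show ?thesis
    by (simp add: grad_pairing_def pairing_cmult_right sum_distrib_left mult_ac)
qed

lemma grad_norm_sq_shift:
  assumes "u \<in> sq_summable"
  shows "grad_norm_sq (\<lambda>x. u (x + z)) = grad_norm_sq u"
proof -
  have "sqsum (shift_diff e (\<lambda>x. u (x + z))) = sqsum (shift_diff e u)" for e
    using sqsum_shift[of "shift_diff e u" z] by (simp add: shift_diff_def add_ac)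
  then show ?thesis
    using assms by (simp add: grad_norm_sq_eq sq_summable_shift)
qed

lemma grad_norm_sq_abs_le:
  assumes "u \<in> sq_summable"
  shows "grad_norm_sq (\<lambda>x. \<bar>u x\<bar>) \<le> grad_norm_sq u"
proof -
  have "sqsum (shift_diff e (\<lambda>x. \<bar>u x\<bar>)) \<le> sqsum (shift_diff e u)" for e
    by (rule sqsum_mono[OF sq_summable_shift_diff[OF assms]]) (simp add: shift_diff_def)
  then show ?thesis
    using assms by (simp add: grad_norm_sq_eq sq_summable_abs sum_mono)
qed

text \<open>Telescoping along a path of unit steps. With weight \<open>n\<close> in Young's
  inequality the constants satisfy
  \<open>(1 + 1 / n) * n\<^sup>2 + (1 + n) = (n + 1)\<^sup>2\<close>, so the growth is exactly
  quadratic in the length. The weight must be positive, hence the separate case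
  \<open>n = 0\<close>.\<close>

lemma sqsum_shift_diff_le:
  assumes "u \<in> sq_summable"
  shows "sqsum (shift_diff z u) \<le> (real_of_int (lnorm z))\<^sup>2 * (2 * grad_norm_sq u)"
proof (induction "nat (lnorm z)" arbitrary: z)
  case 0
  then have "lnorm z = 0" using lnorm_nonneg[of z] by linarith
  then show ?case by (simp add: shift_diff_def sqsum_def)
next
  case (Suc n)
  then have z: "lnorm z = int n + 1" by linarith
  then have "z \<noteq> 0" by auto
  then obtain e where e: "e \<in> unit_steps" "lnorm (z - e) = lnorm z - 1"
    by (rule unit_step_decreasing_lnorm)
  let ?G = "2 * grad_norm_sq u"
  have step: "sqsum (shift_diff e u) \<le> ?G"
    using member_le_sum[OF e(1), of "\<lambda>e. sqsum (shift_diff e u)"] by (simp add: grad_norm_sq_eq[OF assms])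
  have n: "lnorm (z - e) = int n" using e z by simp
  have IH: "sqsum (shift_diff (z - e) u) \<le> (real n)\<^sup>2 * ?G"
    using Suc(1)[of "z - e"] n by simp
  show ?case
  proof (cases "n = 0")
    case True
    then have "z = e" using n by simp
    then show ?thesis using step z True by simp
  next
    case False
    have "shift_diff z u = (\<lambda>x. shift_diff (z - e) (\<lambda>x. u (x + e)) x + shift_diff e u x)"
      by (auto simp: shift_diff_def)
    then have "sqsum (shift_diff z u) = sqsum (\<lambda>x. shift_diff (z - e) (\<lambda>x. u (x + e)) x + shift_diff e u x)"
      by (rule arg_cong)
    also have "\<dots> \<le> (1 + 1 / real n) * sqsum (shift_diff (z - e) (\<lambda>x. u (x + e)))
        + (1 + real n) * sqsum (shift_diff e u)"
      using assms False by (intro sqsum_add_le sq_summable_shift_diff sq_summable_shift) auto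
    also have "sqsum (shift_diff (z - e) (\<lambda>x. u (x + e))) = sqsum (shift_diff (z - e) u)"
      using sqsum_shift[of "shift_diff (z - e) u" e] by (simp add: shift_diff_def add_ac)
    also have "(1 + 1 / real n) * sqsum (shift_diff (z - e) u) + (1 + real n) * sqsum (shift_diff e u)
        \<le> (1 + 1 / real n) * ((real n)\<^sup>2 * ?G) + (1 + real n) * ?G"
      by (intro add_mono mult_left_mono IH step) auto
    also have "\<dots> = (1 + real n)\<^sup>2 * ?G"
      using False by (simp add: field_simps power2_eq_square)
    finally show ?thesis by (simp add: z add.commute)
  qed
qed

section \<open>The space \<open>H1\<close> and the functionals in terms of square and power
  sums\<close>

lemma sq_lq_norm_2: "(lq_norm 2 u)\<^sup>2 = sqsum u"
proof -
  have "lq_norm 2 u = powsum 2 u powr (1 / 2)"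
    by (simp add: lq_norm_def powsum_def)
  also have "\<dots> = sqrt (sqsum u)"
    by (simp add: powsum_2 powr_half_sqrt)
  finally show ?thesis by simp
qed

lemma lq_norm_powr: "p \<noteq> 0 \<Longrightarrow> lq_norm p u powr p = powsum p u"
  using powsum_nonneg[of p u] by (simp add: lq_norm_def powr_powr flip: powsum_def)

lemma H1_norm_sq: "(H1_norm u)\<^sup>2 = grad_norm_sq u + sqsum u"
  by (simp add: H1_norm_def sq_lq_norm_2)

lemma sqrt_sqsum_le_H1_norm: "sqrt (sqsum u) \<le> H1_norm u"
  by (simp add: H1_norm_def sq_lq_norm_2)

lemma H1_norm_nonneg [simp]: "0 \<le> H1_norm u"
  by (simp add: H1_norm_def)

lemma finite_lnorm_le: "finite {x :: int ^ 'd. lnorm x \<le> k}"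
proof (rule finite_subset)
  show "{x :: int ^ 'd. lnorm x \<le> k} \<subseteq> vec_lambda ` (\<Pi>\<^sub>E i\<in>UNIV. {- k..k})"
  proof
    fix x :: "int ^ 'd" assume "x \<in> {x. lnorm x \<le> k}"
    then have "\<bar>x $ i\<bar> \<le> k" for i
      using abs_nth_le_lnorm[of x i] by simp
    then have "- k \<le> x $ i \<and> x $ i \<le> k" for i
      by (simp add: abs_le_iff minus_le_iff)
    then have "vec_nth x \<in> (\<Pi>\<^sub>E i\<in>UNIV. {- k..k})"
      by (simp add: PiE_UNIV_domain)
    then show "x \<in> vec_lambda ` (\<Pi>\<^sub>E i\<in>UNIV. {- k..k})"
      by (metis image_eqI vec_nth_inverse)
  qed
  show "finite (vec_lambda ` (\<Pi>\<^sub>E i\<in>(UNIV :: 'd set). {- k..k}))"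
    by (intro finite_imageI finite_PiE) auto
qed

text \<open>A sequence that is Cauchy in \<open>H1_norm\<close> has bounded mass, so its pointwise
  limit is square summable by Fatou. Conversely, the truncations of a square summable function to
  growing balls are Cauchy, because the gradient is bounded by the mass.\<close>

lemma H1_eq: "H1 = (sq_summable :: (int ^ 'd \<Rightarrow> real) set)"
proof (intro set_eqI iffI)
  fix u :: "int ^ 'd \<Rightarrow> real"
  assume "u \<in> H1"
  then obtain \<phi> :: "nat \<Rightarrow> int ^ 'd \<Rightarrow> real" where fin: "\<And>n. finite {x. \<phi> n x \<noteq> 0}"
    and cauchy: "\<And>\<epsilon>. \<epsilon> > 0 \<Longrightarrow> \<exists>N. \<forall>m\<ge>N. \<forall>n\<ge>N. H1_norm (\<lambda>x. \<phi> m x - \<phi> n x) < \<epsilon>"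
    and lim: "\<And>x. (\<lambda>n. \<phi> n x) \<longlonglongrightarrow> u x"
    unfolding H1_def by blast
  obtain N where N: "\<And>m. m \<ge> N \<Longrightarrow> H1_norm (\<lambda>x. \<phi> m x - \<phi> N x) < 1"
    using cauchy[of 1] by auto
  have sum: "\<phi> n \<in> sq_summable" for n
    by (rule sq_summable_finite_support[OF fin])
  have bd: "sqsum (\<phi> (n + N)) \<le> 2 + 2 * sqsum (\<phi> N)" for n
  proof -
    let ?w = "\<lambda>x. \<phi> (n + N) x - \<phi> N x"
    have "sqrt (sqsum ?w) < 1"
      using le_less_trans[OF sqrt_sqsum_le_H1_norm N[of "n + N"]] by simp
    then have "sqsum ?w \<le> 1" by simp
    moreover have "sqsum (\<lambda>x. ?w x + \<phi> N x) \<le> (1 + 1 / 1) * sqsum ?w + (1 + 1) * sqsum (\<phi> N)"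
      by (intro sqsum_add_le sq_summable_diff sum) auto
    ultimately show ?thesis by simp
  qed
  show "u \<in> sq_summable"
    by (rule sq_summable_pointwise_limit(1)[OF sum bd LIMSEQ_ignore_initial_segment[OF lim]])
next
  fix u :: "int ^ 'd \<Rightarrow> real"
  assume u: "u \<in> sq_summable"
  define \<phi> where "\<phi> n x = (if lnorm x \<le> int n then u x else 0)" for n x
  \<comment> \<open>The constant in \<open>(H1_norm w)\<^sup>2 \<le> c * sqsum w\<close>: the bound
    for the gradient plus 1 for the mass.\<close>
  define c where "c = 2 * real (card (unit_steps :: (int ^ 'd) set)) + 1"
  have c: "0 < c" by (simp add: c_def)
  have fin: "finite {x. \<phi> n x \<noteq> 0}" for n
    by (rule finite_subset[OF _ finite_lnorm_le[of "int n"]]) (auto simp: \<phi>_def)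
  have sum: "\<phi> n \<in> sq_summable" for n
    by (rule sq_summable_finite_support[OF fin])
  have "\<exists>N. \<forall>m\<ge>N. \<forall>n\<ge>N. H1_norm (\<lambda>x. \<phi> m x - \<phi> n x) < \<epsilon>" if "\<epsilon> > 0" for \<epsilon>
  proof -
    have su: "(\<lambda>x. (u x)\<^sup>2) summable_on UNIV" using u by (simp add: sq_summable_def)
    obtain F where F: "finite F" "dist (\<Sum>x\<in>F. (u x)\<^sup>2) (sqsum u) \<le> \<epsilon>\<^sup>2 / (2 * c)"
      using infsum_finite_approximation[OF su, of "\<epsilon>\<^sup>2 / (2 * c)"] \<open>\<epsilon> > 0\<close> c by (auto simp: sqsum_def)
    \<comment> \<open>A crude radius: the ball of radius \<open>N\<close> contains \<open>F\<close>,
      so on \<open>F\<close> all truncations from \<open>N\<close> on agree with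
      \<open>u\<close>.\<close>
    define N where "N = nat (\<Sum>x\<in>F. lnorm x)"
    have FN: "lnorm x \<le> int N" if "x \<in> F" for x
      using member_le_sum[OF that, of lnorm] F by (simp add: N_def sum_nonneg)
    have "H1_norm (\<lambda>x. \<phi> m x - \<phi> n x) < \<epsilon>" if mn: "m \<ge> N" "n \<ge> N" for m n
    proof -
      let ?w = "\<lambda>x. \<phi> m x - \<phi> n x"
      have w0: "?w x = 0" if "x \<in> F" for x
        using FN[OF that] mn by (simp add: \<phi>_def)
      have wu: "\<bar>?w x\<bar> \<le> \<bar>u x\<bar>" for x
        by (simp add: \<phi>_def)
      have "sqsum ?w \<le> \<epsilon>\<^sup>2 / (2 * c)"
      proof (rule sq_summableI(2))
        fix A :: "(int ^ 'd) set" assume A: "finite A"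
        have "(\<Sum>x\<in>A. (?w x)\<^sup>2) = (\<Sum>x\<in>A - F. (?w x)\<^sup>2)"
          using A w0 by (intro sum.mono_neutral_right) auto
        also have "\<dots> \<le> (\<Sum>x\<in>A - F. (u x)\<^sup>2)"
          using wu by (intro sum_mono) (simp add: abs_le_square_iff)
        also have "\<dots> = (\<Sum>x\<in>(A - F) \<union> F. (u x)\<^sup>2) - (\<Sum>x\<in>F. (u x)\<^sup>2)"
          using A F by (subst sum.union_disjoint) auto
        also have "\<dots> \<le> sqsum u - (\<Sum>x\<in>F. (u x)\<^sup>2)"
          using A F sum_le_sqsum[OF u, of "(A - F) \<union> F"] by simp
        also have "\<dots> \<le> \<epsilon>\<^sup>2 / (2 * c)"
          using F(2) unfolding dist_real_def by linarith
        finally show "(\<Sum>x\<in>A. (?w x)\<^sup>2) \<le> \<epsilon>\<^sup>2 / (2 * c)" .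
      qed
      then have "c * sqsum ?w \<le> \<epsilon>\<^sup>2 / 2"
        using c by (simp add: field_simps)
      moreover have "(H1_norm ?w)\<^sup>2 \<le> c * sqsum ?w"
        using grad_norm_sq_le[OF sq_summable_diff[OF sum sum], of m n]
        unfolding H1_norm_sq c_def distrib_right by simp
      moreover have "\<epsilon>\<^sup>2 / 2 < \<epsilon>\<^sup>2" using that \<open>\<epsilon> > 0\<close> by simp
      ultimately have "(H1_norm ?w)\<^sup>2 < \<epsilon>\<^sup>2" by linarith
      then show ?thesis using \<open>\<epsilon> > 0\<close> by (simp add: power_less_imp_less_base)
    qed
    then show ?thesis by blast
  qed
  moreover have "(\<lambda>n. \<phi> n x) \<longlonglongrightarrow> u x" for x
  proof (rule tendsto_eventually)
    show "\<forall>\<^sub>F n in sequentially. \<phi> n x = u x"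
      unfolding \<phi>_def using eventually_ge_at_top[of "nat (lnorm x)"]
      by eventually_elim auto
  qed
  ultimately show "u \<in> H1"
    unfolding H1_def using fin by blast
qed

lemma energy_eq: "p \<noteq> 0 \<Longrightarrow> energy p u = 1 / 2 * grad_norm_sq u - 1 / p * powsum p u"
  by (simp add: energy_def lq_norm_powr)

lemma action_eq:
  "p \<noteq> 0 \<Longrightarrow> action p \<omega> u = 1 / 2 * grad_norm_sq u + \<omega> / 2 * sqsum u - 1 / p * powsum p u"
  by (simp add: action_def lq_norm_powr sq_lq_norm_2)

lemma multiplier_eq: "p \<noteq> 0 \<Longrightarrow> multiplier p u = (powsum p u - grad_norm_sq u) / sqsum u"
  by (simp add: multiplier_def lq_norm_powr sq_lq_norm_2)

lemma H1_mass_iff: "u \<in> H1_mass \<mu> \<longleftrightarrow> u \<in> sq_summable \<and> sqsum u = \<mu>"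
  by (simp add: H1_mass_def H1_eq sq_lq_norm_2)

lemma nehari_iff: "p \<noteq> 0 \<Longrightarrow> u \<in> nehari p \<omega> \<longleftrightarrow>
    u \<in> sq_summable \<and> u \<noteq> (\<lambda>x. 0) \<and> grad_norm_sq u + \<omega> * sqsum u = powsum p u"
  by (simp add: nehari_def H1_eq sq_lq_norm_2 lq_norm_powr)

section \<open>Existence of ground states\<close>

text \<open>Translating \<open>u n\<close> so that a value of size at least \<open>\<delta>\<close> sits at the origin keeps the pointwise limit
  away from zero. The functionals are translation invariant, so the translations do not show up in
  the conclusion.\<close>

lemma concentration_compactness:
  fixes u :: "nat \<Rightarrow> int ^ 'd \<Rightarrow> real"
  assumes u: "\<And>n. u n \<in> sq_summable" "\<And>n. sqsum (u n) \<le> K"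
    and \<delta>: "0 < \<delta>" "\<And>n. \<exists>x. \<delta> \<le> \<bar>u n x\<bar>"
  obtains r :: "nat \<Rightarrow> nat" and v :: "int ^ 'd \<Rightarrow> real" and b :: "nat \<Rightarrow> int ^ 'd \<Rightarrow> real" where
    "strict_mono r" "v \<in> sq_summable" "v \<noteq> (\<lambda>x. 0)" "\<And>n. b n \<in> sq_summable"
    "(\<lambda>n. sqsum (u (r n)) - sqsum (b n)) \<longlonglongrightarrow> sqsum v"
    "(\<lambda>n. grad_norm_sq (u (r n)) - grad_norm_sq (b n)) \<longlonglongrightarrow> grad_norm_sq v"
    "\<And>q. 2 \<le> q \<Longrightarrow> (\<lambda>n. powsum q (u (r n)) - powsum q (b n)) \<longlonglongrightarrow> powsum q v"
proof -
  obtain z where z: "\<And>n. \<delta> \<le> \<bar>u n (z n)\<bar>" using \<delta>(2) by metis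
  define w where "w n x = u n (x + z n)" for n x
  have w: "w n \<in> sq_summable" for n
    unfolding w_def by (rule sq_summable_shift[OF u(1)])
  have wN: "sqsum (w n) = sqsum (u n)" for n
    unfolding w_def by (rule sqsum_shift)
  have wG: "grad_norm_sq (w n) = grad_norm_sq (u n)" for n
    unfolding w_def by (rule grad_norm_sq_shift[OF u(1)])
  have wP: "powsum q (w n) = powsum q (u n)" for n q
    unfolding w_def by (rule powsum_shift)
  have wK: "sqsum (w n) \<le> K" for n by (simp add: wN u)
  have bd: "norm (w n x) \<le> sqrt K" for n x
    using order_trans[OF abs_le_sqrt_sqsum[OF w] real_sqrt_le_mono[OF wK]] by simp
  \<comment> \<open>A diagonal argument: the lattice is countable and all values are bounded by
    \<open>sqrt K\<close>.\<close>
  obtain r where r: "strict_mono r" "\<And>x. \<exists>l. (\<lambda>n. w (r n) x) \<longlonglongrightarrow> l"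
    using function_convergent_subsequence[of UNIV w "sqrt K"] bd by auto
  from r(2) obtain v where v: "\<And>x. (\<lambda>n. w (r n) x) \<longlonglongrightarrow> v x" by metis
  have vs: "v \<in> sq_summable" "sqsum v \<le> K"
    using sq_summable_pointwise_limit[of "\<lambda>n. w (r n)" K v] w wK v by auto
  have "\<delta> \<le> \<bar>v 0\<bar>"
  proof (rule LIMSEQ_le_const)
    show "(\<lambda>n. \<bar>w (r n) 0\<bar>) \<longlonglongrightarrow> \<bar>v 0\<bar>" by (intro tendsto_rabs v)
    show "\<exists>N. \<forall>n\<ge>N. \<delta> \<le> \<bar>w (r n) 0\<bar>" using z by (auto simp: w_def)
  qed
  then have v0: "v \<noteq> (\<lambda>x. 0)" using \<delta> by auto
  define b where "b n x = w (r n) x - v x" for n x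
  have bs: "b n \<in> sq_summable" for n
    unfolding b_def by (intro sq_summable_diff w vs)
  have bN: "sqsum (b n) \<le> 4 * K" for n
  proof -
    have "sqsum (\<lambda>x. w (r n) x + (-1) * v x) \<le> (1 + 1 / 1) * sqsum (w (r n)) + (1 + 1) * sqsum (\<lambda>x. (-1) * v x)"
      by (intro sqsum_add_le w sq_summable_cmult vs) auto
    moreover have "b n = (\<lambda>x. w (r n) x + (-1) * v x)"
      by (auto simp: b_def)
    ultimately have "sqsum (b n) \<le> 2 * sqsum (w (r n)) + 2 * sqsum v"
      unfolding sqsum_cmult by simp
    then show ?thesis using wK[of "r n"] vs(2) by linarith
  qed
  have b0: "(\<lambda>n. b n x) \<longlonglongrightarrow> 0" for x
    unfolding b_def using tendsto_diff[OF v tendsto_const, of x "v x"] by simp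
  have wb: "w (r n) = (\<lambda>x. v x + b n x)" for n by (auto simp: b_def)
  show thesis
  proof
    show "(\<lambda>n. sqsum (u (r n)) - sqsum (b n)) \<longlonglongrightarrow> sqsum v"
      using sqsum_brezis_lieb[OF vs(1) bs bN b0] by (simp flip: wb add: wN)
    show "(\<lambda>n. powsum q (u (r n)) - powsum q (b n)) \<longlonglongrightarrow> powsum q v" if "2 \<le> q" for q
      using brezis_lieb[OF vs(1) bs bN b0 that] by (simp flip: wb add: wP)
    \<comment> \<open>Differences are linear and commute with pointwise limits, so each direction of
      the gradient decouples by the same lemma as the mass.\<close>
    have "(\<lambda>n. sqsum (shift_diff e (w (r n))) - sqsum (shift_diff e (b n))) \<longlonglongrightarrow> sqsum (shift_diff e v)" for e
    proof -
      have w_eq: "shift_diff e (w (r n)) = (\<lambda>x. shift_diff e v x + shift_diff e (b n) x)" for n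
        unfolding wb by (auto simp: shift_diff_def)
      have bd_e: "sqsum (shift_diff e (b n)) \<le> 16 * K" for n
        using sqsum_shift_diff_le_sqsum[OF bs, of e n] bN[of n] by simp
      have lim_e: "(\<lambda>n. shift_diff e (b n) x) \<longlonglongrightarrow> 0" for x
        unfolding shift_diff_def using tendsto_diff[OF b0 b0] by simp
      show ?thesis
        unfolding w_eq
        by (rule sqsum_brezis_lieb[OF sq_summable_shift_diff[OF vs(1)] sq_summable_shift_diff[OF bs] bd_e lim_e])
    qed
    then have "(\<lambda>n. 1 / 2 * (\<Sum>e\<in>unit_steps. sqsum (shift_diff e (w (r n))) - sqsum (shift_diff e (b n))))
        \<longlonglongrightarrow> 1 / 2 * (\<Sum>e\<in>unit_steps. sqsum (shift_diff e v))"
      by (intro tendsto_mult tendsto_const tendsto_sum)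
    then show "(\<lambda>n. grad_norm_sq (u (r n)) - grad_norm_sq (b n)) \<longlonglongrightarrow> grad_norm_sq v"
      unfolding wG[symmetric] grad_norm_sq_eq[OF w] grad_norm_sq_eq[OF bs] grad_norm_sq_eq[OF vs(1)]
      by (simp add: sum_subtractf right_diff_distrib)
  qed (use r vs v0 bs in auto)
qed

section \<open>Energy ground states at fixed mass\<close>

lemma sqrt_powr: "0 \<le> t \<Longrightarrow> sqrt t powr q = t powr (q / 2)"
  by (simp add: powr_half_sqrt[symmetric] powr_powr)

lemma energy_scale:
  assumes "0 < p" "0 \<le> t"
  shows "energy p (\<lambda>x. sqrt t * u x) = t / 2 * grad_norm_sq u - t powr (p / 2) / p * powsum p u"
  using assms by (simp add: energy_eq grad_norm_sq_cmult powsum_cmult sqrt_powr)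

text \<open>The contrapositive of \<open>powsum_le_sup\<close>; it provides the hypothesis on
  \<open>\<delta>\<close> in \<open>concentration_compactness\<close>.\<close>

lemma exists_large_value:
  assumes "u \<in> sq_summable" "2 \<le> p" "\<delta> powr (p - 2) * sqsum u < powsum p u"
  shows "\<exists>x. \<delta> \<le> \<bar>u x\<bar>"
proof (rule ccontr)
  assume "\<not> ?thesis"
  then have "powsum p u \<le> \<delta> powr (p - 2) * sqsum u"
    using assms by (intro powsum_le_sup) (auto simp: not_le less_imp_le)
  then show False using assms by simp
qed

lemma energy_lower_bound:
  assumes "2 < p" "u \<in> sq_summable"
  shows "- (sqsum u powr (p / 2)) / p \<le> energy p u"
proof -
  have "powsum p u / p \<le> sqsum u powr (p / 2) / p"
    using powsum_le_sqsum[OF assms(2), of p] assms by (intro divide_right_mono) auto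
  then have "- (sqsum u powr (p / 2)) / p \<le> - (1 / p * powsum p u)" by simp
  moreover have "p \<noteq> 0" using assms by simp
  ultimately show ?thesis
    using grad_norm_sq_nonneg[of u] unfolding energy_eq[OF \<open>p \<noteq> 0\<close>] by linarith
qed

lemma powsum_ge_energy:
  assumes "0 < p"
  shows "- p * energy p u \<le> powsum p u"
proof -
  have "- energy p u \<le> powsum p u / p"
    using assms by (simp add: energy_eq)
  then show ?thesis using assms by (simp add: field_simps)
qed

text \<open>Strict subadditivity of the minimal energy, in the form used to exclude dichotomy.\<close>

lemma energy_ge_scaled_level:
  fixes y :: "int ^ 'd \<Rightarrow> real"
  assumes p: "2 < p" and \<mu>: "0 < \<mu>" and y: "y \<in> sq_summable" "sqsum y \<le> \<mu>"
    and I: "\<And>v :: int ^ 'd \<Rightarrow> real. v \<in> sq_summable \<Longrightarrow> sqsum v = \<mu> \<Longrightarrow> I \<le> energy p v"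
  shows "sqsum y / \<mu> * I \<le> energy p y"
    and "y \<noteq> (\<lambda>x. 0) \<Longrightarrow> sqsum y < \<mu> \<Longrightarrow> sqsum y / \<mu> * I < energy p y"
proof -
  \<comment> \<open>Stretch \<open>y\<close> to mass \<open>\<mu>\<close> and divide the energy by
    the factor \<open>t\<close>: the gradient term is unchanged, while the power term gains
    \<open>t powr (p / 2 - 1)\<close>. The surplus is kept explicit since both the weak and the
    strict claim are read off from its sign.\<close>
  have *: "sqsum y / \<mu> * I + ((\<mu> / sqsum y) powr (p / 2 - 1) - 1) * powsum p y / p \<le> energy p y"
    if "y \<noteq> (\<lambda>x. 0)"
  proof -
    define t where "t = \<mu> / sqsum y"
    have N: "0 < sqsum y" using sqsum_pos y that by blast
    have t: "0 < t" using N \<mu> by (simp add: t_def)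
    have "I \<le> energy p (\<lambda>x. sqrt t * y x)"
      using t N by (intro I sq_summable_cmult y) (simp add: sqsum_cmult t_def)
    then have "I / t \<le> (t / 2 * grad_norm_sq y - t powr (p / 2) / p * powsum p y) / t"
      using t p by (simp add: energy_scale divide_right_mono)
    also have "\<dots> = grad_norm_sq y / 2 - t powr (p / 2 - 1) / p * powsum p y"
    proof -
      have "t powr (p / 2) = t * t powr (p / 2 - 1)"
        using powr_mult_base[of t "p / 2 - 1"] t by simp
      then show ?thesis using t by (simp add: diff_divide_distrib)
    qed
    finally have "I / t \<le> grad_norm_sq y / 2 - t powr (p / 2 - 1) / p * powsum p y" .
    moreover have "sqsum y / \<mu> * I = I / t" by (simp add: t_def)
    moreover have "(t powr (p / 2 - 1) - 1) * powsum p y / p = t powr (p / 2 - 1) / p * powsum p y - powsum p y / p"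
      by (simp add: left_diff_distrib diff_divide_distrib)
    moreover have "energy p y = grad_norm_sq y / 2 - powsum p y / p"
      using p by (simp add: energy_eq)
    ultimately show ?thesis unfolding t_def[symmetric] by linarith
  qed
  show "sqsum y / \<mu> * I \<le> energy p y"
  proof (cases "y = (\<lambda>x. 0)")
    case True
    then show ?thesis using p by (simp add: energy_eq sqsum_def powsum_def)
  next
    case False
    then have "1 \<le> \<mu> / sqsum y"
      using y sqsum_pos by (metis le_divide_eq_1)
    then have "1 \<le> (\<mu> / sqsum y) powr (p / 2 - 1)"
      using p by (intro ge_one_powr_ge_zero) auto
    then have "0 \<le> ((\<mu> / sqsum y) powr (p / 2 - 1) - 1) * powsum p y / p"
      using p by simp
    then show ?thesis using *[OF False] by linarith
  qed
  show "sqsum y / \<mu> * I < energy p y" if "y \<noteq> (\<lambda>x. 0)" "sqsum y < \<mu>"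
  proof -
    have "1 < \<mu> / sqsum y"
      using y sqsum_pos that by (metis less_divide_eq_1)
    then have "1 < (\<mu> / sqsum y) powr (p / 2 - 1)"
      using p by simp
    then have "0 < ((\<mu> / sqsum y) powr (p / 2 - 1) - 1) * powsum p y / p"
      using p powsum_pos[OF y(1) _ that(1), of p] by simp
    then show ?thesis using *[OF that(1)] by linarith
  qed
qed

text \<open>Beyond convergence, every member is within \<open>c\<close> of the infimum. This gives
  uniform bounds from the first index on: energies below half of a negative infimum, or power sums
  below a fixed constant.\<close>

lemma minimizing_sequence:
  fixes f :: "'a \<Rightarrow> real"
  assumes "S \<noteq> {}" "bdd_below (f ` S)" "0 < c"
  obtains u where "\<And>n. u n \<in> S" "\<And>n. f (u n) < Inf (f ` S) + c"
    "(\<lambda>n. f (u n)) \<longlonglongrightarrow> Inf (f ` S)"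
proof -
  define e where "e n = min c (1 / real (Suc n))" for n
  have e: "0 < e n" for n using assms by (simp add: e_def)
  have "\<exists>u\<in>S. f u < Inf (f ` S) + e n" for n
    using cInf_lessD[of "f ` S" "Inf (f ` S) + e n"] assms(1) e by auto
  then obtain u where u: "\<And>n. u n \<in> S" "\<And>n. f (u n) < Inf (f ` S) + e n" by metis
  have "(\<lambda>n. Inf (f ` S) + 1 / real (Suc n)) \<longlonglongrightarrow> Inf (f ` S) + 0"
    by (intro tendsto_add tendsto_const lim_1_over_n[THEN LIMSEQ_Suc])
  then have lim: "(\<lambda>n. Inf (f ` S) + 1 / real (Suc n)) \<longlonglongrightarrow> Inf (f ` S)" by simp
  have "(\<lambda>n. f (u n)) \<longlonglongrightarrow> Inf (f ` S)"
  proof (rule tendsto_sandwich[OF _ _ tendsto_const lim]; rule always_eventually; rule allI)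
    show "Inf (f ` S) \<le> f (u n)" for n
      using u(1) assms(2) by (intro cINF_lower)
    show "f (u n) \<le> Inf (f ` S) + 1 / real (Suc n)" for n
      using u(2)[of n] unfolding e_def by linarith
  qed
  moreover have "f (u n) < Inf (f ` S) + c" for n
    using u(2)[of n] by (simp add: e_def)
  ultimately show thesis using that u(1) by blast
qed

text \<open>Let \<open>m\<close> be the mass of the extracted limit \<open>v\<close>. The remainders
  have masses tending to \<open>\<mu> - m\<close> and energies tending to
  \<open>I - energy p v\<close>, and their scaled lower bound gives
  \<open>energy p v \<le> m / \<mu> * I\<close>. Strictness in \<open>energy_ge_scaled_level\<close>
  forbids this for \<open>0 < m < \<mu>\<close>, so no mass is lost.\<close>

lemma energy_ground_state_exists:
  fixes w :: "int ^ 'd \<Rightarrow> real"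
  assumes p: "2 < p" and \<mu>: "0 < \<mu>"
    and w: "w \<in> sq_summable" "sqsum w = \<mu>" "energy p w < 0"
  obtains u :: "int ^ 'd \<Rightarrow> real" where "energy_ground_state p \<mu> u" "\<And>x. 0 \<le> u x"
proof -
  define S :: "(int ^ 'd \<Rightarrow> real) set" where "S = {u \<in> sq_summable. sqsum u = \<mu>}"
  define I where "I = Inf (energy p ` S)"
  have SI: "S \<noteq> {}" using w by (auto simp: S_def)
  have bdd: "bdd_below (energy p ` S)"
    using energy_lower_bound[OF p] by (intro bdd_belowI2[of _ "- (\<mu> powr (p / 2)) / p"]) (auto simp: S_def)
  have I: "I \<le> energy p v" if "v \<in> sq_summable" "sqsum v = \<mu>" for v :: "int ^ 'd \<Rightarrow> real"
    unfolding I_def using that bdd by (intro cINF_lower) (auto simp: S_def)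
  have I0: "I < 0" using I[OF w(1,2)] w(3) by linarith
  obtain u where u: "\<And>n. u n \<in> S" "\<And>n. energy p (u n) < I + (- I / 2)" "(\<lambda>n. energy p (u n)) \<longlonglongrightarrow> I"
    using minimizing_sequence[OF SI bdd, of "- I / 2"] I0 by (auto simp flip: I_def)
  have us: "u n \<in> sq_summable" "sqsum (u n) = \<mu>" for n using u(1) by (auto simp: S_def)
  \<comment> \<open>Chosen so that \<open>\<delta> powr (p - 2) * \<mu> = - p * I / 2\<close>.
    Energy below \<open>I / 2\<close> pushes the power sum above this value.\<close>
  define \<delta> where "\<delta> = (p * (- I) / (2 * \<mu>)) powr (1 / (p - 2))"
  have \<delta>: "0 < \<delta>" using p I0 \<mu> by (simp add: \<delta>_def divide_neg_pos mult_pos_neg)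
  have "\<exists>x. \<delta> \<le> \<bar>u n x\<bar>" for n
  proof (rule exists_large_value[OF us(1)])
    have "1 / (p - 2) * (p - 2) = 1" using p by simp
    moreover have "0 \<le> p * (- I) / (2 * \<mu>)"
      using p I0 \<mu> by (intro divide_nonneg_pos mult_nonneg_nonneg) auto
    ultimately have "\<delta> powr (p - 2) = p * (- I) / (2 * \<mu>)"
      unfolding \<delta>_def powr_powr by (simp only: powr_one)
    then have "\<delta> powr (p - 2) * sqsum (u n) = - p * (I / 2)"
      using \<mu> by (simp add: us)
    also have "\<dots> < - p * energy p (u n)"
      using u(2)[of n] p by simp
    also have "\<dots> \<le> powsum p (u n)"
      using p by (intro powsum_ge_energy) simp
    finally show "\<delta> powr (p - 2) * sqsum (u n) < powsum p (u n)" .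
  qed (use p in simp)
  note large = this
  obtain r :: "nat \<Rightarrow> nat" and v :: "int ^ 'd \<Rightarrow> real" and b :: "nat \<Rightarrow> int ^ 'd \<Rightarrow> real" where r: "strict_mono r" and v: "v \<in> sq_summable" "v \<noteq> (\<lambda>x. 0)"
    and b: "\<And>n. b n \<in> sq_summable"
    and lN: "(\<lambda>n. sqsum (u (r n)) - sqsum (b n)) \<longlonglongrightarrow> sqsum v"
    and lG: "(\<lambda>n. grad_norm_sq (u (r n)) - grad_norm_sq (b n)) \<longlonglongrightarrow> grad_norm_sq v"
    and lP: "\<And>q. 2 \<le> q \<Longrightarrow> (\<lambda>n. powsum q (u (r n)) - powsum q (b n)) \<longlonglongrightarrow> powsum q v"
    using concentration_compactness[of u \<mu> \<delta>, OF us(1) eq_refl[OF us(2)] \<delta> large] by blast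
  have m0: "0 < sqsum v" using v sqsum_pos by blast
  have bN: "(\<lambda>n. sqsum (b n)) \<longlonglongrightarrow> \<mu> - sqsum v"
    using tendsto_diff[OF tendsto_const lN, of \<mu>] by (simp add: us)
  have m1: "sqsum v \<le> \<mu>"
    using LIMSEQ_le_const[OF bN, of 0] by simp
  have "(\<lambda>n. 1 / 2 * (grad_norm_sq (u (r n)) - grad_norm_sq (b n)) - 1 / p * (powsum p (u (r n)) - powsum p (b n)))
      \<longlonglongrightarrow> 1 / 2 * grad_norm_sq v - 1 / p * powsum p v"
    using p by (intro tendsto_intros lG lP) auto
  then have "(\<lambda>n. energy p (u (r n)) - energy p (b n)) \<longlonglongrightarrow> energy p v"
    using p by (simp add: energy_eq diff_divide_distrib algebra_simps)
  from tendsto_diff[OF LIMSEQ_subseq_LIMSEQ[OF u(3) r] this]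
  have bE: "(\<lambda>n. energy p (b n)) \<longlonglongrightarrow> I - energy p v" by (simp add: o_def)
  \<comment> \<open>The scaled bound needs mass at most \<open>\<mu>\<close>. The remainders have
    this eventually, because \<open>v\<close> carries positive mass.\<close>
  have "\<forall>\<^sub>F n in sequentially. sqsum (b n) < \<mu>"
    using order_tendstoD(2)[OF bN, of \<mu>] m0 by simp
  then have "\<forall>\<^sub>F n in sequentially. sqsum (b n) / \<mu> * I \<le> energy p (b n)"
    by eventually_elim (use energy_ge_scaled_level(1)[OF p \<mu> b] I in simp)
  note ev = this
  have "(\<lambda>n. sqsum (b n) / \<mu> * I) \<longlonglongrightarrow> (\<mu> - sqsum v) / \<mu> * I"
    using \<mu> by (intro tendsto_intros bN) auto
  from tendsto_le[OF _ bE this ev] have "(\<mu> - sqsum v) / \<mu> * I \<le> I - energy p v"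
    by simp
  then have Ev: "energy p v \<le> sqsum v / \<mu> * I"
    using \<mu> by (simp add: field_simps)
  have mm: "sqsum v = \<mu>"
    using energy_ge_scaled_level(2)[OF p \<mu> v(1) m1 I v(2)] Ev m1 by force
  \<comment> \<open>The absolute value keeps mass and power sum and does not increase the gradient,
    so the minimizer may be taken nonnegative.\<close>
  define a where "a = (\<lambda>x. \<bar>v x\<bar>)"
  have "energy p a \<le> energy p v"
    using grad_norm_sq_abs_le[OF v(1)] p by (simp add: energy_eq a_def powsum_abs divide_right_mono)
  also have "\<dots> \<le> I" using Ev mm \<mu> by simp
  finally have "energy p a \<le> I" .
  moreover have "a \<in> sq_summable" "sqsum a = \<mu>"
    using v mm by (simp_all add: a_def sq_summable_abs sqsum_abs)
  ultimately have "energy_ground_state p \<mu> a"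
    using I by (auto simp: energy_ground_state_def H1_mass_iff intro: order_trans)
  then show thesis using that by (simp add: a_def)
qed

section \<open>Action ground states on the Nehari manifold\<close>

definition quad_form :: "real \<Rightarrow> (int ^ 'd \<Rightarrow> real) \<Rightarrow> real" where
  "quad_form \<omega> u = grad_norm_sq u + \<omega> * sqsum u"

lemma quad_form_pos:
  assumes "0 < \<omega>" "u \<in> sq_summable" "u \<noteq> (\<lambda>x. 0)"
  shows "0 < quad_form \<omega> u"
  unfolding quad_form_def using assms sqsum_pos[OF assms(2,3)]
  by (intro add_nonneg_pos) auto

lemma quad_form_nonneg: "0 < \<omega> \<Longrightarrow> 0 \<le> quad_form \<omega> u"
  by (simp add: quad_form_def)

text \<open>\<open>t\<close> is the positive solution of
  \<open>t\<^sup>2 * quad_form \<omega> y = t powr p * powsum p y\<close>, the Nehari identity along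
  the ray through \<open>y\<close>.\<close>

lemma nehari_scaling:
  assumes p: "2 < p" and \<omega>: "0 < \<omega>" and y: "y \<in> sq_summable" "y \<noteq> (\<lambda>x. 0)"
  defines "t \<equiv> (quad_form \<omega> y / powsum p y) powr (1 / (p - 2))"
  shows "0 < t" "(\<lambda>x. t * y x) \<in> nehari p \<omega>"
proof -
  have P: "0 < powsum p y" using p y by (intro powsum_pos) auto
  have A: "0 < quad_form \<omega> y" using \<omega> y by (rule quad_form_pos)
  show t: "0 < t" using P A by (simp add: t_def)
  have "t powr p = t\<^sup>2 * t powr (p - 2)"
  proof -
    have "t powr p = t powr 2 * t powr (p - 2)" by (subst powr_add[symmetric]) simp
    then show ?thesis using t by simp
  qed
  also have "t powr (p - 2) = quad_form \<omega> y / powsum p y"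
    unfolding t_def powr_powr using p P A by simp
  finally have "t powr p * powsum p y = t\<^sup>2 * quad_form \<omega> y" using P by simp
  moreover have "(\<lambda>x. t * y x) \<noteq> (\<lambda>x. 0)" using t y(2) by (auto simp: fun_eq_iff)
  ultimately show "(\<lambda>x. t * y x) \<in> nehari p \<omega>"
    using p t y by (simp add: nehari_iff sq_summable_cmult grad_norm_sq_cmult sqsum_cmult powsum_cmult
        quad_form_def algebra_simps)
qed

text \<open>Rescaling to the Nehari set turns a lower bound there into a homogeneous inequality of
  Sobolev type for every \<open>y\<close>. In this form it applies to functions off the Nehari set:
  the remainders in the existence proof, and the variations \<open>u + t * v\<close> in the proof of
  criticality.\<close>

lemma powsum_le_quad_form:
  fixes y :: "int ^ 'd \<Rightarrow> real"
  assumes p: "2 < p" and \<omega>: "0 < \<omega>" and y: "y \<in> sq_summable"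
    and c: "0 < c" "\<And>v :: int ^ 'd \<Rightarrow> real. v \<in> nehari p \<omega> \<Longrightarrow> c \<le> powsum p v"
  shows "powsum p y \<le> c * (quad_form \<omega> y / c) powr (p / 2)"
proof (cases "y = (\<lambda>x. 0)")
  case True
  then show ?thesis using c by (simp add: powsum_def)
next
  case False
  define A P where "A = quad_form \<omega> y" and "P = powsum p y"
  have P: "0 < P" using p y False unfolding P_def by (intro powsum_pos) auto
  have A: "0 < A" using \<omega> y False unfolding A_def by (rule quad_form_pos)
  define t where "t = (A / P) powr (1 / (p - 2))"
  have t: "0 < t" "(\<lambda>x. t * y x) \<in> nehari p \<omega>"
    using nehari_scaling[OF p \<omega> y False] by (simp_all add: t_def A_def P_def)
  have "c \<le> t powr p * P"
    using c(2)[OF t(2)] t(1) by (simp add: powsum_cmult P_def)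
  then have "c powr ((p - 2) / 2) \<le> (t powr p * P) powr ((p - 2) / 2)"
    using c p by (intro powr_mono2) auto
  also have "\<dots> = (A / P) powr (p / 2) * P powr (p / 2 - 1)"
  proof -
    have ex: "1 / (p - 2) * p * ((p - 2) / 2) = p / 2" using p by simp
    have "(t powr p) powr ((p - 2) / 2) = (A / P) powr (p / 2)"
      by (simp only: t_def powr_powr ex)
    then show ?thesis
      using P by (simp add: powr_mult diff_divide_distrib)
  qed
  also have "\<dots> = A powr (p / 2) / P"
    using P A by (simp add: powr_divide powr_diff)
  finally have le: "c powr ((p - 2) / 2) \<le> A powr (p / 2) / P" .
  have "(p - 2) / 2 = p / 2 - 1" by simp
  with le have "c powr (p / 2 - 1) * P \<le> A powr (p / 2)"
    unfolding pos_le_divide_eq[OF P] by simp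
  moreover have "0 < c powr (p / 2 - 1)" using c by simp
  ultimately have "P \<le> A powr (p / 2) / c powr (p / 2 - 1)"
    using pos_le_divide_eq by (metis mult.commute)
  also have "\<dots> = c * (A / c) powr (p / 2)"
    using A c by (simp add: powr_divide powr_diff)
  finally show ?thesis by (simp add: A_def P_def)
qed

text \<open>The constraint eliminates the quadratic part. For \<open>p > 2\<close> the factor is
  positive, so minimizing the action on the Nehari set means minimizing the power sum.\<close>

lemma action_on_nehari:
  assumes "0 < p" "u \<in> nehari p \<omega>"
  shows "action p \<omega> u = (1 / 2 - 1 / p) * powsum p u"
proof -
  have "action p \<omega> u = 1 / 2 * (grad_norm_sq u + \<omega> * sqsum u) - 1 / p * powsum p u"
    using assms by (simp add: action_eq)
  also have "grad_norm_sq u + \<omega> * sqsum u = powsum p u"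
    using assms by (simp add: nehari_iff)
  finally show ?thesis by (simp add: left_diff_distrib)
qed

lemma action_ground_state_iff:
  fixes u :: "int ^ 'd \<Rightarrow> real"
  assumes "2 < p"
  shows "action_ground_state p \<omega> u \<longleftrightarrow>
    u \<in> nehari p \<omega> \<and> (\<forall>v\<in>(nehari p \<omega> :: (int ^ 'd \<Rightarrow> real) set). powsum p u \<le> powsum p v)"
proof -
  have "action p \<omega> u \<le> action p \<omega> v \<longleftrightarrow> powsum p u \<le> powsum p v"
    if "u \<in> nehari p \<omega>" "v \<in> nehari p \<omega>" for v :: "int ^ 'd \<Rightarrow> real"
  proof -
    have "0 < 1 / 2 - 1 / p" using assms by (simp add: field_simps)
    then show ?thesis
      using assms that by (simp add: action_on_nehari del: diff_gt_0_iff_gt)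
  qed
  then show ?thesis unfolding action_ground_state_def by auto
qed

text \<open>The first bound drops the gradient from the constraint; the second combines it with
  \<open>powsum_le_sqsum\<close> to \<open>\<omega> * N \<le> N powr (p / 2)\<close> for the mass
  \<open>N\<close>. Together they keep the infimum of the power sum on the Nehari set
  positive.\<close>

lemma nehari_sqsum_bounds:
  assumes p: "2 < p" and \<omega>: "0 < \<omega>" and u: "u \<in> nehari p \<omega>"
  shows "\<omega> * sqsum u \<le> powsum p u" "\<omega> powr (2 / (p - 2)) \<le> sqsum u"
proof -
  have us: "u \<in> sq_summable" "u \<noteq> (\<lambda>x. 0)" "grad_norm_sq u + \<omega> * sqsum u = powsum p u"
    using p u by (auto simp: nehari_iff)
  show 1: "\<omega> * sqsum u \<le> powsum p u"
    using us(3) grad_norm_sq_nonneg[of u] by linarith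
  have N: "0 < sqsum u" using us sqsum_pos by blast
  have "\<omega> * sqsum u \<le> sqsum u powr (p / 2)"
    using 1 powsum_le_sqsum[OF us(1), of p] p by linarith
  also have "\<dots> = sqsum u powr (p / 2 - 1) * sqsum u"
    using N by (simp add: powr_diff)
  finally have "\<omega> \<le> sqsum u powr ((p - 2) / 2)"
    using N by (simp add: diff_divide_distrib)
  then have "\<omega> powr (2 / (p - 2)) \<le> (sqsum u powr ((p - 2) / 2)) powr (2 / (p - 2))"
    using \<omega> p by (intro powr_mono2) auto
  also have "\<dots> = sqsum u"
  proof -
    have "(p - 2) / 2 * (2 / (p - 2)) = 1" using p by simp
    then show ?thesis using N by (simp only: powr_powr powr_one less_imp_le)
  qed
  finally show "\<omega> powr (2 / (p - 2)) \<le> sqsum u" .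
qed

text \<open>With \<open>a = quad_form \<omega> v\<close>, the homogeneous inequality for
  \<open>v\<close> and, in the limit, for the remainders gives
  \<open>1 \<le> (a / c) powr (p / 2) + ((c - a) / c) powr (p / 2)\<close>. As
  \<open>p / 2 > 1\<close> and \<open>a > 0\<close>, this leaves only \<open>a = c\<close>.\<close>

lemma action_ground_state_exists:
  assumes p: "2 < p" and \<omega>: "0 < \<omega>"
  obtains u :: "int ^ 'd \<Rightarrow> real" where "action_ground_state p \<omega> u" "\<And>x. 0 \<le> u x"
proof -
  define S :: "(int ^ 'd \<Rightarrow> real) set" where "S = nehari p \<omega>"
  define c where "c = Inf (powsum p ` S)"
  \<comment> \<open>A point mass, which after rescaling shows that the Nehari set is
    nonempty.\<close>
  define \<delta>0 :: "int ^ 'd \<Rightarrow> real" where "\<delta>0 = (\<lambda>x. of_bool (x = 0))"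
  have "\<delta>0 \<in> sq_summable" by (rule sq_summable_finite_support) (simp add: \<delta>0_def)
  moreover have "\<delta>0 0 \<noteq> 0" by (simp add: \<delta>0_def)
  ultimately have SI: "S \<noteq> {}"
    unfolding S_def using nehari_scaling(2)[OF p \<omega>, of \<delta>0] by force
  have bdd: "bdd_below (powsum p ` S)"
    by (intro bdd_belowI2[of _ 0]) simp
  have cle: "c \<le> powsum p v" if "v \<in> nehari p \<omega>" for v :: "int ^ 'd \<Rightarrow> real"
    unfolding c_def using that bdd by (intro cINF_lower) (auto simp: S_def)
  have "\<omega> * \<omega> powr (2 / (p - 2)) \<le> c"
    unfolding c_def
  proof (rule cINF_greatest[OF SI])
    fix u assume "u \<in> S"
    then have "\<omega> * \<omega> powr (2 / (p - 2)) \<le> \<omega> * sqsum u"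
      using nehari_sqsum_bounds(2)[OF p \<omega>, of u] \<omega> by (intro mult_left_mono) (auto simp: S_def)
    also have "\<dots> \<le> powsum p u"
      using nehari_sqsum_bounds(1)[OF p \<omega>, of u] \<open>u \<in> S\<close> by (auto simp: S_def)
    finally show "\<omega> * \<omega> powr (2 / (p - 2)) \<le> powsum p u" .
  qed
  moreover have "0 < \<omega> * \<omega> powr (2 / (p - 2))" using \<omega> by simp
  ultimately have c: "0 < c" by linarith
  obtain u where u: "\<And>n. u n \<in> S" "\<And>n. powsum p (u n) < c + 1" "(\<lambda>n. powsum p (u n)) \<longlonglongrightarrow> c"
    using minimizing_sequence[OF SI bdd, of 1] by (auto simp flip: c_def)
  have us: "u n \<in> sq_summable" "u n \<noteq> (\<lambda>x. 0)" "quad_form \<omega> (u n) = powsum p (u n)" for n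
    using u(1)[of n] p by (auto simp: S_def nehari_iff quad_form_def)
  have uK: "sqsum (u n) \<le> (c + 1) / \<omega>" for n
    using nehari_sqsum_bounds(1)[OF p \<omega> u(1)[of n, unfolded S_def]] u(2)[of n] \<omega>
    by (simp add: field_simps)
  \<comment> \<open>Chosen so that \<open>\<delta> powr (p - 2) = \<omega> / 2\<close>, half of the
    ratio of power sum to mass that the Nehari identity enforces.\<close>
  define \<delta> where "\<delta> = (\<omega> / 2) powr (1 / (p - 2))"
  have \<delta>: "0 < \<delta>" using \<omega> by (simp add: \<delta>_def)
  have "\<exists>x. \<delta> \<le> \<bar>u n x\<bar>" for n
  proof (rule exists_large_value[OF us(1)])
    have "\<delta> powr (p - 2) = \<omega> / 2"
      unfolding \<delta>_def powr_powr using p \<omega> by simp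
    then have "\<delta> powr (p - 2) * sqsum (u n) = \<omega> * sqsum (u n) / 2" by simp
    also have "\<dots> < \<omega> * sqsum (u n)"
      using \<omega> sqsum_pos[OF us(1,2)] by simp
    also have "\<dots> \<le> powsum p (u n)"
      by (rule nehari_sqsum_bounds(1)[OF p \<omega> u(1)[of n, unfolded S_def]])
    finally show "\<delta> powr (p - 2) * sqsum (u n) < powsum p (u n)" .
  qed (use p in simp)
  note large = this
  obtain r :: "nat \<Rightarrow> nat" and v :: "int ^ 'd \<Rightarrow> real" and b :: "nat \<Rightarrow> int ^ 'd \<Rightarrow> real" where r: "strict_mono r" and v: "v \<in> sq_summable" "v \<noteq> (\<lambda>x. 0)"
    and b: "\<And>n. b n \<in> sq_summable"
    and lN: "(\<lambda>n. sqsum (u (r n)) - sqsum (b n)) \<longlonglongrightarrow> sqsum v"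
    and lG: "(\<lambda>n. grad_norm_sq (u (r n)) - grad_norm_sq (b n)) \<longlonglongrightarrow> grad_norm_sq v"
    and lP: "\<And>q. 2 \<le> q \<Longrightarrow> (\<lambda>n. powsum q (u (r n)) - powsum q (b n)) \<longlonglongrightarrow> powsum q v"
    using concentration_compactness[of u "(c + 1) / \<omega>" \<delta>, OF us(1) uK \<delta> large] by blast
  define a where "a = quad_form \<omega> v"
  have a: "0 < a" unfolding a_def using \<omega> v by (rule quad_form_pos)
  have lur: "(\<lambda>n. powsum p (u (r n))) \<longlonglongrightarrow> c"
    using LIMSEQ_subseq_LIMSEQ[OF u(3) r] by (simp add: o_def)
  have "(\<lambda>n. (grad_norm_sq (u (r n)) - grad_norm_sq (b n)) + \<omega> * (sqsum (u (r n)) - sqsum (b n)))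
      \<longlonglongrightarrow> a"
    unfolding a_def quad_form_def by (intro tendsto_intros lG lN)
  then have "(\<lambda>n. quad_form \<omega> (u (r n)) - quad_form \<omega> (b n)) \<longlonglongrightarrow> a"
    by (simp add: quad_form_def algebra_simps)
  from tendsto_diff[OF lur this] have bA: "(\<lambda>n. quad_form \<omega> (b n)) \<longlonglongrightarrow> c - a"
    by (simp add: us)
  have ac: "a \<le> c"
    using LIMSEQ_le_const[OF bA, of 0] quad_form_nonneg[OF \<omega>] by auto
  have bP: "(\<lambda>n. powsum p (b n)) \<longlonglongrightarrow> c - powsum p v"
    using tendsto_diff[OF lur lP[of p]] p by simp
  have "(\<lambda>n. c * (quad_form \<omega> (b n) / c) powr (p / 2)) \<longlonglongrightarrow> c * ((c - a) / c) powr (p / 2)"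
    using p c quad_form_nonneg[OF \<omega>] by (intro tendsto_intros tendsto_powr' bA)
      (auto intro!: always_eventually divide_nonneg_pos quad_form_nonneg \<omega>)
  then have 1: "c - powsum p v \<le> c * ((c - a) / c) powr (p / 2)"
    by (rule LIMSEQ_le[OF bP]) (use powsum_le_quad_form[OF p \<omega> b c cle] in auto)
  have 2: "powsum p v \<le> c * (a / c) powr (p / 2)"
    using powsum_le_quad_form[OF p \<omega> v(1) c cle] by (simp add: a_def)
  \<comment> \<open>Otherwise both fractions lie strictly between 0 and 1 and add up to 1, and
    raising them to a power above 1 makes the sum strictly smaller.\<close>
  have "a = c"
  proof (rule ccontr)
    assume "a \<noteq> c"
    then have "a / c < 1" "0 < a / c" "0 < (c - a) / c" "(c - a) / c < 1" using ac a c by auto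
    then have "(a / c) powr (p / 2) < (a / c) powr 1" "((c - a) / c) powr (p / 2) < ((c - a) / c) powr 1"
      using p by - (rule powr_less_mono'; simp)+
    then have "(a / c) powr (p / 2) + ((c - a) / c) powr (p / 2) < a / c + (c - a) / c"
      using a c ac by simp
    then have "c * ((a / c) powr (p / 2) + ((c - a) / c) powr (p / 2)) < c * (a / c + (c - a) / c)"
      using c by simp
    then show False using 1 2 c by (simp add: field_simps)
  qed
  then have Pv: "powsum p v = c" using 1 2 c by simp
  define w where "w = (\<lambda>x. \<bar>v x\<bar>)"
  have w: "w \<in> sq_summable" "w \<noteq> (\<lambda>x. 0)" "powsum p w = c"
    using v Pv by (auto simp: w_def sq_summable_abs powsum_abs fun_eq_iff)
  have "quad_form \<omega> w \<le> c"
    using grad_norm_sq_abs_le[OF v(1)] \<open>a = c\<close> by (simp add: w_def quad_form_def sqsum_abs a_def)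
  \<comment> \<open>The absolute value may lower the quadratic form and so leave the Nehari set. The
    factor returning to it is at most 1, hence does not raise the power sum above
    \<open>c\<close>.\<close>
  define t where "t = (quad_form \<omega> w / powsum p w) powr (1 / (p - 2))"
  have t: "0 < t" "(\<lambda>x. t * w x) \<in> nehari p \<omega>"
    using nehari_scaling[OF p \<omega> w(1,2)] by (simp_all add: t_def)
  have "t \<le> 1 powr (1 / (p - 2))"
    unfolding t_def using \<open>quad_form \<omega> w \<le> c\<close> w c p quad_form_nonneg[OF \<omega>, of w] by (intro powr_mono2) auto
  then have "t powr p \<le> 1 powr p" using t p by (intro powr_mono2) auto
  then have "powsum p (\<lambda>x. t * w x) \<le> c" using t(1) c by (simp add: powsum_cmult w)
  then have "action_ground_state p \<omega> (\<lambda>x. t * w x)"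
    unfolding action_ground_state_iff[OF p] using t cle by fastforce
  then show thesis using that t(1) by (simp add: w_def)
qed

section \<open>Differentiability, criticality and positivity\<close>

text \<open>For \<open>q = p - 1\<close> this is the nonlinearity
  \<open>\<bar>u\<bar> powr (p - 2) * u\<close> of the Euler-Lagrange equation, in the form produced
  by differentiating \<open>\<bar>s\<bar> powr p\<close>.\<close>

definition signed_pow :: "real \<Rightarrow> ('a \<Rightarrow> real) \<Rightarrow> 'a \<Rightarrow> real" where
  "signed_pow q u = (\<lambda>x. sgn (u x) * \<bar>u x\<bar> powr q)"

lemma sq_summable_signed_pow:
  assumes "u \<in> sq_summable" "2 < p"
  shows "signed_pow (p - 1) u \<in> sq_summable"
proof (rule sq_summable_bounded_by[OF sq_summable_cmult[OF assms(1)]])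
  fix x
  have "\<bar>signed_pow (p - 1) u x\<bar> \<le> \<bar>u x\<bar> powr (p - 1)"
    by (simp add: signed_pow_def abs_mult abs_sgn_eq)
  also have "\<dots> = \<bar>u x\<bar> powr (p - 2) * \<bar>u x\<bar>"
    using abs_powr_eq_mult[of "u x" "p - 1"] by simp
  also have "\<dots> \<le> sqrt (sqsum u) powr (p - 2) * \<bar>u x\<bar>"
    using assms abs_le_sqrt_sqsum[OF assms(1)] by (intro mult_right_mono powr_mono2) auto
  finally show "\<bar>signed_pow (p - 1) u x\<bar> \<le> \<bar>sqrt (sqsum u) powr (p - 2) * u x\<bar>"
    by (simp add: abs_mult)
qed

text \<open>The pointwise expansion is summable with a uniform coefficient, because the values of
  \<open>u\<close> and \<open>v\<close> are bounded by their \<open>\<ell>\<^sup>2\<close>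
  norms.\<close>

lemma powsum_taylor:
  assumes u: "u \<in> sq_summable" and v: "v \<in> sq_summable" and p: "2 < p"
  shows "\<bar>powsum p (\<lambda>x. u x + v x) - powsum p u - p * pairing (signed_pow (p - 1) u) v\<bar>
    \<le> p * (p - 1) * (sqrt (sqsum u) + sqrt (sqsum v)) powr (p - 2) * sqsum v"
proof -
  define C where "C = p * (p - 1) * (sqrt (sqsum u) + sqrt (sqsum v)) powr (p - 2)"
  define f where "f x = \<bar>u x + v x\<bar> powr p - \<bar>u x\<bar> powr p" for x
  define g where "g x = p * (signed_pow (p - 1) u x * v x)" for x
  have p2: "2 \<le> p" using p by simp
  have sf: "f summable_on UNIV"
    unfolding f_def by (intro summable_on_real_diff powr_summable sq_summable_add u v p2)
  have sg: "g summable_on UNIV"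
    unfolding g_def by (intro summable_on_cmult_right summable_on_mult sq_summable_signed_pow u v p)
  have "infsum f UNIV = powsum p (\<lambda>x. u x + v x) - powsum p u"
    unfolding f_def powsum_def by (intro infsum_real_diff powr_summable sq_summable_add u v p2)
  moreover have "infsum g UNIV = p * pairing (signed_pow (p - 1) u) v"
    unfolding g_def pairing_def by (rule infsum_cmult_right')
  ultimately have "powsum p (\<lambda>x. u x + v x) - powsum p u - p * pairing (signed_pow (p - 1) u) v
      = infsum (\<lambda>x. f x - g x) UNIV"
    using infsum_real_diff[OF sf sg] by simp
  moreover have "norm (infsum (\<lambda>x. f x - g x) UNIV) \<le> infsum (\<lambda>x. C * (v x)\<^sup>2) UNIV"
  proof (rule norm_infsum_le[OF has_sum_infsum has_sum_infsum])
    show "(\<lambda>x. f x - g x) summable_on UNIV" by (rule summable_on_real_diff[OF sf sg])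
    show "(\<lambda>x. C * (v x)\<^sup>2) summable_on UNIV"
      using v by (auto simp: sq_summable_def intro!: summable_on_cmult_right)
    fix x
    have "\<bar>f x - g x\<bar> \<le> p * (p - 1) * (\<bar>u x\<bar> + \<bar>v x\<bar>) powr (p - 2) * (v x)\<^sup>2"
      using abs_powr_taylor[OF p, of "u x" "v x"] by (simp add: f_def g_def signed_pow_def mult.assoc)
    also have "\<dots> \<le> C * (v x)\<^sup>2"
      unfolding C_def using p abs_le_sqrt_sqsum[OF u, of x] abs_le_sqrt_sqsum[OF v, of x]
      by (intro mult_right_mono mult_left_mono powr_mono2 add_mono) auto
    finally show "norm (f x - g x) \<le> C * (v x)\<^sup>2" by simp
  qed
  moreover have "infsum (\<lambda>x. C * (v x)\<^sup>2) UNIV = C * sqsum v"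
    unfolding sqsum_def by (rule infsum_cmult_right')
  ultimately show ?thesis by (simp add: C_def)
qed

lemma has_real_derivative_at_0_quadratic:
  fixes g :: "real \<Rightarrow> real"
  assumes "\<And>t. \<bar>t\<bar> \<le> 1 \<Longrightarrow> \<bar>g t - g 0 - t * d\<bar> \<le> C * t\<^sup>2"
  shows "(g has_real_derivative d) (at 0)"
proof -
  have "((\<lambda>h. (g h - g 0) / h - d) \<longlongrightarrow> 0) (at 0)"
  proof (rule Lim_null_comparison)
    have "((\<lambda>h::real. C * \<bar>h\<bar>) \<longlongrightarrow> C * \<bar>0\<bar>) (at 0)"
      by (intro tendsto_intros)
    then show "((\<lambda>h::real. C * \<bar>h\<bar>) \<longlongrightarrow> 0) (at 0)" by simp
    show "\<forall>\<^sub>F h in at 0. norm ((g h - g 0) / h - d) \<le> C * \<bar>h\<bar>"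
      unfolding eventually_at
    proof (intro exI[of _ 1] conjI ballI impI)
      fix h :: real assume h: "h \<noteq> 0 \<and> dist h 0 < 1"
      then have "(g h - g 0) / h - d = (g h - g 0 - h * d) / h" by (simp add: field_simps)
      moreover have "\<bar>g h - g 0 - h * d\<bar> \<le> C * \<bar>h\<bar> * \<bar>h\<bar>"
        using assms[of h] h by (simp add: power2_eq_square)
      ultimately show "norm ((g h - g 0) / h - d) \<le> C * \<bar>h\<bar>"
        using h by (simp add: abs_divide divide_le_eq)
    qed simp
  qed
  then have "((\<lambda>h. (g h - g 0) / h) \<longlongrightarrow> d) (at 0)"
    by (simp add: LIM_zero_iff)
  then show ?thesis by (simp add: DERIV_def)
qed

lemma powsum_line_derivative:
  assumes u: "u \<in> sq_summable" and v: "v \<in> sq_summable" and p: "2 < p"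
  shows "((\<lambda>t. powsum p (\<lambda>x. u x + t * v x)) has_real_derivative p * pairing (signed_pow (p - 1) u) v) (at 0)"
proof (rule has_real_derivative_at_0_quadratic)
  fix t :: real assume t: "\<bar>t\<bar> \<le> 1"
  let ?r = "\<lambda>t. (sqrt (sqsum u) + sqrt (sqsum (\<lambda>x. t * v x))) powr (p - 2)"
  have "sqsum (\<lambda>x. t * v x) \<le> sqsum v"
    using t v by (intro sqsum_mono) (auto simp: abs_mult mult_left_le_one_le)
  then have "?r t \<le> ?r 1"
    using p by (intro powr_mono2) auto
  then have "p * (p - 1) * ?r t * sqsum (\<lambda>x. t * v x) \<le> p * (p - 1) * ?r 1 * sqsum (\<lambda>x. t * v x)"
    using p by (intro mult_right_mono mult_left_mono) auto
  then have "\<bar>powsum p (\<lambda>x. u x + t * v x) - powsum p u - p * pairing (signed_pow (p - 1) u) (\<lambda>x. t * v x)\<bar>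
      \<le> p * (p - 1) * ?r 1 * sqsum (\<lambda>x. t * v x)"
    using powsum_taylor[OF u sq_summable_cmult[OF v] p, of t] by linarith
  then show "\<bar>powsum p (\<lambda>x. u x + t * v x) - powsum p (\<lambda>x. u x + 0 * v x)
      - t * (p * pairing (signed_pow (p - 1) u) v)\<bar> \<le> (p * (p - 1) * ?r 1 * sqsum v) * t\<^sup>2"
    unfolding pairing_cmult_right sqsum_cmult by (simp add: mult_ac)
qed

definition energy_differential :: "real \<Rightarrow> (int ^ 'd \<Rightarrow> real) \<Rightarrow> (int ^ 'd \<Rightarrow> real) \<Rightarrow> real" where
  "energy_differential p u v = grad_pairing u v - pairing (signed_pow (p - 1) u) v"

lemma abs_grad_pairing_le:
  fixes u v :: "int ^ 'd \<Rightarrow> real"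
  assumes "u \<in> sq_summable" "v \<in> sq_summable"
  shows "\<bar>grad_pairing u v\<bar> \<le> 2 * real (card (unit_steps :: (int ^ 'd) set)) * sqrt (sqsum u) * sqrt (sqsum v)"
proof -
  have "\<bar>pairing (shift_diff e u) (shift_diff e v)\<bar> \<le> 4 * (sqrt (sqsum u) * sqrt (sqsum v))" for e
  proof -
    have *: "sqrt (sqsum (shift_diff e w)) \<le> 2 * sqrt (sqsum w)" if "w \<in> sq_summable" for w
      using real_sqrt_le_mono[OF sqsum_shift_diff_le_sqsum[OF that, of e]] by (simp add: real_sqrt_mult)
    have "\<bar>pairing (shift_diff e u) (shift_diff e v)\<bar> \<le> sqrt (sqsum (shift_diff e u)) * sqrt (sqsum (shift_diff e v))"
      by (intro pairing_abs_le sq_summable_shift_diff assms)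
    also have "\<dots> \<le> (2 * sqrt (sqsum u)) * (2 * sqrt (sqsum v))"
      by (intro mult_mono * assms) auto
    finally show ?thesis by simp
  qed
  then have "(\<Sum>e\<in>(unit_steps :: (int ^ 'd) set). \<bar>pairing (shift_diff e u) (shift_diff e v)\<bar>)
     \<le> (\<Sum>e\<in>(unit_steps :: (int ^ 'd) set). 4 * (sqrt (sqsum u) * sqrt (sqsum v)))"
    by (intro sum_mono)
  then have "\<bar>\<Sum>e\<in>(unit_steps :: (int ^ 'd) set). pairing (shift_diff e u) (shift_diff e v)\<bar>
     \<le> real (card (unit_steps :: (int ^ 'd) set)) * (4 * (sqrt (sqsum u) * sqrt (sqsum v)))"
    by (intro order_trans[OF sum_abs]) simp
  then show ?thesis by (simp add: grad_pairing_def abs_mult)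
qed

lemma energy_has_differential:
  fixes u :: "int ^ 'd \<Rightarrow> real"
  assumes u: "u \<in> sq_summable" and p: "2 < p"
  shows "H1_has_differential (energy p) u (energy_differential p u)"
proof -
  define c where "c = real (card (unit_steps :: (int ^ 'd) set))"
  let ?D = "energy_differential p u"
  let ?\<phi> = "signed_pow (p - 1) u"
  have \<phi>: "?\<phi> \<in> sq_summable" by (rule sq_summable_signed_pow[OF u p])
  have lin: "?D (\<lambda>x. a * v x + b * w x) = a * ?D v + b * ?D w"
    if "v \<in> sq_summable" "w \<in> sq_summable" for v w a b
    using that u \<phi>
    by (simp add: energy_differential_def grad_pairing_add_right pairing_add_right sq_summable_cmult
        grad_pairing_cmult_right pairing_cmult_right algebra_simps)
  have bnd: "\<bar>?D v\<bar> \<le> (2 * c * sqrt (sqsum u) + sqrt (sqsum ?\<phi>)) * H1_norm v" if v: "v \<in> sq_summable" for v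
  proof -
    have "\<bar>?D v\<bar> \<le> \<bar>grad_pairing u v\<bar> + \<bar>pairing ?\<phi> v\<bar>"
      unfolding energy_differential_def by (rule abs_triangle_ineq4)
    also have "\<dots> \<le> 2 * c * sqrt (sqsum u) * sqrt (sqsum v) + sqrt (sqsum ?\<phi>) * sqrt (sqsum v)"
      unfolding c_def by (intro add_mono abs_grad_pairing_le pairing_abs_le u v \<phi>)
    also have "\<dots> = (2 * c * sqrt (sqsum u) + sqrt (sqsum ?\<phi>)) * sqrt (sqsum v)"
      by (simp add: algebra_simps)
    also have "\<dots> \<le> (2 * c * sqrt (sqsum u) + sqrt (sqsum ?\<phi>)) * H1_norm v"
      by (intro mult_left_mono sqrt_sqsum_le_H1_norm) (simp add: c_def)
    finally show ?thesis .
  qed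
  define C where "C = c + (p - 1) * (sqrt (sqsum u) + 1) powr (p - 2)"
  have C: "0 \<le> C" using p by (simp add: C_def c_def)
  have rem: "\<bar>energy p (\<lambda>x. u x + v x) - energy p u - ?D v\<bar> \<le> C * (H1_norm v)\<^sup>2"
    if v: "v \<in> sq_summable" and v1: "H1_norm v \<le> 1" for v
  proof -
    define r where "r = powsum p (\<lambda>x. u x + v x) - powsum p u - p * pairing ?\<phi> v"
    have "energy p (\<lambda>x. u x + v x) - energy p u - ?D v = 1 / 2 * grad_norm_sq v - r / p"
      using p u v by (simp add: energy_eq grad_norm_sq_add energy_differential_def r_def diff_divide_distrib
          add_divide_distrib)
    then have "\<bar>energy p (\<lambda>x. u x + v x) - energy p u - ?D v\<bar> \<le> 1 / 2 * grad_norm_sq v + \<bar>r\<bar> / p"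
      using abs_triangle_ineq4[of "1 / 2 * grad_norm_sq v" "r / p"] p by simp
    also have "1 / 2 * grad_norm_sq v \<le> c * sqsum v"
      using grad_norm_sq_le[OF v] by (simp add: c_def)
    also have "\<bar>r\<bar> / p \<le> (p - 1) * (sqrt (sqsum u) + sqrt (sqsum v)) powr (p - 2) * sqsum v"
      using divide_right_mono[OF powsum_taylor[OF u v p], of p] p by (simp add: r_def)
    also have "\<dots> \<le> (p - 1) * (sqrt (sqsum u) + 1) powr (p - 2) * sqsum v"
      using p order_trans[OF sqrt_sqsum_le_H1_norm v1]
      by (intro mult_right_mono mult_left_mono powr_mono2 add_left_mono) auto
    finally have "\<bar>energy p (\<lambda>x. u x + v x) - energy p u - ?D v\<bar> \<le> C * sqsum v"
      by (simp add: C_def distrib_right)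
    also have "\<dots> \<le> C * (H1_norm v)\<^sup>2"
      using C by (intro mult_left_mono) (simp_all add: H1_norm_sq)
    finally show ?thesis .
  qed
  have "\<exists>\<delta>>0. \<forall>v\<in>sq_summable. H1_norm v < \<delta> \<longrightarrow>
      \<bar>energy p (\<lambda>x. u x + v x) - energy p u - ?D v\<bar> \<le> \<epsilon> * H1_norm v" if "\<epsilon> > 0" for \<epsilon>
  proof (intro exI conjI ballI impI)
    \<comment> \<open>The cap 1 makes the quadratic remainder bound applicable, and
      \<open>C + 1\<close> avoids division by 0.\<close>
    show "0 < min 1 (\<epsilon> / (C + 1))" using that C by simp
    fix v :: "int ^ 'd \<Rightarrow> real" assume v: "v \<in> sq_summable" and small: "H1_norm v < min 1 (\<epsilon> / (C + 1))"
    have "C * H1_norm v \<le> (C + 1) * H1_norm v"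
      by (intro mult_right_mono) auto
    also have "\<dots> \<le> \<epsilon>" using small C by (simp add: field_simps)
    finally have "C * H1_norm v * H1_norm v \<le> \<epsilon> * H1_norm v"
      by (intro mult_right_mono) auto
    then show "\<bar>energy p (\<lambda>x. u x + v x) - energy p u - ?D v\<bar> \<le> \<epsilon> * H1_norm v"
      using rem[OF v] small by (simp add: power2_eq_square mult.assoc)
  qed
  then show ?thesis
    unfolding H1_has_differential_def H1_eq using lin bnd by blast
qed

lemma energy_critical_pointI:
  fixes u :: "int ^ 'd \<Rightarrow> real"
  assumes "2 < p" "u \<in> sq_summable" "sqsum u = \<mu>"
    and "\<And>v. v \<in> sq_summable \<Longrightarrow> pairing u v = 0 \<Longrightarrow> energy_differential p u v = 0"
  shows "energy_critical_point p \<mu> u"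
  unfolding energy_critical_point_def H1_mass_iff H1_eq
  using energy_has_differential[OF assms(2,1)] assms(2-4) by (auto simp: pairing_def)

section \<open>Ground states as constrained critical points\<close>

lemma sqsum_line:
  assumes "u \<in> sq_summable" "v \<in> sq_summable"
  shows "sqsum (\<lambda>x. u x + t * v x) = sqsum u + 2 * t * pairing u v + t\<^sup>2 * sqsum v"
  using assms by (simp add: sqsum_add sq_summable_cmult pairing_cmult_right sqsum_cmult)

lemma grad_norm_sq_line:
  assumes "u \<in> sq_summable" "v \<in> sq_summable"
  shows "grad_norm_sq (\<lambda>x. u x + t * v x) = grad_norm_sq u + 2 * t * grad_pairing u v + t\<^sup>2 * grad_norm_sq v"
  using assms by (simp add: grad_norm_sq_add sq_summable_cmult grad_pairing_cmult_right grad_norm_sq_cmult)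

text \<open>Since \<open>v\<close> is orthogonal to \<open>u\<close>, the line
  \<open>u + t * v\<close> leaves the sphere only to second order. The normalizing factor
  \<open>\<theta>\<close> therefore has derivative 0 at 0, and the derivative of the energy along
  the normalized curve is the differential at \<open>v\<close>.\<close>

lemma energy_ground_state_differential:
  fixes u :: "int ^ 'd \<Rightarrow> real"
  assumes p: "2 < p" and \<mu>: "0 < \<mu>" and gs: "energy_ground_state p \<mu> u"
    and v: "v \<in> sq_summable" "pairing u v = 0"
  shows "energy_differential p u v = 0"
proof -
  have u: "u \<in> sq_summable" "sqsum u = \<mu>"
    and min: "\<And>w :: int ^ 'd \<Rightarrow> real. w \<in> sq_summable \<Longrightarrow> sqsum w = \<mu> \<Longrightarrow> energy p u \<le> energy p w"
    using gs by (auto simp: energy_ground_state_def H1_mass_iff)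
  define P where "P t = powsum p (\<lambda>x. u x + t * v x)" for t
  define k where "k = grad_pairing u v"
  define \<theta> where "\<theta> t = \<mu> / (\<mu> + t\<^sup>2 * sqsum v)" for t
  define F where "F t = \<theta> t / 2 * (grad_norm_sq u + 2 * t * k + t\<^sup>2 * grad_norm_sq v) - \<theta> t powr (p / 2) / p * P t" for t
  have N: "0 < \<mu> + t\<^sup>2 * sqsum v" for t
    using \<mu> by (intro add_pos_nonneg) auto
  have F_eq: "F t = energy p (\<lambda>x. sqrt (\<theta> t) * (u x + t * v x))" for t
    using p \<mu> N[of t] less_imp_le[OF N[of t]] u v
    by (subst energy_scale) (auto simp: F_def \<theta>_def P_def k_def grad_norm_sq_line)
  have "F 0 \<le> F t" for t
  proof -
    have "F 0 = energy p u" using \<mu> by (simp add: F_eq \<theta>_def)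
    also have "\<dots> \<le> F t"
      unfolding F_eq using N[of t] \<mu> less_imp_le[OF N[of t]]
      by (intro min sq_summable_cmult sq_summable_add u v)
        (simp add: sqsum_cmult sqsum_line u v \<theta>_def)
    finally show ?thesis .
  qed
  moreover have P': "(P has_real_derivative p * pairing (signed_pow (p - 1) u) v) (at 0)"
    unfolding P_def by (rule powsum_line_derivative[OF u(1) v(1) p])
  have "(\<theta> has_real_derivative 0) (at 0)"
    unfolding \<theta>_def using \<mu> by (auto intro!: derivative_eq_intros)
  then have "(F has_real_derivative energy_differential p u v) (at 0)"
    unfolding F_def using p \<mu>
    by (auto intro!: derivative_eq_intros P' simp: \<theta>_def energy_differential_def k_def)
  ultimately show ?thesis
    using DERIV_local_min[of F "energy_differential p u v" 0 1] by auto
qed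

text \<open>In place of a curve in the Nehari manifold, the homogeneous inequality
  \<open>powsum_le_quad_form\<close> is used along a straight line: its defect \<open>F\<close> is
  nonnegative and vanishes at \<open>t = 0\<close>. The \<open>\<omega>\<close> term contributes
  nothing to first order because \<open>v\<close> is orthogonal to \<open>u\<close>.\<close>

lemma action_ground_state_differential:
  fixes u :: "int ^ 'd \<Rightarrow> real"
  assumes p: "2 < p" and \<omega>: "0 < \<omega>" and gs: "action_ground_state p \<omega> u"
    and v: "v \<in> sq_summable" "pairing u v = 0"
  shows "energy_differential p u v = 0"
proof -
  define c where "c = powsum p u"
  have uN: "u \<in> nehari p \<omega>" and min: "\<And>w :: int ^ 'd \<Rightarrow> real. w \<in> nehari p \<omega> \<Longrightarrow> c \<le> powsum p w"
    using gs p by (auto simp: action_ground_state_iff c_def)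
  have u: "u \<in> sq_summable" "u \<noteq> (\<lambda>x. 0)" "quad_form \<omega> u = c"
    using uN p by (auto simp: nehari_iff quad_form_def c_def)
  have c: "0 < c" unfolding c_def using u p by (intro powsum_pos) auto
  define P where "P t = powsum p (\<lambda>x. u x + t * v x)" for t
  define k where "k = grad_pairing u v"
  define A where "A t = c + 2 * t * k + t\<^sup>2 * quad_form \<omega> v" for t
  define F where "F t = c * (A t / c) powr (p / 2) - P t" for t
  have A: "A t = quad_form \<omega> (\<lambda>x. u x + t * v x)" for t
    using u v by (simp add: A_def k_def quad_form_def grad_norm_sq_line sqsum_line algebra_simps)
  have "F 0 = 0" using c by (simp add: F_def A_def P_def c_def)
  moreover have "0 \<le> F t" for t
    using powsum_le_quad_form[OF p \<omega> sq_summable_add[OF u(1) sq_summable_cmult[OF v(1)]] c min, of t]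
    by (simp add: F_def A P_def)
  moreover have P': "(P has_real_derivative p * pairing (signed_pow (p - 1) u) v) (at 0)"
    unfolding P_def by (rule powsum_line_derivative[OF u(1) v(1) p])
  have "(A has_real_derivative 2 * k) (at 0)"
    unfolding A_def by (auto intro!: derivative_eq_intros)
  then have "(F has_real_derivative p * energy_differential p u v) (at 0)"
    unfolding F_def using p c
    by (auto intro!: derivative_eq_intros P' simp: A_def energy_differential_def k_def algebra_simps)
  ultimately have "p * energy_differential p u v = 0"
    using DERIV_local_min[of F "p * energy_differential p u v" 0 1] by auto
  then show ?thesis using p by simp
qed

section \<open>Strict positivity\<close>

definition point_mass :: "'a \<Rightarrow> 'a \<Rightarrow> real" where
  "point_mass x = (\<lambda>y. of_bool (y = x))"

lemma sq_summable_point_mass [simp]: "point_mass x \<in> sq_summable"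
  by (rule sq_summable_finite_support) (simp add: point_mass_def)

lemma sqsum_point_mass [simp]: "sqsum (point_mass x) = 1"
  by (subst sqsum_finite_support[of "{x}"]) (auto simp: point_mass_def)

lemma powsum_point_mass [simp]: "powsum q (point_mass x) = 1"
proof -
  have "powsum q (point_mass x) = infsum (\<lambda>y. \<bar>point_mass x y\<bar> powr q) {x}"
    unfolding powsum_def by (intro infsum_cong_neutral) (auto simp: point_mass_def)
  then show ?thesis by (simp add: point_mass_def)
qed

lemma pairing_point_mass: "pairing u (point_mass x) = u x"
proof -
  have "pairing u (point_mass x) = infsum (\<lambda>y. u y * point_mass x y) {x}"
    unfolding pairing_def by (intro infsum_cong_neutral) (auto simp: point_mass_def)
  then show ?thesis by (simp add: point_mass_def)
qed

text \<open>Summation by parts: the right-hand side is minus the lattice Laplacian of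
  \<open>u\<close> at \<open>x\<close>. Steps come in pairs \<open>e\<close> and \<open>- e\<close>,
  so the sum counts every neighbour twice.\<close>

lemma grad_pairing_point_mass:
  assumes "u \<in> sq_summable"
  shows "grad_pairing u (point_mass x) = 1 / 2 * (\<Sum>e\<in>unit_steps. 2 * u x - u (x - e) - u (x + e))"
proof -
  have "pairing (shift_diff e u) (shift_diff e (point_mass x)) = 2 * u x - u (x - e) - u (x + e)" for e
  proof -
    have "shift_diff e (point_mass x) = (\<lambda>y. point_mass (x - e) y + (-1) * point_mass x y)"
      by (auto simp: shift_diff_def point_mass_def eq_diff_eq)
    then show ?thesis
      by (simp only: pairing_add_right sq_summable_shift_diff sq_summable_cmult sq_summable_point_mass assms
          pairing_cmult_right pairing_point_mass) (simp add: shift_diff_def)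
  qed
  then show ?thesis by (simp add: grad_pairing_def)
qed

text \<open>Testing criticality against the point mass at a zero of \<open>u\<close> forces \<open>u\<close> to vanish at all
  neighbours.\<close>

lemma critical_nonneg_imp_positive:
  fixes u :: "int ^ 'd \<Rightarrow> real"
  assumes u: "u \<in> sq_summable" "u \<noteq> (\<lambda>x. 0)" and nn: "\<And>x. 0 \<le> u x"
    and crit: "\<And>v. v \<in> sq_summable \<Longrightarrow> pairing u v = 0 \<Longrightarrow> energy_differential p u v = 0"
  shows "positive_fun u"
proof (rule ccontr)
  assume "\<not> positive_fun u"
  then obtain x0 where x0: "u x0 = 0"
    using nn by (auto simp: positive_fun_def not_less intro: antisym)
  have step: "u (x + e) = 0" if "u x = 0" "e \<in> unit_steps" for x e
  proof -
    have "energy_differential p u (point_mass x) = 0"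
      using that by (intro crit) (simp_all add: pairing_point_mass)
    then have "(\<Sum>e\<in>unit_steps. u (x - e) + u (x + e)) = 0"
      using that by (simp add: energy_differential_def grad_pairing_point_mass[OF u(1)] pairing_point_mass
          signed_pow_def sum.distrib sum_negf sum_subtractf)
    then have "u (x - e) + u (x + e) = 0"
      using that nn by (subst (asm) sum_nonneg_eq_0_iff) auto
    then show ?thesis using nn[of "x - e"] nn[of "x + e"] by linarith
  qed
  \<comment> \<open>Connectedness of the lattice: zeros spread along a path of unit steps to every
    point.\<close>
  have "u (x0 + z) = 0" for z
  proof (induction "nat (lnorm z)" arbitrary: z)
    case 0
    then have "z = 0" using lnorm_nonneg[of z] lnorm_eq_0_iff[of z] by linarith
    then show ?case using x0 by simp
  next
    case (Suc n)
    then have "z \<noteq> 0" by auto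
    then obtain e where e: "e \<in> unit_steps" "lnorm (z - e) = lnorm z - 1"
      by (rule unit_step_decreasing_lnorm)
    then have "u (x0 + (z - e)) = 0" using Suc by simp
    from step[OF this e(1)] show ?case by (simp add: algebra_simps)
  qed
  then have "u x = 0" for x by (metis add_diff_cancel_left' diff_add_cancel add.commute)
  then show False using u(2) by auto
qed

section \<open>A Nash type inequality\<close>

text \<open>Chebyshev's inequality. It is proved first for finite subsets; their bounded cardinality
  then yields finiteness of the whole level set.\<close>

lemma large_values_card:
  assumes "u \<in> sq_summable" "0 < t"
  shows "finite {x. t \<le> \<bar>u x\<bar>}" "real (card {x. t \<le> \<bar>u x\<bar>}) * t\<^sup>2 \<le> sqsum u"
proof -
  have bd: "real (card G) * t\<^sup>2 \<le> sqsum u" if "G \<subseteq> {x. t \<le> \<bar>u x\<bar>}" "finite G" for G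
  proof -
    have "real (card G) * t\<^sup>2 = (\<Sum>x\<in>G. t\<^sup>2)" by simp
    also have "\<dots> \<le> (\<Sum>x\<in>G. (u x)\<^sup>2)"
      using that assms(2) by (intro sum_mono) (auto simp: abs_le_square_iff[symmetric])
    also have "\<dots> \<le> sqsum u" by (rule sum_le_sqsum[OF assms(1) that(2)])
    finally show ?thesis .
  qed
  have "card G \<le> nat \<lceil>sqsum u / t\<^sup>2\<rceil>" if "G \<subseteq> {x. t \<le> \<bar>u x\<bar>}" "finite G" for G
  proof -
    have "real (card G) \<le> sqsum u / t\<^sup>2"
      using bd[OF that] assms(2) by (simp add: field_simps)
    then show ?thesis by linarith
  qed
  then show fin: "finite {x. t \<le> \<bar>u x\<bar>}"
    using finite_if_finite_subsets_card_bdd by blast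
  show "real (card {x. t \<le> \<bar>u x\<bar>}) * t\<^sup>2 \<le> sqsum u"
    by (rule bd[OF subset_refl fin])
qed

text \<open>Half open, so that \<open>cube 0 L\<close> has exactly \<open>L ^ CARD('d)\<close>
  points for natural \<open>L\<close>.\<close>

definition cube :: "int \<Rightarrow> int \<Rightarrow> (int ^ 'd) set" where
  "cube a b = {x. \<forall>i. a \<le> x $ i \<and> x $ i < b}"

lemma cube_bij: "bij_betw vec_nth (cube a b :: (int ^ 'd) set) (\<Pi>\<^sub>E i\<in>UNIV. {a..<b})"
proof (rule bij_betwI[where g = vec_lambda])
  show "vec_nth \<in> cube a b \<rightarrow> (\<Pi>\<^sub>E i\<in>UNIV. {a..<b})"
    by (auto simp: cube_def PiE_UNIV_domain)
  show "vec_lambda \<in> (\<Pi>\<^sub>E i\<in>UNIV. {a..<b}) \<rightarrow> cube a b"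
    by (auto simp: cube_def PiE_UNIV_domain)
qed auto

lemma finite_cube [simp]: "finite (cube a b :: (int ^ 'd) set)"
  using bij_betw_finite[OF cube_bij] by (simp add: finite_PiE)

lemma card_cube: "card (cube a b :: (int ^ 'd) set) = nat (b - a) ^ CARD('d)"
  using bij_betw_same_card[OF cube_bij] by (simp add: card_PiE)

lemma lnorm_cube_le:
  fixes z :: "int ^ 'd"
  assumes "z \<in> cube 0 b"
  shows "lnorm z \<le> int CARD('d) * b"
proof -
  have "lnorm z \<le> (\<Sum>i\<in>(UNIV :: 'd set). b)"
    unfolding lnorm_def using assms by (intro sum_mono) (simp add: cube_def less_imp_le)
  then show ?thesis by simp
qed

text \<open>If \<open>|u x| \<ge> s\<close>, then \<open>u\<close> is smaller than \<open>s / 2\<close> at most points of \<open>x + cube 0 L\<close>, as the set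
  \<open>|u| \<ge> s / 2\<close> is too small to fill half of the cube.\<close>

lemma large_values_poincare:
  fixes u :: "int ^ 'd \<Rightarrow> real"
  assumes u: "u \<in> sq_summable" "sqsum u \<le> M" and M: "0 < M" and s: "0 < s"
    and L: "8 * M / s\<^sup>2 \<le> real L ^ CARD('d)"
    and F: "finite F" "F \<subseteq> {x. s \<le> \<bar>u x\<bar>}"
  shows "(\<Sum>x\<in>F. (u x)\<^sup>2) \<le> 16 * (real CARD('d) * real L)\<^sup>2 * grad_norm_sq u"
proof -
  define B :: "(int ^ 'd) set" where "B = cube 0 (int L)"
  define D where "D = real L ^ CARD('d)"
  have B: "finite B" "real (card B) = D"
    by (simp_all add: B_def card_cube D_def)
  have "0 < 8 * M / s\<^sup>2" using M s by simp
  then have D: "0 < D" using L unfolding D_def by linarith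
  define A where "A = {y. s / 2 \<le> \<bar>u y\<bar>}"
  have A: "finite A" "real (card A) * (s / 2)\<^sup>2 \<le> sqsum u"
    unfolding A_def using large_values_card[OF u(1), of "s / 2"] s by auto
  have "real (card A) * (s / 2)\<^sup>2 \<le> M" using A(2) u(2) by linarith
  then have "real (card A) \<le> 4 * M / s\<^sup>2"
    using s by (simp add: field_simps power2_eq_square)
  \<comment> \<open>The 8 in the hypothesis on \<open>L\<close> is used here: Chebyshev at level
    \<open>s / 2\<close> costs a factor 4, and half of the cube has to remain free.\<close>
  then have cA: "real (card A) \<le> D / 2" using L unfolding D_def by simp
  \<comment> \<open>At least half of the translations \<open>z\<close> lead to a value below
    \<open>s / 2\<close>, and for these the difference is at least half of
    \<open>\<bar>u x\<bar>\<close>. Hence the factor 1/2 times 1/4.\<close>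
  have point: "D / 8 * (u x)\<^sup>2 \<le> (\<Sum>z\<in>B. (shift_diff z u x)\<^sup>2)" if x: "x \<in> F" for x
  proof -
    define Bad where "Bad = {z \<in> B. x + z \<in> A}"
    have Bad: "finite Bad" "Bad \<subseteq> B" using B by (auto simp: Bad_def)
    have "card Bad \<le> card A"
      by (rule card_inj_on_le[of "\<lambda>z. x + z"]) (auto simp: Bad_def inj_on_def A)
    then have "D / 2 \<le> real (card (B - Bad))"
      using cA B Bad card_mono[OF B(1) Bad(2)] by (simp add: card_Diff_subset of_nat_diff)
    then have "D / 2 * ((u x)\<^sup>2 / 4) \<le> real (card (B - Bad)) * ((u x)\<^sup>2 / 4)"
      by (intro mult_right_mono) auto
    also have "\<dots> = (\<Sum>z\<in>B - Bad. (u x)\<^sup>2 / 4)" by simp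
    also have "\<dots> \<le> (\<Sum>z\<in>B - Bad. (shift_diff z u x)\<^sup>2)"
    proof (rule sum_mono)
      fix z assume "z \<in> B - Bad"
      then have "\<bar>u (x + z)\<bar> < s / 2" by (auto simp: Bad_def A_def)
      moreover have "s \<le> \<bar>u x\<bar>" using x F by auto
      ultimately have "\<bar>u x / 2\<bar> \<le> \<bar>shift_diff z u x\<bar>" unfolding shift_diff_def by linarith
      then have "(u x / 2)\<^sup>2 \<le> (shift_diff z u x)\<^sup>2" by (simp only: abs_le_square_iff)
      then show "(u x)\<^sup>2 / 4 \<le> (shift_diff z u x)\<^sup>2" by (simp add: power_divide)
    qed
    also have "\<dots> \<le> (\<Sum>z\<in>B. (shift_diff z u x)\<^sup>2)"
      using B by (intro sum_mono2) auto
    finally show ?thesis by simp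
  qed
  \<comment> \<open>After exchanging the sums, each translation costs at most the square of its path
    length times the gradient norm. The number \<open>D\<close> of translations then
    cancels.\<close>
  have "D / 8 * (\<Sum>x\<in>F. (u x)\<^sup>2) \<le> (\<Sum>x\<in>F. \<Sum>z\<in>B. (shift_diff z u x)\<^sup>2)"
    unfolding sum_distrib_left by (intro sum_mono point)
  also have "\<dots> = (\<Sum>z\<in>B. \<Sum>x\<in>F. (shift_diff z u x)\<^sup>2)"
    by (rule sum.swap)
  also have "\<dots> \<le> (\<Sum>z\<in>B. (real CARD('d) * real L)\<^sup>2 * (2 * grad_norm_sq u))"
  proof (rule sum_mono)
    fix z assume "z \<in> B"
    then have "lnorm z \<le> int CARD('d) * int L"
      using lnorm_cube_le[of z "int L"] by (simp add: B_def)
    then have "real_of_int (lnorm z) \<le> real_of_int (int CARD('d) * int L)"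
      by (simp only: of_int_le_iff)
    then have lz: "(real_of_int (lnorm z))\<^sup>2 \<le> (real CARD('d) * real L)\<^sup>2"
      by (intro power_mono) auto
    have "(\<Sum>x\<in>F. (shift_diff z u x)\<^sup>2) \<le> sqsum (shift_diff z u)"
      by (intro sum_le_sqsum sq_summable_shift_diff u F)
    also have "\<dots> \<le> (real_of_int (lnorm z))\<^sup>2 * (2 * grad_norm_sq u)"
      by (rule sqsum_shift_diff_le[OF u(1)])
    also have "\<dots> \<le> (real CARD('d) * real L)\<^sup>2 * (2 * grad_norm_sq u)"
      by (intro mult_right_mono lz) auto
    finally show "(\<Sum>x\<in>F. (shift_diff z u x)\<^sup>2) \<le> (real CARD('d) * real L)\<^sup>2 * (2 * grad_norm_sq u)" .
  qed
  also have "\<dots> = D / 8 * (16 * (real CARD('d) * real L)\<^sup>2 * grad_norm_sq u)"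
    by (simp add: B(2))
  finally show ?thesis
    using D by (simp only: mult_le_cancel_left_pos divide_pos_pos zero_less_numeral)
qed

text \<open>The side \<open>L\<close> is \<open>\<rho>\<close> rounded up. Since
  \<open>s \<le> 1 \<le> M\<close>, we have \<open>\<rho> \<ge> 1\<close>, so rounding at most
  doubles it and turns 16 into 64. The resulting power \<open>- 4 / d\<close> of \<open>s\<close> is
  the one that \<open>p - 2\<close> has to outweigh.\<close>

lemma large_values_nash:
  fixes u :: "int ^ 'd \<Rightarrow> real"
  assumes u: "u \<in> sq_summable" "sqsum u \<le> M" and M: "1 \<le> M" and s: "0 < s" "s \<le> 1"
    and F: "finite F" "F \<subseteq> {x. s \<le> \<bar>u x\<bar>}"
  shows "(\<Sum>x\<in>F. (u x)\<^sup>2)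
    \<le> 64 * (real CARD('d))\<^sup>2 * (8 * M) powr (2 / CARD('d)) * s powr (- 4 / CARD('d)) * grad_norm_sq u"
proof -
  define d where "d = real CARD('d)"
  have d: "0 < d" by (simp add: d_def)
  define \<rho> where "\<rho> = (8 * M / s\<^sup>2) powr (1 / d)"
  have "s\<^sup>2 \<le> 1" using s by (simp add: power_le_one)
  then have big: "1 \<le> 8 * M / s\<^sup>2" using M s by (simp add: field_simps)
  have \<rho>1: "1 \<le> \<rho>" unfolding \<rho>_def using big d by (intro ge_one_powr_ge_zero) auto
  define L where "L = nat \<lceil>\<rho>\<rceil>"
  have L: "\<rho> \<le> real L" "real L \<le> 2 * \<rho>" using \<rho>1 unfolding L_def by linarith+
  have "8 * M / s\<^sup>2 = \<rho> powr d"
  proof -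
    have "1 / d * d = 1" using d by simp
    then show ?thesis
      unfolding \<rho>_def powr_powr using big by (simp only: powr_one)
  qed
  also have "\<dots> = \<rho> ^ CARD('d)" using \<rho>1 by (simp add: d_def powr_realpow)
  also have "\<dots> \<le> real L ^ CARD('d)" using L \<rho>1 by (intro power_mono) auto
  finally have "(\<Sum>x\<in>F. (u x)\<^sup>2) \<le> 16 * (d * real L)\<^sup>2 * grad_norm_sq u"
    unfolding d_def using M by (intro large_values_poincare[OF u _ s(1) _ F]) auto
  also have "\<dots> \<le> 16 * (d * (2 * \<rho>))\<^sup>2 * grad_norm_sq u"
    using L d by (intro mult_right_mono mult_left_mono power_mono) auto
  also have "\<rho>\<^sup>2 = (8 * M) powr (2 / d) * s powr (- 4 / d)"
  proof -
    have "\<rho>\<^sup>2 = \<rho> powr 2" using \<rho>1 by simp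
    also have "\<dots> = (8 * M / s\<^sup>2) powr (2 / d)" by (simp add: \<rho>_def powr_powr)
    also have "\<dots> = (8 * M) powr (2 / d) / (s powr 2) powr (2 / d)"
      using M s by (simp add: powr_divide)
    also have "\<dots> = (8 * M) powr (2 / d) * s powr (- 4 / d)"
      by (simp only: powr_powr) (simp add: powr_minus field_simps)
    finally show ?thesis .
  qed
  then have "16 * (d * (2 * \<rho>))\<^sup>2 * grad_norm_sq u = 64 * d\<^sup>2 * (8 * M) powr (2 / d) * s powr (- 4 / d) * grad_norm_sq u"
    by (simp add: power_mult_distrib)
  finally show ?thesis by (simp add: d_def)
qed

text \<open>Dyadic layers: where \<open>t / 2 < \<bar>u\<bar> \<le> t\<close>, the power sum is at
  most \<open>t powr (p - 2)\<close> times the square sum, which the previous lemma bounds by a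
  multiple of \<open>(t / 2) powr (- 4 / d)\<close> times the gradient norm. For
  \<open>t = \<eta> / 2 ^ k\<close> these bounds decay geometrically since
  \<open>\<gamma> > 0\<close>. In \<open>C\<close>, the power of 2 in the numerator comes from the
  lower end \<open>t / 2\<close> and the denominator from the geometric series.\<close>

lemma powsum_le_grad_of_small_sup:
  fixes u :: "int ^ 'd \<Rightarrow> real"
  assumes p: "2 + 4 / real CARD('d) < p" and M: "1 \<le> M"
    and u: "u \<in> sq_summable" "sqsum u \<le> M" and \<eta>: "0 < \<eta>" "\<eta> \<le> 1" "\<And>x. \<bar>u x\<bar> \<le> \<eta>"
  defines "\<gamma> \<equiv> p - 2 - 4 / real CARD('d)"
  defines "C \<equiv> 64 * (real CARD('d))\<^sup>2 * (8 * M) powr (2 / CARD('d)) * 2 powr (4 / CARD('d)) / (1 - 2 powr (- \<gamma>))"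
  shows "powsum p u \<le> C * \<eta> powr \<gamma> * grad_norm_sq u"
proof -
  define d where "d = real CARD('d)"
  have d: "0 < d" by (simp add: d_def)
  have "0 < 4 / d" using d by simp
  then have p2: "2 < p" using p unfolding d_def by linarith
  define K where "K = 64 * d\<^sup>2 * (8 * M) powr (2 / d)"
  define r where "r = 2 powr (- \<gamma>)"
  have \<gamma>: "0 < \<gamma>" using p by (simp add: \<gamma>_def)
  have r: "0 < r" "r < 1" using \<gamma> by (auto simp: r_def intro!: powr_less_one)
  have K: "0 \<le> K" by (simp add: K_def)
  let ?G = "grad_norm_sq u"
  have fin: "(\<Sum>x\<in>F. \<bar>u x\<bar> powr p) \<le> C * \<eta> powr \<gamma> * ?G" if F: "finite F" for F
  proof -
    have level: "(\<Sum>x\<in>{x\<in>F. \<eta> / 2 ^ k < \<bar>u x\<bar>}. \<bar>u x\<bar> powr p)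
        \<le> K * 2 powr (4 / d) * \<eta> powr \<gamma> * ?G * (\<Sum>j<k. r ^ j)" for k
    proof (induction k)
      case 0
      have "{x\<in>F. \<eta> / 2 ^ 0 < \<bar>u x\<bar>} = {}" using \<eta>(3) by (auto simp: not_less)
      then show ?case by (simp only: sum.empty) simp
    next
      case (Suc k)
      define t where "t = \<eta> / 2 ^ k"
      have "t \<le> \<eta> / 1" unfolding t_def using \<eta>(1) by (intro divide_left_mono) auto
      then have "t / 2 \<le> 1" using \<eta>(1,2) by linarith
      then have t: "0 < t" "t / 2 \<le> 1" "t / 2 = \<eta> / 2 ^ Suc k"
        using \<eta>(1) by (auto simp: t_def)
      define S where "S = {x\<in>F. t / 2 < \<bar>u x\<bar> \<and> \<bar>u x\<bar> \<le> t}"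
      have split: "{x\<in>F. \<eta> / 2 ^ Suc k < \<bar>u x\<bar>} = {x\<in>F. \<eta> / 2 ^ k < \<bar>u x\<bar>} \<union> S"
        using t unfolding S_def t(3)[symmetric] t_def[symmetric] by auto
      have "(\<Sum>x\<in>S. \<bar>u x\<bar> powr p) \<le> (\<Sum>x\<in>S. t powr (p - 2) * (u x)\<^sup>2)"
        using p2 by (intro sum_mono abs_powr_le_sq) (auto simp: S_def)
      also have "\<dots> = t powr (p - 2) * (\<Sum>x\<in>S. (u x)\<^sup>2)"
        by (simp add: sum_distrib_left)
      also have "\<dots> \<le> t powr (p - 2) * (K * (t / 2) powr (- 4 / d) * ?G)"
      proof (rule mult_left_mono)
        show "(\<Sum>x\<in>S. (u x)\<^sup>2) \<le> K * (t / 2) powr (- 4 / d) * ?G"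
          unfolding K_def d_def using t F by (intro large_values_nash[OF u M]) (auto simp: S_def)
      qed simp
      also have "\<dots> = K * 2 powr (4 / d) * \<eta> powr \<gamma> * ?G * r ^ k"
      proof -
        have "t powr (p - 2) * (t / 2) powr (- 4 / d) = 2 powr (4 / d) * t powr \<gamma>"
        proof -
          have "(t / 2) powr (- 4 / d) = 2 powr (4 / d) * t powr (- 4 / d)"
            using t by (simp add: powr_divide powr_minus field_simps)
          moreover have "t powr (p - 2) * t powr (- 4 / d) = t powr \<gamma>"
            by (simp add: \<gamma>_def d_def flip: powr_add)
          ultimately show ?thesis by simp
        qed
        moreover have "t powr \<gamma> = \<eta> powr \<gamma> * r ^ k"
        proof -
          have "r ^ k = 2 powr (- \<gamma> * real k)"
            by (simp add: r_def powr_power mult.commute)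
          moreover have "t powr \<gamma> = \<eta> powr \<gamma> / (2 powr real k) powr \<gamma>"
            using \<eta>(1) by (simp add: t_def powr_divide powr_realpow)
          ultimately show ?thesis
            by (simp add: powr_powr powr_minus_divide mult.commute)
        qed
        ultimately have "t powr (p - 2) * (t / 2) powr (- 4 / d) = 2 powr (4 / d) * (\<eta> powr \<gamma> * r ^ k)"
          by simp
        then have "(t powr (p - 2) * (t / 2) powr (- 4 / d)) * (K * ?G) = 2 powr (4 / d) * (\<eta> powr \<gamma> * r ^ k) * (K * ?G)"
          by (rule arg_cong)
        then show ?thesis by (simp only: mult_ac)
      qed
      finally have "(\<Sum>x\<in>S. \<bar>u x\<bar> powr p) \<le> K * 2 powr (4 / d) * \<eta> powr \<gamma> * ?G * r ^ k" .
      moreover have "(\<Sum>x\<in>{x\<in>F. \<eta> / 2 ^ Suc k < \<bar>u x\<bar>}. \<bar>u x\<bar> powr p)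
          = (\<Sum>x\<in>{x\<in>F. \<eta> / 2 ^ k < \<bar>u x\<bar>}. \<bar>u x\<bar> powr p) + (\<Sum>x\<in>S. \<bar>u x\<bar> powr p)"
        unfolding split using F by (intro sum.union_disjoint) (auto simp: S_def t_def)
      ultimately show ?case
        using Suc by (simp add: distrib_left)
    qed
    have "(\<lambda>k. \<eta> / 2 ^ k) \<longlonglongrightarrow> 0"
      using tendsto_mult[OF tendsto_const LIMSEQ_power_zero[of "1 / 2 :: real"], of \<eta>]
      by (simp add: power_divide)
    then have "\<forall>\<^sub>F k in sequentially. u x \<noteq> 0 \<longrightarrow> \<eta> / 2 ^ k < \<bar>u x\<bar>" for x
      using order_tendstoD(2)[of "\<lambda>k. \<eta> / 2 ^ k" 0 sequentially "\<bar>u x\<bar>"] by (cases "u x = 0") auto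
    then have "\<forall>\<^sub>F k in sequentially. \<forall>x\<in>F. u x \<noteq> 0 \<longrightarrow> \<eta> / 2 ^ k < \<bar>u x\<bar>"
      using F by (intro eventually_ball_finite) auto
    \<comment> \<open>As \<open>F\<close> is finite, finitely many layers already contain all of its
      nonzero values.\<close>
    then obtain k where k: "\<forall>x\<in>F. u x \<noteq> 0 \<longrightarrow> \<eta> / 2 ^ k < \<bar>u x\<bar>"
      using eventually_happens'[OF sequentially_bot] by blast
    have "(\<Sum>x\<in>F. \<bar>u x\<bar> powr p) = (\<Sum>x\<in>{x\<in>F. \<eta> / 2 ^ k < \<bar>u x\<bar>}. \<bar>u x\<bar> powr p)"
      using F k by (intro sum.mono_neutral_right) auto
    also have "\<dots> \<le> K * 2 powr (4 / d) * \<eta> powr \<gamma> * ?G * (\<Sum>j<k. r ^ j)"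
      by (rule level)
    also have "\<dots> \<le> K * 2 powr (4 / d) * \<eta> powr \<gamma> * ?G * (1 / (1 - r))"
    proof (rule mult_left_mono)
      show "(\<Sum>j<k. r ^ j) \<le> 1 / (1 - r)"
        unfolding sum_gp_strict using r by (auto intro!: divide_right_mono)
    qed (use K in simp)
    also have "\<dots> = C * \<eta> powr \<gamma> * ?G"
      by (simp add: C_def K_def r_def d_def)
    finally show ?thesis .
  qed
  show ?thesis
    unfolding powsum_def using fin p2 by (intro infsum_le_finite_sums powr_summable u) auto
qed

text \<open>\<open>\<delta>\<close> is taken so small that the constant times
  \<open>\<delta> powr \<gamma>\<close> is at most 1. The conclusion contradicts the Nehari
  identity, where the power sum exceeds the gradient norm by \<open>\<omega>\<close> times the
  mass.\<close>

lemma small_sup_imp_powsum_le_grad: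
  assumes p: "2 + 4 / real CARD('d) < p" and M: "1 \<le> M"
  obtains \<delta> where "0 < \<delta>"
    "\<And>u :: int ^ 'd \<Rightarrow> real. u \<in> sq_summable \<Longrightarrow> sqsum u \<le> M \<Longrightarrow> (\<And>x. \<bar>u x\<bar> \<le> \<delta>) \<Longrightarrow>
      powsum p u \<le> grad_norm_sq u"
proof -
  define \<gamma> where "\<gamma> = p - 2 - 4 / real CARD('d)"
  define C where "C = 64 * (real CARD('d))\<^sup>2 * (8 * M) powr (2 / CARD('d)) * 2 powr (4 / CARD('d)) / (1 - 2 powr (- \<gamma>))"
  have \<gamma>: "0 < \<gamma>" using p by (simp add: \<gamma>_def)
  have "2 powr (- \<gamma>) < 1" using \<gamma> by (auto intro!: powr_less_one)
  then have C: "0 < C" using M by (simp add: C_def)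
  define \<delta> where "\<delta> = min 1 ((1 / C) powr (1 / \<gamma>))"
  have \<delta>: "0 < \<delta>" "\<delta> \<le> 1" using C by (simp_all add: \<delta>_def)
  have "\<delta> powr \<gamma> \<le> ((1 / C) powr (1 / \<gamma>)) powr \<gamma>"
    using \<delta> \<gamma> by (intro powr_mono2) (auto simp: \<delta>_def)
  also have "\<dots> = 1 / C" unfolding powr_powr using \<gamma> C by simp
  finally have C\<delta>: "C * \<delta> powr \<gamma> \<le> 1" using C by (simp add: field_simps)
  show thesis
  proof
    fix u :: "int ^ 'd \<Rightarrow> real"
    assume "u \<in> sq_summable" "sqsum u \<le> M" "\<And>x. \<bar>u x\<bar> \<le> \<delta>"
    then have "powsum p u \<le> C * \<delta> powr \<gamma> * grad_norm_sq u"
      unfolding C_def \<gamma>_def using p M \<delta> by (intro powsum_le_grad_of_small_sup) auto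
    also have "\<dots> \<le> grad_norm_sq u"
      using C\<delta> by (intro mult_left_le_one_le) (use C in auto)
    finally show "powsum p u \<le> grad_norm_sq u" .
  qed (rule \<delta>)
qed

section \<open>Small action and large mass\<close>

text \<open>Height and radius are both \<open>R\<close>, so the slope is 1: the gradient norm is at
  most of order \<open>R ^ d\<close>, the mass at most of order \<open>R ^ (d + 2)\<close>, and the
  power sum at least of order \<open>R powr (d + p)\<close>.\<close>

definition tent :: "nat \<Rightarrow> int ^ 'd \<Rightarrow> real" where
  "tent R x = max 0 (real R - real_of_int (lnorm x))"

lemma lnorm_le_imp_cube: "lnorm x \<le> k \<Longrightarrow> x \<in> cube (- k) (k + 1)"
  using abs_nth_le_lnorm[of x] unfolding cube_def by (smt (verit) mem_Collect_eq)

lemma tent_support: "{x :: int ^ 'd. tent R x \<noteq> 0} \<subseteq> cube (- int R) (int R + 1)"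
  by (intro subsetI lnorm_le_imp_cube) (auto simp: tent_def max_def split: if_splits)

lemma sq_summable_tent: "tent R \<in> sq_summable"
  by (rule sq_summable_finite_support[OF finite_subset[OF tent_support]]) simp

lemma tent_bounds: "0 \<le> tent R x" "tent R x \<le> real R"
proof -
  have "0 \<le> real_of_int (lnorm x)" by simp
  then show "0 \<le> tent R x" "tent R x \<le> real R" unfolding tent_def by linarith+
qed

lemma sqsum_tent_le:
  "sqsum (tent R :: int ^ 'd \<Rightarrow> real) \<le> real (2 * R + 1) ^ CARD('d) * (real R)\<^sup>2"
proof -
  have "sqsum (tent R :: int ^ 'd \<Rightarrow> real) = (\<Sum>x\<in>cube (- int R) (int R + 1). (tent R (x :: int ^ 'd))\<^sup>2)"
    by (rule sqsum_finite_support[OF finite_cube tent_support])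
  also have "\<dots> \<le> (\<Sum>x\<in>(cube (- int R) (int R + 1) :: (int ^ 'd) set). (real R)\<^sup>2)"
    by (intro sum_mono power_mono tent_bounds)
  also have "\<dots> = real (2 * R + 1) ^ CARD('d) * (real R)\<^sup>2"
  proof -
    have "nat (int R + 1 - - int R) = 2 * R + 1" by simp
    then show ?thesis by (simp add: card_cube)
  qed
  finally show ?thesis .
qed

lemma grad_norm_sq_tent_le:
  "grad_norm_sq (tent R :: int ^ 'd \<Rightarrow> real)
    \<le> real (card (unit_steps :: (int ^ 'd) set)) * real (2 * R + 3) ^ CARD('d)"
proof -
  have step: "sqsum (shift_diff e (tent R)) \<le> real (2 * R + 3) ^ CARD('d)" if e: "e \<in> unit_steps" for e :: "int ^ 'd"
  proof -
    \<comment> \<open>One layer larger than the support of the tent, since a difference can be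
      nonzero just outside it.\<close>
    let ?Q = "cube (- (int R + 1)) (int R + 1 + 1) :: (int ^ 'd) set"
    have tri: "lnorm x \<le> lnorm (x + e) + 1" "lnorm (x + e) \<le> lnorm x + 1" for x
      using lnorm_triangle[of "x + e" "- e"] lnorm_triangle[of x e] e by (auto simp: unit_steps_def)
    have tri': "real_of_int (lnorm x) \<le> real_of_int (lnorm (x + e)) + 1"
      "real_of_int (lnorm (x + e)) \<le> real_of_int (lnorm x) + 1" for x
      using tri[of x] by linarith+
    have "{x. shift_diff e (tent R) x \<noteq> 0} \<subseteq> ?Q"
    proof (intro subsetI lnorm_le_imp_cube)
      fix x assume "x \<in> {x. shift_diff e (tent R) x \<noteq> 0}"
      then have "real_of_int (lnorm x) < real R \<or> real_of_int (lnorm (x + e)) < real R"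
        by (auto simp: shift_diff_def tent_def max_def split: if_splits)
      then show "lnorm x \<le> int R + 1" using tri[of x] by linarith
    qed
    then have "sqsum (shift_diff e (tent R)) = (\<Sum>x\<in>?Q. (shift_diff e (tent R) x)\<^sup>2)"
      by (intro sqsum_finite_support finite_cube)
    also have "\<dots> \<le> (\<Sum>x\<in>?Q. 1)"
    proof (rule sum_mono)
      fix x :: "int ^ 'd"
      have "\<bar>shift_diff e (tent R) x\<bar> \<le> 1"
        using tri'[of x] unfolding shift_diff_def tent_def by linarith
      then show "(shift_diff e (tent R) x)\<^sup>2 \<le> 1" by (simp add: abs_square_le_1)
    qed
    also have "\<dots> = real (2 * R + 3) ^ CARD('d)"
    proof -
      have "nat (int R + 1 + 1 - - (int R + 1)) = 2 * R + 3" by simp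
      then show ?thesis by (simp add: card_cube)
    qed
    finally show ?thesis .
  qed
  have "grad_norm_sq (tent R :: int ^ 'd \<Rightarrow> real) \<le> 1 / 2 * (\<Sum>e\<in>(unit_steps :: (int ^ 'd) set). real (2 * R + 3) ^ CARD('d))"
    unfolding grad_norm_sq_eq[OF sq_summable_tent] by (intro mult_left_mono sum_mono step) auto
  also have "\<dots> = 1 / 2 * (real (card (unit_steps :: (int ^ 'd) set)) * real (2 * R + 3) ^ CARD('d))"
    by simp
  also have "\<dots> \<le> real (card (unit_steps :: (int ^ 'd) set)) * real (2 * R + 3) ^ CARD('d)"
    by (simp add: mult_le_cancel_right1)
  finally show ?thesis .
qed

text \<open>On the cube of side \<open>m\<close> the distance to the origin is at most
  \<open>CARD('d) * m\<close>. With twice that as radius, the tent keeps at least half of its height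
  there.\<close>

lemma powsum_tent_ge:
  assumes "2 \<le> p"
  shows "real m ^ CARD('d) * real (CARD('d) * m) powr p \<le> powsum p (tent (2 * CARD('d) * m) :: int ^ 'd \<Rightarrow> real)"
proof -
  let ?R = "2 * CARD('d) * m" and ?Q = "cube 0 (int m) :: (int ^ 'd) set"
  have "real m ^ CARD('d) * real (CARD('d) * m) powr p = (\<Sum>x\<in>?Q. real (CARD('d) * m) powr p)"
    by (simp add: card_cube)
  also have "\<dots> \<le> (\<Sum>x\<in>?Q. \<bar>tent ?R x\<bar> powr p)"
  proof (rule sum_mono)
    fix x :: "int ^ 'd" assume "x \<in> ?Q"
    from lnorm_cube_le[OF this] have "real_of_int (lnorm x) \<le> real_of_int (int CARD('d) * int m)"
      by (simp only: of_int_le_iff)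
    then have "real (CARD('d) * m) \<le> \<bar>tent ?R x\<bar>"
      by (simp add: tent_def)
    then show "real (CARD('d) * m) powr p \<le> \<bar>tent ?R x\<bar> powr p"
      using assms by (intro powr_mono2) auto
  qed
  also have "\<dots> \<le> powsum p (tent ?R :: int ^ 'd \<Rightarrow> real)"
    unfolding powsum_def by (intro finite_sum_le_infsum powr_summable sq_summable_tent assms) auto
  finally show ?thesis .
qed

text \<open>With \<open>\<omega>\<close> at most the inverse square of the radius, the mass term is
  of the same order as the gradient term. Both side lengths, \<open>2 * R + 1\<close> and
  \<open>2 * R + 3\<close>, are bounded by \<open>5 * R\<close>.\<close>

lemma quad_form_tent_le:
  assumes m: "1 \<le> m" and \<omega>: "0 < \<omega>" "\<omega> \<le> 1 / (real (2 * CARD('d) * m))\<^sup>2"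
  shows "quad_form \<omega> (tent (2 * CARD('d) * m) :: int ^ 'd \<Rightarrow> real)
    \<le> (real (card (unit_steps :: (int ^ 'd) set)) + 1) * (10 * real CARD('d) * real m) ^ CARD('d)"
proof -
  define R where "R = 2 * CARD('d) * m"
  define s where "s = real (card (unit_steps :: (int ^ 'd) set))"
  have R: "2 \<le> R" using m by (simp add: R_def Suc_le_eq)
  have "\<omega> * sqsum (tent R :: int ^ 'd \<Rightarrow> real) \<le> 1 / (real R)\<^sup>2 * (real (2 * R + 1) ^ CARD('d) * (real R)\<^sup>2)"
    using \<omega> sqsum_tent_le[of R] unfolding R_def[symmetric] by (intro mult_mono) auto
  also have "\<dots> = real (2 * R + 1) ^ CARD('d)" using R by simp
  also have "\<dots> \<le> (5 * real R) ^ CARD('d)" using R by (intro power_mono) auto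
  finally have 1: "\<omega> * sqsum (tent R :: int ^ 'd \<Rightarrow> real) \<le> (5 * real R) ^ CARD('d)" .
  have "grad_norm_sq (tent R :: int ^ 'd \<Rightarrow> real) \<le> s * real (2 * R + 3) ^ CARD('d)"
    unfolding s_def by (rule grad_norm_sq_tent_le)
  also have "\<dots> \<le> s * (5 * real R) ^ CARD('d)"
    using R by (intro mult_left_mono power_mono) (auto simp: s_def)
  finally have "quad_form \<omega> (tent R :: int ^ 'd \<Rightarrow> real) \<le> (s + 1) * (5 * real R) ^ CARD('d)"
    using 1 by (simp add: quad_form_def distrib_right)
  also have "5 * real R = 10 * real CARD('d) * real m" by (simp add: R_def)
  finally show ?thesis by (simp add: R_def s_def)
qed

text \<open>The elements are tents of radius comparable to \<open>\<omega>0 powr (- 1 / 2)\<close>, rescaled to the Nehari manifold.\<close>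

lemma nehari_small_element:
  assumes p: "2 < p" "p * (real CARD('d) - 2) < 2 * real CARD('d)" and \<epsilon>: "0 < \<epsilon>"
  obtains \<omega>0 where "0 < \<omega>0"
    "\<And>\<omega>. 0 < \<omega> \<Longrightarrow> \<omega> \<le> \<omega>0 \<Longrightarrow> \<exists>y :: int ^ 'd \<Rightarrow> real. y \<in> nehari p \<omega> \<and> powsum p y \<le> \<epsilon>"
proof -
  define d where "d = real CARD('d)"
  have d: "0 < d" by (simp add: d_def)
  define s where "s = real (card (unit_steps :: (int ^ 'd) set)) + 1"
  have s: "0 < s" by (simp add: s_def)
  \<comment> \<open>The rescaled tent has a power sum \<open>Q\<close> with
    \<open>Q powr (p - 2) = A powr p / P\<^sup>2\<close>. With \<open>A\<close> at most of order
    \<open>m powr d\<close> and \<open>P\<close> at least of order \<open>m powr (d + p)\<close>,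
    this is at most of order \<open>m powr (- \<beta>)\<close>, and \<open>\<beta> > 0\<close> is
    exactly the subcriticality of \<open>p\<close>.\<close>
  define \<beta> where "\<beta> = 2 * d + 2 * p - d * p"
  have \<beta>: "0 < \<beta>" using p by (simp add: \<beta>_def d_def algebra_simps)
  define C where "C = (s * (10 * d) powr d) powr p / (d powr p)\<^sup>2"
  have "(\<lambda>m. C * real m powr (- \<beta>)) \<longlonglongrightarrow> C * 0"
    using \<beta> by (intro tendsto_mult tendsto_const tendsto_neg_powr filterlim_real_sequentially) auto
  then have "\<forall>\<^sub>F m in sequentially. C * real m powr (- \<beta>) < \<epsilon> powr (p - 2)"
    using order_tendstoD(2)[of "\<lambda>m. C * real m powr (- \<beta>)" 0 sequentially "\<epsilon> powr (p - 2)"] \<epsilon> by simp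
  then have "\<forall>\<^sub>F m in sequentially. C * real m powr (- \<beta>) < \<epsilon> powr (p - 2) \<and> 1 \<le> m"
    using eventually_ge_at_top[of 1] by (rule eventually_conj)
  then obtain m :: nat where m: "C * real m powr (- \<beta>) < \<epsilon> powr (p - 2)" "1 \<le> m"
    using eventually_happens'[OF sequentially_bot] by blast
  define \<omega>0 where "\<omega>0 = 1 / (real (2 * CARD('d) * m))\<^sup>2"
  have \<omega>0: "0 < \<omega>0" using m by (simp add: \<omega>0_def)
  have "\<exists>y :: int ^ 'd \<Rightarrow> real. y \<in> nehari p \<omega> \<and> powsum p y \<le> \<epsilon>" if \<omega>: "0 < \<omega>" "\<omega> \<le> \<omega>0" for \<omega>
  proof -
    define v :: "int ^ 'd \<Rightarrow> real" where "v = tent (2 * CARD('d) * m)"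
    define A P where "A = quad_form \<omega> v" and "P = powsum p v"
    have Ale: "A \<le> s * (10 * d * real m) powr d"
      unfolding A_def s_def v_def d_def using quad_form_tent_le[OF m(2) \<omega>[unfolded \<omega>0_def]] m
      by (simp add: powr_realpow)
    have Pge: "real m powr d * (d * real m) powr p \<le> P"
      unfolding P_def v_def d_def using powsum_tent_ge[of p m, where 'd = 'd] p m
      by (simp add: powr_realpow)
    have mp: "0 < real m" using m by simp
    have P0: "0 < real m powr d * (d * real m) powr p" using mp d by simp
    then have P: "0 < P" using Pge by linarith
    have v0: "v \<noteq> (\<lambda>x. 0)" using P by (auto simp: P_def powsum_def)
    have vs: "v \<in> sq_summable" unfolding v_def by (rule sq_summable_tent)
    have A: "0 < A" unfolding A_def using \<omega>(1) vs v0 by (rule quad_form_pos)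
    define t where "t = (A / P) powr (1 / (p - 2))"
    have t: "0 < t" "(\<lambda>x. t * v x) \<in> nehari p \<omega>"
      using nehari_scaling[OF p(1) \<omega>(1) vs v0] by (simp_all add: t_def A_def P_def)
    define Q where "Q = powsum p (\<lambda>x. t * v x)"
    have Q: "Q = t powr p * P" using t(1) by (simp add: Q_def P_def powsum_cmult)
    have "Q powr (p - 2) = (A / P) powr p * P powr (p - 2)"
    proof -
      have "1 / (p - 2) * p * (p - 2) = p" using p by simp
      then have "(t powr p) powr (p - 2) = (A / P) powr p"
        by (simp only: t_def powr_powr)
      then show ?thesis using P by (simp add: Q powr_mult)
    qed
    also have "\<dots> = A powr p / P\<^sup>2"
      using A P by (simp add: powr_divide powr_diff)
    also have "\<dots> \<le> (s * (10 * d * real m) powr d) powr p / (real m powr d * (d * real m) powr p)\<^sup>2"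
      using A Ale P0 Pge p mp by (intro frac_le powr_mono2 power_mono) auto
    also have "\<dots> = C * real m powr (- \<beta>)"
    proof -
      have "(s * (10 * d * real m) powr d) powr p = (s * (10 * d) powr d) powr p * real m powr (d * p)"
        using s d mp by (simp add: powr_mult powr_powr)
      moreover have "(real m powr d * (d * real m) powr p)\<^sup>2 = (d powr p)\<^sup>2 * real m powr (2 * d + 2 * p)"
      proof -
        have "(real m powr d * (d * real m) powr p)\<^sup>2 = (d powr p)\<^sup>2 * ((real m powr d)\<^sup>2 * (real m powr p)\<^sup>2)"
          using d mp by (simp add: powr_mult power_mult_distrib)
        also have "(real m powr d)\<^sup>2 * (real m powr p)\<^sup>2 = real m powr (2 * d + 2 * p)"
          using mp by (simp add: powr_power powr_add mult.commute)
        finally show ?thesis .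
      qed
      moreover have "real m powr (- \<beta>) = real m powr (d * p) / real m powr (2 * d + 2 * p)"
        using mp by (simp add: \<beta>_def flip: powr_diff)
      ultimately show ?thesis by (simp add: C_def)
    qed
    also have "\<dots> < \<epsilon> powr (p - 2)" by (rule m(1))
    finally have "Q powr (p - 2) < \<epsilon> powr (p - 2)" .
    then have "Q \<le> \<epsilon>"
      using powr_mono2[of "p - 2" \<epsilon> Q] p \<epsilon> by (cases "Q \<le> \<epsilon>") auto
    then show ?thesis using t(2) unfolding Q_def by blast
  qed
  then show thesis using that \<omega>0 by blast
qed

lemma action_ground_state_mass_large:
  assumes p: "2 + 4 / real CARD('d) < p" "p * (real CARD('d) - 2) < 2 * real CARD('d)"
  obtains \<omega>0 where "0 < \<omega>0"
    "\<And>\<omega> u. 0 < \<omega> \<Longrightarrow> \<omega> \<le> \<omega>0 \<Longrightarrow> action_ground_state p \<omega> (u :: int ^ 'd \<Rightarrow> real) \<Longrightarrow> K < sqsum u"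
proof -
  have p2: "2 < p" using p(1) by (rule less_trans[rotated]) simp
  obtain \<delta> where \<delta>: "0 < \<delta>" and small: "\<And>u :: int ^ 'd \<Rightarrow> real. u \<in> sq_summable \<Longrightarrow> sqsum u \<le> max 1 K \<Longrightarrow>
      (\<And>x. \<bar>u x\<bar> \<le> \<delta>) \<Longrightarrow> powsum p u \<le> grad_norm_sq u"
    using small_sup_imp_powsum_le_grad[OF p(1), of "max 1 K"] by auto
  \<comment> \<open>The target \<open>\<delta> powr p\<close> is chosen because a power sum below it
    forces every value to be at most \<open>\<delta>\<close>.\<close>
  obtain \<omega>0 where \<omega>0: "0 < \<omega>0" and ex: "\<And>\<omega>. 0 < \<omega> \<Longrightarrow> \<omega> \<le> \<omega>0 \<Longrightarrow>
      \<exists>y :: int ^ 'd \<Rightarrow> real. y \<in> nehari p \<omega> \<and> powsum p y \<le> \<delta> powr p"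
    using nehari_small_element[OF p2 p(2), of "\<delta> powr p"] \<delta> by auto
  have "K < sqsum u" if \<omega>: "0 < \<omega>" "\<omega> \<le> \<omega>0" and gs: "action_ground_state p \<omega> u" for \<omega> and u :: "int ^ 'd \<Rightarrow> real"
  proof (rule ccontr)
    assume "\<not> K < sqsum u"
    then have K: "sqsum u \<le> max 1 K" by simp
    have uN: "u \<in> nehari p \<omega>" and min: "\<And>y :: int ^ 'd \<Rightarrow> real. y \<in> nehari p \<omega> \<Longrightarrow> powsum p u \<le> powsum p y"
      using gs p2 by (auto simp: action_ground_state_iff)
    have u: "u \<in> sq_summable" "u \<noteq> (\<lambda>x. 0)" "grad_norm_sq u + \<omega> * sqsum u = powsum p u"
      using uN p2 by (auto simp: nehari_iff)
    have P: "powsum p u \<le> \<delta> powr p" using ex[OF \<omega>] min order_trans by blast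
    have "\<bar>u x\<bar> \<le> \<delta>" for x
    proof (rule ccontr)
      assume "\<not> \<bar>u x\<bar> \<le> \<delta>"
      then have "\<delta> powr p < \<bar>u x\<bar> powr p" using \<delta> p2 by (intro powr_less_mono2) auto
      also have "\<dots> \<le> powsum p u" using p2 by (intro abs_powr_le_powsum u) auto
      finally show False using P by simp
    qed
    then have "powsum p u \<le> grad_norm_sq u" using small u(1) K by blast
    moreover have "0 < \<omega> * sqsum u" using \<omega> sqsum_pos[OF u(1,2)] by simp
    ultimately show False using u(3) by linarith
  qed
  then show thesis using that \<omega>0 by blast
qed

section \<open>Comparison with a point mass, multipliers and conclusion\<close>

lemma energy_concentrated_le:
  assumes p: "2 < p" and \<mu>: "0 < \<mu>"
  defines "w \<equiv> (\<lambda>x. sqrt \<mu> * point_mass (0 :: int ^ 'd) x)"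
  shows "w \<in> sq_summable" "sqsum w = \<mu>"
    "energy p w \<le> real (card (unit_steps :: (int ^ 'd) set)) * \<mu> - \<mu> powr (p / 2) / p"
proof -
  show "w \<in> sq_summable" "sqsum w = \<mu>"
    using \<mu> by (simp_all add: w_def sq_summable_cmult sqsum_cmult)
  have "grad_norm_sq (point_mass (0 :: int ^ 'd)) \<le> 2 * real (card (unit_steps :: (int ^ 'd) set))"
    using grad_norm_sq_le[OF sq_summable_point_mass, of "0 :: int ^ 'd"] by simp
  then have "\<mu> / 2 * grad_norm_sq (point_mass (0 :: int ^ 'd)) \<le> \<mu> / 2 * (2 * real (card (unit_steps :: (int ^ 'd) set)))"
    using \<mu> by (intro mult_left_mono) auto
  then show "energy p w \<le> real (card (unit_steps :: (int ^ 'd) set)) * \<mu> - \<mu> powr (p / 2) / p"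
    unfolding w_def using p \<mu> by (simp add: energy_scale mult.commute)
qed

text \<open>Minimality against the concentrated function bounds the power sum of \<open>u\<close>
  from below; the gradient of the point mass costs \<open>p * s\<close> per unit mass, with
  \<open>s\<close> the number of unit steps. The gradient of \<open>u\<close> itself costs another
  \<open>2 * s\<close>, hence \<open>p + 2\<close>.\<close>

lemma multiplier_energy_ground_state:
  fixes u :: "int ^ 'd \<Rightarrow> real"
  assumes p: "2 < p" and \<mu>: "0 < \<mu>" and gs: "energy_ground_state p \<mu> u"
  shows "\<mu> powr (p / 2 - 1) - (p + 2) * real (card (unit_steps :: (int ^ 'd) set)) \<le> multiplier p u"
proof -
  define s where "s = real (card (unit_steps :: (int ^ 'd) set))"
  have u: "u \<in> sq_summable" "sqsum u = \<mu>"
    and min: "\<And>w :: int ^ 'd \<Rightarrow> real. w \<in> sq_summable \<Longrightarrow> sqsum w = \<mu> \<Longrightarrow> energy p u \<le> energy p w"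
    using gs by (auto simp: energy_ground_state_def H1_mass_iff)
  have "energy p u \<le> s * \<mu> - \<mu> powr (p / 2) / p"
    unfolding s_def
    using order_trans[OF min[OF energy_concentrated_le(1,2)[OF p \<mu>]] energy_concentrated_le(3)[OF p \<mu>]] .
  then have "p * energy p u \<le> p * (s * \<mu> - \<mu> powr (p / 2) / p)"
    using p by (intro mult_left_mono) auto
  then have "\<mu> powr (p / 2) - p * s * \<mu> \<le> - p * energy p u"
    using p by (simp add: right_diff_distrib)
  also have "\<dots> \<le> powsum p u" using p by (intro powsum_ge_energy) simp
  finally have 1: "\<mu> powr (p / 2) - p * s * \<mu> \<le> powsum p u" .
  have 2: "grad_norm_sq u \<le> 2 * s * \<mu>"
    using grad_norm_sq_le[OF u(1)] u(2) by (simp add: s_def)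
  have "\<mu> powr (p / 2) = \<mu> powr (p / 2 - 1) * \<mu>"
    using \<mu> by (simp add: powr_diff)
  with 1 2 have "(\<mu> powr (p / 2 - 1) - (p + 2) * s) * \<mu> \<le> powsum p u - grad_norm_sq u"
    by (simp add: algebra_simps)
  then show ?thesis
    using p \<mu> u(2) by (simp add: multiplier_eq pos_le_divide_eq s_def)
qed

lemma multiplier_nehari:
  assumes "0 < p" "u \<in> nehari p \<omega>"
  shows "multiplier p u = \<omega>"
proof -
  have u: "u \<in> sq_summable" "u \<noteq> (\<lambda>x. 0)" "grad_norm_sq u + \<omega> * sqsum u = powsum p u"
    using assms by (auto simp: nehari_iff)
  have "powsum p u - grad_norm_sq u = \<omega> * sqsum u" using u(3) by simp
  then show ?thesis using sqsum_pos[OF u(1,2)] assms by (simp add: multiplier_eq)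
qed

text \<open>The parameter \<open>k\<close> controls both limits at once: the mass is at least
  \<open>k\<close> and the multiplier of \<open>u2\<close> at most \<open>1 / k\<close>. The mass is
  read off from \<open>u2\<close>, and \<open>u1\<close> is built afterwards at that mass.\<close>

lemma two_critical_points:
  assumes p: "2 + 4 / real CARD('d) < p" "p * (real CARD('d) - 2) < 2 * real CARD('d)" and k: "1 \<le> k"
  obtains \<mu> :: real and u1 u2 :: "int ^ 'd \<Rightarrow> real" and \<omega> :: real where
    "k \<le> \<mu>" "0 < \<omega>" "\<omega> \<le> 1 / k"
    "positive_fun u1" "energy_critical_point p \<mu> u1" "energy_ground_state p \<mu> u1"
    "positive_fun u2" "energy_critical_point p \<mu> u2" "action_ground_state p \<omega> u2"
    "energy p u1 < energy p u2"
    "\<mu> powr (p / 2 - 1) - (p + 2) * real (card (unit_steps :: (int ^ 'd) set)) \<le> multiplier p u1"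
    "multiplier p u2 = \<omega>"
proof -
  have p2: "2 < p" using p(1) by (rule less_trans[rotated]) simp
  define s where "s = real (card (unit_steps :: (int ^ 'd) set))"
  have s: "0 \<le> s" by (simp add: s_def)
  \<comment> \<open>Mass above the second entry gives
    \<open>\<mu> powr (p / 2 - 1) \<ge> (p + 2) * s + 2\<close>. This makes the energy of the point
    mass negative and the multiplier of every energy ground state at least 2, while
    \<open>\<omega> \<le> 1\<close>.\<close>
  define B where "B = max k (((p + 2) * s + 2) powr (1 / (p / 2 - 1)))"
  obtain \<omega>0 where \<omega>0: "0 < \<omega>0" and big: "\<And>\<omega> u. 0 < \<omega> \<Longrightarrow> \<omega> \<le> \<omega>0 \<Longrightarrow>
      action_ground_state p \<omega> (u :: int ^ 'd \<Rightarrow> real) \<Longrightarrow> B < sqsum u"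
    using action_ground_state_mass_large[OF p] by blast
  define \<omega> where "\<omega> = min \<omega>0 (1 / k)"
  have \<omega>: "0 < \<omega>" "\<omega> \<le> \<omega>0" "\<omega> \<le> 1 / k" using \<omega>0 k by (auto simp: \<omega>_def)
  obtain u2 :: "int ^ 'd \<Rightarrow> real" where gs2: "action_ground_state p \<omega> u2" and nn2: "\<And>x. 0 \<le> u2 x"
    using action_ground_state_exists[OF p2 \<omega>(1)] by blast
  have u2N: "u2 \<in> nehari p \<omega>" using gs2 by (simp add: action_ground_state_def)
  then have u2: "u2 \<in> sq_summable" "u2 \<noteq> (\<lambda>x. 0)" using p2 by (auto simp: nehari_iff)
  define \<mu> where "\<mu> = sqsum u2"
  have B: "B < \<mu>" unfolding \<mu>_def by (rule big[OF \<omega>(1,2) gs2])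
  have \<mu>k: "k \<le> \<mu>" using B by (simp add: B_def)
  have \<mu>: "0 < \<mu>" using \<mu>k k by linarith
  have "(p + 2) * s + 2 = (((p + 2) * s + 2) powr (1 / (p / 2 - 1))) powr (p / 2 - 1)"
  proof -
    have "1 / (p / 2 - 1) * (p / 2 - 1) = 1" using p2 by simp
    moreover have "0 \<le> (p + 2) * s + 2" using p2 s by simp
    ultimately show ?thesis by (simp only: powr_powr powr_one)
  qed
  also have "\<dots> \<le> \<mu> powr (p / 2 - 1)"
    using B p2 by (intro powr_mono2) (auto simp: B_def)
  finally have \<mu>B: "(p + 2) * s + 2 \<le> \<mu> powr (p / 2 - 1)" .
  have "energy p (\<lambda>x. sqrt \<mu> * point_mass (0 :: int ^ 'd) x) < 0"
  proof -
    have "p * s < \<mu> powr (p / 2 - 1)" using \<mu>B s by (simp add: distrib_right)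
    then have "p * s * \<mu> < \<mu> powr (p / 2 - 1) * \<mu>" using \<mu> by simp
    also have "\<mu> powr (p / 2 - 1) * \<mu> = \<mu> powr (p / 2)" using \<mu> by (simp add: powr_diff)
    finally have "s * \<mu> - \<mu> powr (p / 2) / p < 0" using p2 by (simp add: field_simps)
    then show ?thesis using energy_concentrated_le(3)[OF p2 \<mu>] unfolding s_def by (rule le_less_trans[rotated])
  qed
  then obtain u1 :: "int ^ 'd \<Rightarrow> real" where gs1: "energy_ground_state p \<mu> u1" and nn1: "\<And>x. 0 \<le> u1 x"
    using energy_ground_state_exists[OF p2 \<mu> energy_concentrated_le(1,2)[OF p2 \<mu>]] by blast
  have u1: "u1 \<in> sq_summable" "sqsum u1 = \<mu>" using gs1 by (auto simp: energy_ground_state_def H1_mass_iff)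
  then have u10: "u1 \<noteq> (\<lambda>x. 0)" using \<mu> by (auto simp: sqsum_def)
  have m2: "multiplier p u2 = \<omega>" using p2 u2N by (intro multiplier_nehari) auto
  have u2\<mu>: "u2 \<in> H1_mass \<mu>" using u2 by (simp add: H1_mass_iff \<mu>_def)
  \<comment> \<open>Equality would make \<open>u2\<close> an energy ground state, whose multiplier
    is then at least 2; but that multiplier is \<open>\<omega> \<le> 1\<close>.\<close>
  have "energy p u1 \<noteq> energy p u2"
  proof
    assume "energy p u1 = energy p u2"
    then have "energy_ground_state p \<mu> u2"
      using gs1 u2\<mu> by (simp add: energy_ground_state_def)
    from multiplier_energy_ground_state[OF p2 \<mu> this]
    have "2 \<le> \<omega>" using \<mu>B unfolding m2 s_def by linarith
    moreover have "1 / k \<le> 1" using k by simp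
    ultimately show False using \<omega>(3) by linarith
  qed
  moreover have "energy p u1 \<le> energy p u2"
    using gs1 u2\<mu> by (simp add: energy_ground_state_def)
  ultimately have "energy p u1 < energy p u2" by simp
  moreover have d1: "\<And>v. v \<in> sq_summable \<Longrightarrow> pairing u1 v = 0 \<Longrightarrow> energy_differential p u1 v = 0"
    using energy_ground_state_differential[OF p2 \<mu> gs1] .
  moreover have d2: "\<And>v. v \<in> sq_summable \<Longrightarrow> pairing u2 v = 0 \<Longrightarrow> energy_differential p u2 v = 0"
    using action_ground_state_differential[OF p2 \<omega>(1) gs2] .
  moreover have "positive_fun u1" by (rule critical_nonneg_imp_positive[OF u1(1) u10 nn1 d1])
  moreover have "positive_fun u2" by (rule critical_nonneg_imp_positive[OF u2 nn2 d2])
  moreover have "energy_critical_point p \<mu> u1" by (rule energy_critical_pointI[OF p2 u1 d1])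
  moreover have "energy_critical_point p \<mu> u2" by (rule energy_critical_pointI[OF p2 u2(1) \<mu>_def[symmetric] d2])
  ultimately show thesis
    using that[OF \<mu>k \<omega>(1,3)] gs1 gs2 multiplier_energy_ground_state[OF p2 \<mu> gs1] m2 by blast
qed

lemma ground_energy_eq:
  fixes u :: "int ^ 'd \<Rightarrow> real"
  assumes "energy_ground_state p \<mu> u"
  shows "ground_energy p TYPE('d) \<mu> = energy p u"
  unfolding ground_energy_def
proof (rule cInf_eq_minimum)
  show "energy p u \<in> energy p ` (H1_mass \<mu> :: (int ^ 'd \<Rightarrow> real) set)"
    using assms by (auto simp: energy_ground_state_def)
  show "energy p u \<le> x" if "x \<in> energy p ` (H1_mass \<mu> :: (int ^ 'd \<Rightarrow> real) set)" for x
    using assms that by (auto simp: energy_ground_state_def)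
qed

text \<open>Clearing the denominator puts both cases of the Sobolev exponent into one inequality;
  for \<open>d = 2\<close> the left-hand side is 0.\<close>

lemma subcritical_iff:
  assumes "2 \<le> d" "ereal p < sobolev_exponent d"
  shows "p * (real d - 2) < 2 * real d"
proof (cases "d = 2")
  case False
  then have "0 < real d - 2" "p < 2 * real d / (real d - 2)"
    using assms by (auto simp: sobolev_exponent_def)
  then show ?thesis by (simp add: pos_less_divide_eq)
qed simp

theorem theorem1p6:
  fixes p :: real
  assumes "CARD('d::finite) \<ge> 2"
    and "2 + 4 / real CARD('d) < p"
    and "ereal p < sobolev_exponent CARD('d)"
  shows "\<exists>(\<mu> :: nat \<Rightarrow> real) (u1 :: nat \<Rightarrow> int ^ 'd \<Rightarrow> real) (u2 :: nat \<Rightarrow> int ^ 'd \<Rightarrow> real).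
    (\<forall>n\<ge>1. \<mu> n > 0) \<and>
    filterlim \<mu> at_top sequentially \<and>
    (\<forall>n\<ge>1.
       u1 n \<noteq> u2 n \<and>
       positive_fun (u1 n) \<and> energy_critical_point p (\<mu> n) (u1 n) \<and>
       positive_fun (u2 n) \<and> energy_critical_point p (\<mu> n) (u2 n) \<and>
       energy_ground_state p (\<mu> n) (u1 n) \<and>
       (\<exists>\<omega>>0. action_ground_state p \<omega> (u2 n)) \<and>
       energy p (u2 n) > energy p (u1 n) \<and>
       energy p (u1 n) = ground_energy p TYPE('d) (\<mu> n)) \<and>
    filterlim (\<lambda>n. multiplier p (u1 n)) at_top sequentially \<and>
    ((\<lambda>n. multiplier p (u2 n)) \<longlonglongrightarrow> 0)"
proof -
  have sub: "p * (real CARD('d) - 2) < 2 * real CARD('d)"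
    using assms(1,3) by (rule subcritical_iff)
  have p2: "2 < p" using assms(2) by (rule less_trans[rotated]) simp
  define c where "c = (p + 2) * real (card (unit_steps :: (int ^ 'd) set))"
  define Q where "Q k \<mu> u1 u2 \<omega> \<longleftrightarrow> k \<le> \<mu> \<and> 0 < \<omega> \<and> \<omega> \<le> 1 / k \<and>
    positive_fun u1 \<and> energy_critical_point p \<mu> u1 \<and> energy_ground_state p \<mu> u1 \<and>
    positive_fun u2 \<and> energy_critical_point p \<mu> u2 \<and> action_ground_state p \<omega> u2 \<and>
    energy p u1 < energy p u2 \<and> \<mu> powr (p / 2 - 1) - c \<le> multiplier p u1 \<and> multiplier p u2 = \<omega>"
    for k \<mu> \<omega> :: real and u1 u2 :: "int ^ 'd \<Rightarrow> real"
  \<comment> \<open>The shift to \<open>Suc n\<close> meets the requirement \<open>1 \<le> k\<close>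
    also at index 0, so the properties hold for every \<open>n\<close>.\<close>
  have "\<exists>\<mu> u1 u2 \<omega>. Q (real (Suc n)) \<mu> u1 u2 \<omega>" for n
    using two_critical_points[OF assms(2) sub, of "real (Suc n)"] unfolding Q_def c_def by fastforce
  then obtain \<mu> u1 u2 \<omega> where Q: "\<And>n. Q (real (Suc n)) (\<mu> n) (u1 n) (u2 n) (\<omega> n)" by metis
  have \<mu>ge: "real (Suc n) \<le> \<mu> n" for n using Q[of n] by (simp add: Q_def)
  have \<mu>pos: "0 < \<mu> n" for n using \<mu>ge[of n] by (simp add: less_le_trans[OF _ \<mu>ge])
  have \<mu>lim: "filterlim \<mu> at_top sequentially"
    by (rule filterlim_at_top_mono[OF filterlim_compose[OF filterlim_real_sequentially filterlim_Suc]])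
      (use \<mu>ge in auto)
  have "filterlim (\<lambda>n. \<mu> n powr (p / 2 - 1)) at_top sequentially"
    using p2 by (intro filterlim_compose[OF _ \<mu>lim] real_powr_at_top) simp
  then have "filterlim (\<lambda>n. - c + \<mu> n powr (p / 2 - 1)) at_top sequentially"
    by (rule filterlim_tendsto_add_at_top[OF tendsto_const])
  then have m1: "filterlim (\<lambda>n. multiplier p (u1 n)) at_top sequentially"
    by (rule filterlim_at_top_mono) (use Q in \<open>auto simp: Q_def\<close>)
  have "(\<lambda>n. multiplier p (u2 n)) \<longlonglongrightarrow> 0"
  proof (rule tendsto_sandwich[OF _ _ tendsto_const LIMSEQ_inverse_real_of_nat])
    show "\<forall>\<^sub>F n in sequentially. 0 \<le> multiplier p (u2 n)"
      using Q by (auto simp: Q_def less_imp_le)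
    show "\<forall>\<^sub>F n in sequentially. multiplier p (u2 n) \<le> inverse (real (Suc n))"
      using Q by (auto simp: Q_def inverse_eq_divide)
  qed
  moreover have "u1 n \<noteq> u2 n \<and>
       positive_fun (u1 n) \<and> energy_critical_point p (\<mu> n) (u1 n) \<and>
       positive_fun (u2 n) \<and> energy_critical_point p (\<mu> n) (u2 n) \<and>
       energy_ground_state p (\<mu> n) (u1 n) \<and>
       (\<exists>\<omega>>0. action_ground_state p \<omega> (u2 n)) \<and>
       energy p (u2 n) > energy p (u1 n) \<and>
       energy p (u1 n) = ground_energy p TYPE('d) (\<mu> n)" for n
    \<comment> \<open>Distinctness of the two functions follows from the strict inequality of their
      energies.\<close>
    using Q[of n] ground_energy_eq[of p "\<mu> n" "u1 n"] unfolding Q_def by auto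
  ultimately show ?thesis using \<mu>pos \<mu>lim m1 by blast
qed

end
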